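(* Let $\vec F(x,u,t)={}^t(F_1(x,t)-u,F_2(x,t),\dots,F_k(x,t))$ be the deformation described in the context, with discriminant $D\subset S$, and let $P(s)$ and $T(t)$ be the matrices defined there. 1. The discriminant set of the deformation of projection $X_t=\{(x,u):\vec F(x,u,t)=0\}$ is given by $$D=\{s\in S:\det(P(s))=0\}.$$ 2. (For real data, $s=(u,t)$ real with $|s|$ small enough.) The number of positive critical points of $F_1(x,t)-u$ on $F_2(x,t)=\dots=F_k(x,t)=0$, $x\in\tilde X\cap\mathbb R^n$, minus the number of negative critical points of $F_1(x,t)-u$ on $F_2(x,t)=\dots=F_k(x,t)=0$, $x\in\tilde X\cap\mathbb R^n$, equals $$sign\,(P(s)\cdot T(t)).$$
   Context: Setting. $X=(\mathbb C^{n+1},0)$ with coordinates $(x,u)$, $S=(\mathbb C^\mu,0)$ with coordinates $s=(u,t)$, $t=(t_1,\dots,t_\tau)$, $\mu=\tau+1$. For $\vec f(x,u)\in(\mathcal O_X)^k$ put $Q_f=(\mathcal O_X)^k/\big(\mathcal O_X\langle\partial\vec f/\partial x_1,\dots,\partial\vec f/\partial x_n\rangle+\vec f^{*}(m_{\mathbb C^k,0})(\mathcal O_X)^k\big)$, assumed to satisfy $0<\mu=\dim_{\mathbb C}Q_f<\infty$. The deformation is $$\vec F(x,s)=\vec f^{(0)}(x)+\sum_{\ell=1}^\tau t_\ell\vec e_\ell(x)+u\vec e_0={}^t(F_1(x,t)-u,F_2(x,t),\dots,F_k(x,t)),$$ a miniversal deformation of $\vec f^{(0)}(x)=\vec f(x,0)=(f_1(x),\dots,f_k(x))$,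 with $\vec e_0={}^t(-1,0,\dots,0)$, $\vec e_0,\dots,\vec e_\tau$ representing a basis of $Q_f$ and $\vec f(x,u)=\vec F(x,u,0)$. $D$ is the image in $S$ of $Cr(\vec F)=\{(x,s):\vec F(x,s)=0,\ \operatorname{rank}(\partial\vec F/\partial x_1,\dots,\partial\vec F/\partial x_n)<k\}$ under $(x,s)\mapsto s$. It is assumed that $|s|$ is small enough, and $\tilde X=\{x\in\mathbb C^n:|x|\le\delta\}$ is a closed ball such that all critical points of $F_1(x,t)-u$ on $F_2(x,t)=\dots=F_k(x,t)=0$ are located inside $\tilde X$. Let $I_{C_0}(t)\subset\mathcal O_{\tilde X\times S}$ be the ideal generated by the $k\times k$ minors of $(\partial\vec F(x,0,t)/\partial x_1,\dots,\partial\vec F(x,0,t)/\partial x_n)$, and let $J=\mathcal O_{\tilde X\times S}\langle F_2(x,t),\dots,F_k(x,t)\rangle+I_{C_0}(t)$. Let $\phi_0(x),\dots,\phi_\tau(x)$ be a basis of $\Phi=\mathcal O_{\tilde X}/(\mathcal O_{\tilde X}\langle f_2,\dots,f_k\rangle+I_{C_0}(0))$, which has dimension $\mu$; these also form a free $\mathcal O_S$-basis of $\Phi(s)=\mathcal O_{\tilde X\times S}/J$. Matrices. $(F_1(x,t)-u)\phi_i(x)\equiv\sum_{\ell=0}^\tau\rho_i^\ell(s)\phi_\ell(x)$ mod $J$ and $P(s)=(\rho_i^\ell(s))_{0\le i,\ell\le\tau}$; $\phi_i(x)\phi_j(x)\equiv\sum_{\ell=0}^\tau w_{i,j}^\ell(t)\phi_\ell(x)$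 mod $J$ and $W^c(t)=(w_{\ell,b}^c(t))_{0\le\ell,b\le\tau}$; $\zeta_c(t)=\sum_{\ell=0}^\tau w_{c,\ell}^\ell(t)$ (the trace of multiplication by $\phi_c$); $T(t)=\sum_{c=0}^\tau\zeta_c(t)W^c(t)$. A critical point $x$ of $F_1(x,t)-u$ on $F_2=\dots=F_k=0$ is called positive (negative) if $F_1(x,t)-u>0$ (resp. $<0$) there. $sign(A)$ denotes the number of positive minus the number of negative eigenvalues of a symmetric matrix $A$. *)

theory Defs
  imports "HOL-Analysis.Analysis" "HOL-Computational_Algebra.Polynomial"
begin

section \<open>Holomorphic functions of several variables near a set\<close>

definition complex_differentiable_at :: "(complex^'a \<Rightarrow> complex) \<Rightarrow> complex^'a \<Rightarrow> bool" where
  "complex_differentiable_at f z \<longleftrightarrow>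
     (\<exists>D. (f has_derivative D) (at z) \<and> (\<forall>c v. D (c *s v) = c * D v))"

text \<open>
  \<open>hol K\<close> represents the ring of functions holomorphic on some open neighbourhood of \<open>K\<close>.
  It is the ring of germs along \<open>K\<close> once functions agreeing near \<open>K\<close> are identified; with
  \<open>K = {0}\<close> it is the local ring at the origin. The functions are not normalised away from
  \<open>K\<close>, so identities in this ring are always stated up to \<open>eq_near K\<close>.
\<close>

definition hol :: "(complex^'a) set \<Rightarrow> (complex^'a \<Rightarrow> complex) set" where
  "hol K = {f. \<forall>p\<in>K. \<forall>\<^sub>F z in nhds p. complex_differentiable_at f z}"

definition holv :: "(complex^'a) set \<Rightarrow> (complex^'a \<Rightarrow> complex^'k) set" where
  "holv K = {f. \<forall>i. (\<lambda>z. f z $ i) \<in> hol K}"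

definition eq_near :: "(complex^'a) set \<Rightarrow> (complex^'a \<Rightarrow> 'b) \<Rightarrow> (complex^'a \<Rightarrow> 'b) \<Rightarrow> bool" where
  "eq_near K f g \<longleftrightarrow> (\<forall>p\<in>K. \<forall>\<^sub>F z in nhds p. f z = g z)"

definition ideal_near ::
  "(complex^'a) set \<Rightarrow> (complex^'a \<Rightarrow> complex) set \<Rightarrow> (complex^'a \<Rightarrow> complex) set" where
  "ideal_near K G = {h \<in> hol K. \<exists>A a. finite A \<and> A \<subseteq> G \<and> (\<forall>g\<in>A. a g \<in> hol K) \<and>
     eq_near K h (\<lambda>z. \<Sum>g\<in>A. a g z * g z)}"

definition submodule_near ::
  "(complex^'a) set \<Rightarrow> (complex^'a \<Rightarrow> complex^'k) set \<Rightarrow> (complex^'a \<Rightarrow> complex^'k) set" where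
  "submodule_near K G = {h \<in> holv K. \<exists>A a. finite A \<and> A \<subseteq> G \<and> (\<forall>g\<in>A. a g \<in> hol K) \<and>
     eq_near K h (\<lambda>z. \<Sum>g\<in>A. a g z *s g z)}"

definition partial :: "'a \<Rightarrow> (complex^'a \<Rightarrow> complex^'k) \<Rightarrow> complex^'a \<Rightarrow> complex^'k" where
  "partial j f z = (\<chi> i. deriv (\<lambda>w. f (z + axis j w) $ i) 0)"

text \<open>The matrix with columns \<open>\<partial>f/\<partial>x\<^sub>1, \<dots>, \<partial>f/\<partial>x\<^sub>n\<close>.\<close>

definition jacobi_matrix :: "(complex^'n \<Rightarrow> complex^'k) \<Rightarrow> complex^'n \<Rightarrow> complex^'n^'k" where
  "jacobi_matrix f x = (\<chi> i j. partial j f x $ i)"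

section \<open>The deformation\<close>

text \<open>
  Conventions: \<open>n = CARD('n)\<close>, \<open>k = CARD('k)\<close>, \<open>\<mu> = CARD('m)\<close>. The index \<open>i1 :: 'k\<close> is the
  first component of the target, and \<open>l0 :: 'm\<close> is the index \<open>0\<close> of \<open>{0, \<dots>, \<tau>}\<close>. A parameter
  \<open>s = (u,t) :: complex^'m\<close> has \<open>u = s $ l0\<close>, and its remaining coordinates are
  \<open>t\<^sub>1, \<dots>, t\<^sub>\<tau>\<close>. \<open>no_u l0 s = (0,t)\<close>.
\<close>

definition no_u :: "'m \<Rightarrow> complex^'m \<Rightarrow> complex^'m" where
  "no_u l0 s = (\<chi> l. if l = l0 then 0 else s $ l)"

definition deformation ::
  "(complex^'n \<Rightarrow> complex^'k) \<Rightarrow> ('m \<Rightarrow> complex^'n \<Rightarrow> complex^'k)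
     \<Rightarrow> complex^'n \<Rightarrow> complex^'m \<Rightarrow> complex^'k" where
  "deformation f0 e x s = f0 x + (\<Sum>l\<in>UNIV. s $ l *s e l x)"

text \<open>
  Points \<open>(x,u)\<close> of \<open>X\<close> are vectors \<open>z :: complex^('n option)\<close> with \<open>x\<^sub>j = z $ Some j\<close> and
  \<open>u = z $ None\<close>; points \<open>(x,s)\<close> are vectors \<open>z :: complex^('n + 'm)\<close>.
\<close>

definition xu_x :: "complex^('n::finite option) \<Rightarrow> complex^'n" where
  "xu_x z = (\<chi> j. z $ Some j)"

definition xs_x :: "complex^('n::finite + 'm::finite) \<Rightarrow> complex^'n" where
  "xs_x z = (\<chi> j. z $ Inl j)"

definition xs_s :: "complex^('n::finite + 'm::finite) \<Rightarrow> complex^'m" where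
  "xs_s z = (\<chi> l. z $ Inr l)"

text \<open>\<open>f(x,u) = F(x,u,0)\<close>.\<close>

definition undeformed ::
  "'m \<Rightarrow> (complex^'n \<Rightarrow> complex^'m \<Rightarrow> complex^'k) \<Rightarrow> complex^('n::finite option) \<Rightarrow> complex^'k" where
  "undeformed l0 F z = F (xu_x z) (axis l0 (z $ None))"

text \<open>
  The denominator of \<open>Q\<^sub>f\<close>, for \<open>f\<close> vanishing at the origin: the products \<open>f\<^sub>i v\<close> generate
  \<open>f\<^sup>*(m) (\<O>\<^sub>X)\<^sup>k\<close>. Only the derivatives in the \<open>x\<close>-directions occur.
\<close>

definition Q_relations ::
  "(complex^('n::finite option) \<Rightarrow> complex^'k) \<Rightarrow> (complex^('n option) \<Rightarrow> complex^'k) set" where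
  "Q_relations f = submodule_near {0}
     (range (\<lambda>j. partial (Some j) f) \<union> {\<lambda>z. f z $ i *s v z | i v. v \<in> holv {0}})"

definition represents_basis_Q ::
  "(complex^('n::finite option) \<Rightarrow> complex^'k)
     \<Rightarrow> ('m::finite \<Rightarrow> complex^('n option) \<Rightarrow> complex^'k) \<Rightarrow> bool" where
  "represents_basis_Q f b \<longleftrightarrow>
     (\<forall>l. b l \<in> holv {0}) \<and>
     (\<forall>h\<in>holv {0}. \<exists>c::complex^'m. (\<lambda>z. h z - (\<Sum>l\<in>UNIV. c $ l *s b l z)) \<in> Q_relations f) \<and>
     (\<forall>c::complex^'m. (\<lambda>z. \<Sum>l\<in>UNIV. c $ l *s b l z) \<in> Q_relations f \<longrightarrow> c = 0)"

section \<open>Critical points and discriminant\<close>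

text \<open>
  Critical points of \<open>F\<^sub>1(x,t) - u\<close> on \<open>F\<^sub>2 = \<dots> = F\<^sub>k = 0\<close>, in the sense of the rank condition
  defining \<open>Cr(F)\<close>; singular points of the fibre \<open>F\<^sub>2 = \<dots> = F\<^sub>k = 0\<close> are included.
\<close>

definition critical_point ::
  "'k \<Rightarrow> (complex^'n \<Rightarrow> complex^'m \<Rightarrow> complex^'k) \<Rightarrow> complex^'m \<Rightarrow> complex^'n \<Rightarrow> bool" where
  "critical_point i1 F s x \<longleftrightarrow>
     (\<forall>i. i \<noteq> i1 \<longrightarrow> F x s $ i = 0) \<and> rank (jacobi_matrix (\<lambda>x. F x s) x) < CARD('k)"

definition Cr ::
  "(complex^'n) set \<Rightarrow> (complex^'n \<Rightarrow> complex^'m \<Rightarrow> complex^'k) \<Rightarrow> ((complex^'n) \<times> (complex^'m)) set" where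
  "Cr X F = {(x, s). x \<in> X \<and> F x s = 0 \<and> rank (jacobi_matrix (\<lambda>x. F x s) x) < CARD('k)}"

definition discriminant ::
  "(complex^'n) set \<Rightarrow> (complex^'n \<Rightarrow> complex^'m \<Rightarrow> complex^'k) \<Rightarrow> (complex^'m) set" where
  "discriminant X F = snd ` Cr X F"

section \<open>The algebras of functions on the critical set\<close>

definition max_minors :: "('p \<Rightarrow> complex^'n^'k) \<Rightarrow> ('p \<Rightarrow> complex) set" where
  "max_minors M = {\<lambda>z. det (\<chi> i c. M z $ i $ \<sigma> c) | \<sigma> :: 'k \<Rightarrow> 'n. inj \<sigma>}"

definition slab :: "(complex^'n) set \<Rightarrow> (complex^('n::finite + 'm::finite)) set" where
  "slab X = {z. xs_x z \<in> X \<and> xs_s z = 0}"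

definition ideal_J ::
  "(complex^'n) set \<Rightarrow> 'k \<Rightarrow> 'm::finite \<Rightarrow> (complex^'n \<Rightarrow> complex^'m \<Rightarrow> complex^'k)
     \<Rightarrow> (complex^('n::finite + 'm::finite) \<Rightarrow> complex) set" where
  "ideal_J X i1 l0 F = ideal_near (slab X)
     ({\<lambda>z. F (xs_x z) (xs_s z) $ i | i. i \<noteq> i1} \<union>
      max_minors (\<lambda>z. jacobi_matrix (\<lambda>x. F x (no_u l0 (xs_s z))) (xs_x z)))"

definition ideal_J0 ::
  "(complex^'n) set \<Rightarrow> 'k \<Rightarrow> (complex^'n \<Rightarrow> complex^'k) \<Rightarrow> (complex^'n \<Rightarrow> complex) set" where
  "ideal_J0 X i1 f0 = ideal_near X ({\<lambda>x. f0 x $ i | i. i \<noteq> i1} \<union> max_minors (jacobi_matrix f0))"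

definition basis_Phi ::
  "(complex^'n) set \<Rightarrow> 'k \<Rightarrow> (complex^'n \<Rightarrow> complex^'k)
     \<Rightarrow> ('m::finite \<Rightarrow> complex^'n \<Rightarrow> complex) \<Rightarrow> bool"
  where "basis_Phi X i1 f0 \<phi> \<longleftrightarrow>
     (\<forall>l. \<phi> l \<in> hol X) \<and>
     (\<forall>h\<in>hol X. \<exists>c::complex^'m. (\<lambda>x. h x - (\<Sum>l\<in>UNIV. c $ l * \<phi> l x)) \<in> ideal_J0 X i1 f0) \<and>
     (\<forall>c::complex^'m. (\<lambda>x. \<Sum>l\<in>UNIV. c $ l * \<phi> l x) \<in> ideal_J0 X i1 f0 \<longrightarrow> c = 0)"

definition free_basis_Phi_s ::
  "(complex^'n) set \<Rightarrow> 'k \<Rightarrow> 'm \<Rightarrow> (complex^'n \<Rightarrow> complex^'m \<Rightarrow> complex^'k)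
     \<Rightarrow> ('m \<Rightarrow> complex^'n \<Rightarrow> complex) \<Rightarrow> bool" where
  "free_basis_Phi_s X i1 l0 F \<phi> \<longleftrightarrow>
     (\<forall>h\<in>hol (slab X). \<exists>c. c \<in> holv {0} \<and>
        (\<lambda>z. h z - (\<Sum>l\<in>UNIV. c (xs_s z) $ l * \<phi> l (xs_x z))) \<in> ideal_J X i1 l0 F) \<and>
     (\<forall>c\<in>holv {0}. (\<lambda>z. \<Sum>l\<in>UNIV. c (xs_s z) $ l * \<phi> l (xs_x z)) \<in> ideal_J X i1 l0 F
        \<longrightarrow> eq_near {0} c (\<lambda>_. 0))"

section \<open>The matrices\<close>

definition mat_P :: "('m \<Rightarrow> 'm \<Rightarrow> complex^'m \<Rightarrow> complex) \<Rightarrow> complex^'m \<Rightarrow> complex^'m^'m" where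
  "mat_P \<rho> s = (\<chi> i l. \<rho> i l s)"

text \<open>\<open>w i j l t\<close> stands for \<open>w\<^sub>i\<^sub>,\<^sub>j\<^sup>l(t)\<close>.\<close>

definition mat_W ::
  "('m \<Rightarrow> 'm \<Rightarrow> 'm \<Rightarrow> complex^'m \<Rightarrow> complex) \<Rightarrow> 'm \<Rightarrow> complex^'m \<Rightarrow> complex^'m^'m" where
  "mat_W w c t = (\<chi> l b. w l b c t)"

definition zeta ::
  "('m::finite \<Rightarrow> 'm \<Rightarrow> 'm \<Rightarrow> complex^'m \<Rightarrow> complex) \<Rightarrow> 'm \<Rightarrow> complex^'m \<Rightarrow> complex" where
  "zeta w c t = (\<Sum>l\<in>UNIV. w c l l t)"

definition mat_T ::
  "('m \<Rightarrow> 'm \<Rightarrow> 'm \<Rightarrow> complex^'m \<Rightarrow> complex) \<Rightarrow> complex^'m \<Rightarrow> complex^'m^'m" where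
  "mat_T w t = (\<Sum>c\<in>UNIV. map_matrix ((*) (zeta w c t)) (mat_W w c t))"

section \<open>Real data and signature\<close>

definition real_vec :: "complex^'a \<Rightarrow> bool" where
  "real_vec x \<longleftrightarrow> (\<forall>i. x $ i \<in> \<real>)"

definition characteristic_poly :: "real^'m^'m \<Rightarrow> real poly" where
  "characteristic_poly A = det (\<chi> i j. (if i = j then [:0, 1:] else 0) - [:A $ i $ j:])"

definition signature :: "real^'m^'m \<Rightarrow> int" where
  "signature A = int (size {#x \<in># proots (characteristic_poly A). x > 0#})
               - int (size {#x \<in># proots (characteristic_poly A). x < 0#})"

end

theory Submission
  imports Defs "HOL-Complex_Analysis.Complex_Analysis"
begin

text \<open>
For a parameter \<open>s\<close> near \<open>0\<close> the fibre of \<open>\<Phi>\<close> over \<open>s\<close> is a commutative algebra \<open>A\<^sub>s\<close> of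
dimension \<open>\<mu>\<close>, with the structure constants \<open>w\<close> at \<open>s\<close>. A critical point in \<open>X\<close> defines a
character of \<open>A\<^sub>s\<close>, namely evaluation. Suppose that every character of \<open>A\<^sub>s\<close> arises in this
way. Then both claims are linear algebra in \<open>A\<^sub>s\<close>. The matrix \<open>P(s)\<close> is multiplication by
\<open>g = F\<^sub>1 - u\<close>, hence singular iff some character kills \<open>g\<close>, that is, iff \<open>g\<close> vanishes at some
critical point (\<open>discriminant_eq_det_zero\<close>). The matrix \<open>P(s) T(t)\<close> is the Gram matrix of the
form \<open>(a, b) \<mapsto> tr (g a b)\<close>. The trace of a multiplication is the sum of the values of all
characters \<open>y\<close> with multiplicities \<open>m\<^sub>y > 0\<close>, so the Gram matrix is
\<open>\<Sum>\<^sub>y m\<^sub>y g(y) y y\<^sup>T\<close>, a sum of forms of rank one in linearly independent directions. For real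
data a real critical point contributes the sign of \<open>g\<close> there, and a pair of complex conjugate
points contributes one plus and one minus (\<open>trace_form_signature\<close>, by Sylvester's law of inertia).
The matrix is real because complex conjugation preserves the ideal and the coefficients with
respect to a free basis are unique (\<open>represents_real\<close>).

The substance is that all characters are evaluations (\<open>chars_are_evaluations\<close>). At \<open>s = 0\<close> this
is the usual argument: a character sends the coordinates to a point \<open>\<xi>\<close>; if \<open>\<xi>\<close> were outside the
ball, an affine function vanishing at \<open>\<xi>\<close> would be invertible on the ball; and
\<open>f - f(\<xi>)\<close> is a combination of the \<open>x\<^sub>j - \<xi>\<^sub>j\<close>. For \<open>s \<noteq> 0\<close> the last step breaks down: the
elements of \<open>\<Phi>\<close> are germs along \<open>X \<times> {0}\<close>, so a relation between them holds only for \<open>s\<close> in a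
neighbourhood depending on the relation, while the quotients of \<open>f - f(\<xi>)\<close> vary with \<open>\<xi>\<close>, hence
with \<open>s\<close>. So let \<open>d\<^sub>y(s) = y(f) - f(\<xi>\<^sub>y, s)\<close> be the deviation of a character \<open>y\<close> of \<open>A\<^sub>s\<close> from
evaluation. Two properties force it to vanish.

\<^item> It is flat: \<open>d\<^sub>y(s) = O(|s|\<^sup>N)\<close> for every \<open>N\<close>. Hadamard's lemma applied repeatedly at the
  fixed points \<open>p\<close> of the special fibre bounds \<open>d\<^sub>y\<close> by any power of \<open>\<Prod>\<^sub>p |\<xi>\<^sub>y - p|\<close>. A function
  vanishing at all \<open>p\<close> is nilpotent in \<open>A\<^sub>0\<close>, so its \<open>\<mu>\<close>-th power has size \<open>O(|s|)\<close> in \<open>A\<^sub>s\<close>; this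
  makes the product of the distances \<open>O(|s|\<^sup>1\<^sup>/\<^sup>\<mu>)\<close> (\<open>proximity\<close>, \<open>deviation_flat\<close>).

\<^item> The sums \<open>\<Sum>\<^sub>y m\<^sub>y y\<^sub>b d\<^sub>y(s)\<close> are holomorphic in \<open>s\<close>: for \<open>f\<close> polynomial in \<open>x\<close> they are traces
  of matrices with holomorphic entries, and the expansion of \<open>f\<close> into homogeneous polynomials in \<open>x\<close>
  converges uniformly near the ball (\<open>weighted_sum_expansion_term\<close>).

A flat holomorphic function is zero, and distinct characters are linearly independent, so all
\<open>d\<^sub>y(s)\<close> vanish on a whole neighbourhood of \<open>0\<close>.
\<close>

section \<open>Holomorphic functions of several variables\<close>

lemma bounded_linear_axis: "bounded_linear (\<lambda>c. axis i c :: complex^'b)"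
proof (rule bounded_linear_intro[where K=1])
  show "axis i (x + y) = axis i x + (axis i y :: complex^'b)" for x y
    by (simp add: vec_eq_iff axis_def)
  show "axis i (r *\<^sub>R x) = r *\<^sub>R (axis i x :: complex^'b)" for r x
    by (simp add: vec_eq_iff axis_def)
  fix x
  have "(\<Sum>k\<in>UNIV. (norm ((axis i x :: complex^'b) $ k))\<^sup>2) = (\<Sum>k\<in>UNIV. if k = i then (norm x)\<^sup>2 else 0)"
    by (rule sum.cong) (auto simp: axis_def)
  also have "\<dots> = (norm x)\<^sup>2" by (rule sum.delta[OF finite, THEN trans]) auto
  finally show "norm (axis i x :: complex^'b) \<le> norm x * 1"
    unfolding norm_vec_def L2_set_def by (simp only: real_sqrt_abs abs_norm_cancel mult_1_right order_refl)
qed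

lemma axis_zero: "axis i 0 = (0 :: complex^'b)"
  by (simp add: vec_eq_iff axis_def)

lemma vec_as_sum_axis: "(x :: complex^'b) = (\<Sum>i\<in>UNIV. axis i (x $ i))"
  by (simp add: vec_eq_iff axis_def sum.delta if_distrib cong: if_cong)

lemma has_derivative_vec_lambda:
  fixes f :: "'a::real_normed_vector \<Rightarrow> complex^'b"
  assumes "\<And>i. ((\<lambda>z. f z $ i) has_derivative D i) F"
  shows "(f has_derivative (\<lambda>v. \<chi> i. D i v)) F"
proof -
  have "((\<lambda>z. \<Sum>i\<in>UNIV. axis i (f z $ i)) has_derivative (\<lambda>v. \<Sum>i\<in>UNIV. axis i (D i v))) F"
    by (intro has_derivative_sum bounded_linear.has_derivative[OF bounded_linear_axis] assms)
  moreover have "(\<lambda>v. \<Sum>i\<in>UNIV. axis i (D i v)) = (\<lambda>v. \<chi> i. D i v)"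
    by (simp add: fun_eq_iff vec_eq_iff axis_def if_distrib cong: if_cong)
  ultimately show ?thesis
    by (simp flip: vec_as_sum_axis)
qed

lemma complex_differentiableE:
  assumes "complex_differentiable_at f z"
  obtains D where "(f has_derivative D) (at z)" "\<forall>c v. D (c *s v) = c * D v"
  using assms unfolding complex_differentiable_at_def by blast

lemma complex_differentiable_isCont: "complex_differentiable_at f z \<Longrightarrow> isCont f z"
  by (auto simp: complex_differentiable_at_def has_derivative_continuous)

lemma complex_differentiable_const: "complex_differentiable_at (\<lambda>_. c) z"
  unfolding complex_differentiable_at_def by (rule exI[of _ "\<lambda>_. 0"]) auto

lemma complex_differentiable_coord: "complex_differentiable_at (\<lambda>z. z $ i) z"
  unfolding complex_differentiable_at_def
  by (rule exI[of _ "\<lambda>v. v $ i"]) (auto intro: bounded_linear_imp_has_derivative)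

lemma complex_differentiable_add:
  assumes "complex_differentiable_at f z" "complex_differentiable_at g z"
  shows "complex_differentiable_at (\<lambda>z. f z + g z) z"
proof -
  obtain D where D: "(f has_derivative D) (at z)" "\<forall>c v. D (c *s v) = c * D v"
    using assms(1) by (rule complex_differentiableE)
  obtain E where E: "(g has_derivative E) (at z)" "\<forall>c v. E (c *s v) = c * E v"
    using assms(2) by (rule complex_differentiableE)
  show ?thesis unfolding complex_differentiable_at_def
    by (rule exI[of _ "\<lambda>v. D v + E v"])
       (auto intro!: has_derivative_add D E simp: D(2) E(2) algebra_simps)
qed

lemma complex_differentiable_mult:
  assumes "complex_differentiable_at f z" "complex_differentiable_at g z"
  shows "complex_differentiable_at (\<lambda>z. f z * g z) z"
proof -
  obtain D where D: "(f has_derivative D) (at z)" "\<forall>c v. D (c *s v) = c * D v"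
    using assms(1) by (rule complex_differentiableE)
  obtain E where E: "(g has_derivative E) (at z)" "\<forall>c v. E (c *s v) = c * E v"
    using assms(2) by (rule complex_differentiableE)
  show ?thesis unfolding complex_differentiable_at_def
    by (rule exI[of _ "\<lambda>v. f z * E v + D v * g z"])
       (use has_derivative_mult[OF D(1) E(1)] D(2) E(2) in \<open>auto simp: algebra_simps\<close>)
qed

lemma complex_differentiable_inverse:
  assumes "complex_differentiable_at f z" "f z \<noteq> 0"
  shows "complex_differentiable_at (\<lambda>z. inverse (f z)) z"
proof -
  obtain D where D: "(f has_derivative D) (at z)" "\<forall>c v. D (c *s v) = c * D v"
    using assms(1) by (rule complex_differentiableE)
  show ?thesis unfolding complex_differentiable_at_def
    by (rule exI[of _ "\<lambda>v. - (inverse (f z) * D v * inverse (f z))"])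
       (use Deriv.has_derivative_inverse[OF assms(2) D(1)] D(2) in \<open>auto simp: algebra_simps\<close>)
qed

lemma complex_differentiable_minus:
  "complex_differentiable_at f z \<Longrightarrow> complex_differentiable_at (\<lambda>z. - f z) z"
  using complex_differentiable_mult[OF complex_differentiable_const[of "-1"]] by fastforce

lemma complex_differentiable_diff:
  "complex_differentiable_at f z \<Longrightarrow> complex_differentiable_at g z
    \<Longrightarrow> complex_differentiable_at (\<lambda>z. f z - g z) z"
  using complex_differentiable_add[OF _ complex_differentiable_minus, of f z g] by simp

lemma complex_differentiable_sum:
  "(\<And>i. i \<in> A \<Longrightarrow> complex_differentiable_at (f i) z)
    \<Longrightarrow> complex_differentiable_at (\<lambda>z. \<Sum>i\<in>A. f i z) z"
  by (induction A rule: infinite_finite_induct)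
     (auto intro: complex_differentiable_add complex_differentiable_const)


lemma complex_differentiable_compose:
  fixes A :: "complex^'a \<Rightarrow> complex^'b"
  assumes "\<And>i. complex_differentiable_at (\<lambda>z. A z $ i) z" "complex_differentiable_at g (A z)"
  shows "complex_differentiable_at (\<lambda>z. g (A z)) z"
proof -
  have "\<forall>i. \<exists>D. ((\<lambda>z. A z $ i) has_derivative D) (at z) \<and> (\<forall>c v. D (c *s v) = c * D v)"
    using assms(1) by (simp add: complex_differentiable_at_def)
  then obtain D where D: "\<And>i. ((\<lambda>z. A z $ i) has_derivative D i) (at z)"
      "\<And>i c v. D i (c *s v) = c * D i v"
    by metis
  obtain E where E: "(g has_derivative E) (at (A z))" "\<forall>c v. E (c *s v) = c * E v"
    using assms(2) by (rule complex_differentiableE)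
  have "(A has_derivative (\<lambda>v. \<chi> i. D i v)) (at z)"
    by (intro has_derivative_vec_lambda D)
  from has_derivative_compose[OF this E(1)]
  have "((\<lambda>z. g (A z)) has_derivative (\<lambda>v. E (\<chi> i. D i v))) (at z)" .
  moreover have "E (\<chi> i. D i (c *s v)) = c * E (\<chi> i. D i v)" for c v
  proof -
    have "(\<chi> i. D i (c *s v)) = c *s (\<chi> i. D i v)"
      by (simp add: vec_eq_iff D(2))
    then show ?thesis using E(2) by simp
  qed
  ultimately show ?thesis
    unfolding complex_differentiable_at_def by blast
qed

lemma complex_differentiable_along_curve:
  fixes A :: "complex \<Rightarrow> complex^'a"
  assumes "\<And>i. (\<lambda>l. A l $ i) field_differentiable (at l)" "complex_differentiable_at g (A l)"
  shows "(\<lambda>l. g (A l)) field_differentiable (at l)"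
proof -
  obtain d where d: "\<And>i. ((\<lambda>l. A l $ i) has_field_derivative d i) (at l)"
    using assms(1) unfolding field_differentiable_def by metis
  obtain E where E: "(g has_derivative E) (at (A l))" "\<forall>c v. E (c *s v) = c * E v"
    using assms(2) by (rule complex_differentiableE)
  have "(A has_derivative (\<lambda>v. \<chi> i. d i * v)) (at l)"
    by (intro has_derivative_vec_lambda) (use d in \<open>auto simp: has_field_derivative_def\<close>)
  from has_derivative_compose[OF this E(1)]
  have "((\<lambda>l. g (A l)) has_derivative (\<lambda>v. E (\<chi> i. d i * v))) (at l)" .
  moreover have "E (\<chi> i. d i * v) = E (\<chi> i. d i) * v" for v
  proof -
    have "(\<chi> i. d i * v) = v *s (\<chi> i. d i)"
      by (simp add: vec_eq_iff mult.commute)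
    then show ?thesis using E(2) by (simp add: mult.commute)
  qed
  ultimately have "((\<lambda>l. g (A l)) has_field_derivative E (\<chi> i. d i)) (at l)"
    unfolding has_field_derivative_def by simp
  then show ?thesis unfolding field_differentiable_def by blast
qed

lemma complex_differentiable_transform:
  assumes "complex_differentiable_at f z" "\<forall>\<^sub>F w in nhds z. f w = g w"
  shows "complex_differentiable_at g z"
proof -
  obtain D where D: "(f has_derivative D) (at z)" "\<forall>c v. D (c *s v) = c * D v"
    using assms(1) by (rule complex_differentiableE)
  have "(g has_derivative D) (at z)"
    by (rule has_derivative_transform_eventually[OF D(1)])
       (use assms(2) in \<open>auto simp: eventually_nhds_conv_at\<close>)
  with D(2) show ?thesis by (auto simp: complex_differentiable_at_def)
qed

definition cpartial :: "'a \<Rightarrow> (complex^'a \<Rightarrow> complex) \<Rightarrow> complex^'a \<Rightarrow> complex" where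
  "cpartial j g z = deriv (\<lambda>w. g (z + axis j w)) 0"

lemma axis_field_differentiable: "(\<lambda>w. (z + axis j w) $ i) field_differentiable at l"
  by (cases "i = j") (simp_all add: axis_def field_differentiable_add field_differentiable_const field_differentiable_ident)

lemma complex_differentiable_derivative_eq:
  assumes "complex_differentiable_at g z"
  shows "(g has_derivative (\<lambda>v. \<Sum>j\<in>UNIV. v $ j * cpartial j g z)) (at z)"
proof -
  obtain E where E: "(g has_derivative E) (at z)" "\<forall>c v. E (c *s v) = c * E v"
    using assms(1) by (rule complex_differentiableE)
  have cpartial: "cpartial j g z = E (axis j 1)" for j
  proof -
    have "((\<lambda>w. z + axis j w) has_derivative (\<lambda>w. axis j w)) (at 0)"
      using has_derivative_add[OF has_derivative_const bounded_linear_imp_has_derivative[OF bounded_linear_axis]]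
      by simp
    moreover have "(g has_derivative E) (at (z + axis j 0))"
      using E(1) by (simp add: axis_zero)
    ultimately have "((\<lambda>w. g (z + axis j w)) has_derivative (\<lambda>w. E (axis j w))) (at 0)"
      by (rule has_derivative_compose)
    moreover have "(\<lambda>w. E (axis j w)) = (*) (E (axis j 1))"
    proof
      fix w
      have "axis j w = w *s (axis j 1 :: complex^'a)" by (simp add: vec_eq_iff axis_def)
      then show "E (axis j w) = E (axis j 1) * w" using E(2) by simp
    qed
    ultimately have "((\<lambda>w. g (z + axis j w)) has_field_derivative E (axis j 1)) (at 0)"
      by (simp only: has_field_derivative_def)
    then show ?thesis
      unfolding cpartial_def by (rule DERIV_imp_deriv)
  qed
  have lin: "linear E" using E(1) has_derivative_linear by blast
  have "E v = (\<Sum>j\<in>UNIV. v $ j * cpartial j g z)" for v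
  proof -
    have "axis j (v $ j) = v $ j *s (axis j 1 :: complex^'a)" for j
      by (simp add: vec_eq_iff axis_def)
    then have "E v = E (\<Sum>j\<in>UNIV. v $ j *s axis j 1)"
      using vec_as_sum_axis[of v] by simp
    also have "\<dots> = (\<Sum>j\<in>UNIV. E (v $ j *s axis j 1))"
      by (rule linear_sum[OF lin])
    finally show ?thesis by (simp add: E(2) cpartial)
  qed
  then have "E = (\<lambda>v. \<Sum>j\<in>UNIV. v $ j * cpartial j g z)" by (rule ext)
  with E(1) show ?thesis by simp
qed

lemma norm_axis_complex: "norm (axis i c :: complex^'b) = norm c"
proof -
  have "(\<Sum>k\<in>UNIV. (norm ((axis i c :: complex^'b) $ k))\<^sup>2) = (\<Sum>k\<in>UNIV. if k = i then (norm c)\<^sup>2 else 0)"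
    by (rule sum.cong) (auto simp: axis_def)
  also have "\<dots> = (norm c)\<^sup>2" by (rule sum.delta[OF finite, THEN trans]) auto
  finally show ?thesis unfolding norm_vec_def L2_set_def by (simp only: real_sqrt_abs abs_norm_cancel)
qed

lemma circlepath_nonzero: "r > 0 \<Longrightarrow> circlepath 0 r x \<noteq> 0" "r > 0 \<Longrightarrow> norm (circlepath 0 r x) = r"
  unfolding circlepath by (auto simp: norm_mult)

text \<open>
Cauchy's formula expresses the derivative by values of the function itself. This is the source of
all regularity below: integrals of continuous integrands are continuous in parameters.
\<close>

lemma cpartial_circle_integral:
  assumes "\<rho> > 0" "\<And>w. norm w \<le> \<rho> \<Longrightarrow> complex_differentiable_at g (z + axis j w)"
  shows "cpartial j g z = integral {0..1} (\<lambda>\<theta>. g (z + axis j (circlepath 0 \<rho> \<theta>)) / circlepath 0 \<rho> \<theta>)"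
proof -
  define k where "k w = g (z + axis j w)" for w
  have fd: "k field_differentiable (at w)" if "norm w \<le> \<rho>" for w
    unfolding k_def
    by (rule complex_differentiable_along_curve[where A="\<lambda>w. z + axis j w"])
       (use axis_field_differentiable assms(2)[OF that] in \<open>simp_all\<close>)
  have cont: "continuous_on (cball 0 \<rho>) k"
    by (rule continuous_at_imp_continuous_on) (auto intro!: field_differentiable_imp_continuous_at fd)
  have hol: "k holomorphic_on ball 0 \<rho>"
    unfolding holomorphic_on_def by (auto intro!: field_differentiable_at_within fd)
  have "((\<lambda>u. k u / (u - 0) ^ Suc 1) has_contour_integral (2 * pi * \<i>) / fact 1 * (deriv ^^ 1) k 0)
          (circlepath 0 \<rho>)"
    by (rule Cauchy_has_contour_integral_higher_derivative_circlepath[OF cont hol]) (use assms in auto)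
  then have "((\<lambda>x. k (circlepath 0 \<rho> x) / (circlepath 0 \<rho> x)\<^sup>2 *
      vector_derivative (circlepath 0 \<rho>) (at x within {0..1})) has_integral 2 * pi * \<i> * deriv k 0) {0..1}"
    by (simp add: has_contour_integral_def power2_eq_square)
  then have "((\<lambda>x. 2 * pi * \<i> * (k (circlepath 0 \<rho> x) / circlepath 0 \<rho> x)) has_integral 2 * pi * \<i> * deriv k 0) {0..1}"
  proof (rule has_integral_eq[rotated])
    fix x :: real assume x: "x \<in> {0..1}"
    have "vector_derivative (circlepath 0 \<rho>) (at x within {0..1}) = 2 * pi * \<i> * circlepath 0 \<rho> x"
      using x by (subst vector_derivative_circlepath01) (auto simp: circlepath)
    then show "k (circlepath 0 \<rho> x) / (circlepath 0 \<rho> x)\<^sup>2 *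
      vector_derivative (circlepath 0 \<rho>) (at x within {0..1}) = 2 * pi * \<i> * (k (circlepath 0 \<rho> x) / circlepath 0 \<rho> x)"
      using circlepath_nonzero(1)[OF assms(1), of x] by (simp add: power2_eq_square)
  qed
  from has_integral_mult_right[OF this, of "1 / (2 * pi * \<i>)"]
  have "((\<lambda>x. k (circlepath 0 \<rho> x) / circlepath 0 \<rho> x) has_integral deriv k 0) {0..1}"
    by simp
  then show ?thesis
    unfolding cpartial_def k_def[abs_def] by (simp add: integral_unique)
qed

lemma continuous_on_axis: "continuous_on S f \<Longrightarrow> continuous_on S (\<lambda>x. axis i (f x) :: complex^'b)"
  using bounded_linear.continuous_on[OF bounded_linear_axis] .

lemma continuous_on_circlepath: "continuous_on S f \<Longrightarrow> continuous_on S (\<lambda>x. circlepath z r (f x))"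
  unfolding circlepath by (intro continuous_intros)

text \<open>
Differentiation under the integral sign asks for a jointly continuous derivative of the integrand.
Joint continuity of \<open>f\<close> itself is enough, because by Cauchy's formula each partial derivative is an
integral of \<open>f\<close> over a circle of fixed radius.
\<close>

lemma complex_differentiable_parameter_integral:
  fixes f :: "complex^'a \<Rightarrow> real \<Rightarrow> complex"
  assumes "open U"
    and cont: "continuous_on (U \<times> {0..1}) (\<lambda>(z, t). f z t)"
    and cd: "\<And>z t. z \<in> U \<Longrightarrow> t \<in> {0..1} \<Longrightarrow> complex_differentiable_at (\<lambda>z. f z t) z"
    and "z0 \<in> U"
  shows "complex_differentiable_at (\<lambda>z. integral {0..1} (f z)) z0"
proof -
  obtain e where e: "e > 0" "cball z0 e \<subseteq> U"
    using \<open>open U\<close> \<open>z0 \<in> U\<close> open_contains_cball by blast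
  define \<rho> where "\<rho> = e / 2"
  have \<rho>: "\<rho> > 0" using e by (simp add: \<rho>_def)
  define B where "B = ball z0 \<rho>"
  have inU: "z + axis j w \<in> U" if "z \<in> B" "norm w \<le> \<rho>" for z j w
  proof -
    have "dist z0 (z + axis j w) \<le> dist z0 z + dist z (z + axis j w)" by (rule dist_triangle)
    also have "\<dots> \<le> e" using that by (simp add: B_def dist_norm norm_axis_complex \<rho>_def)
    finally show ?thesis using e by auto
  qed
  have BU: "z \<in> U" if "z \<in> B" for z
    using inU[OF that, of 0 undefined] \<rho> by (simp add: axis_zero)
  define P where "P j z t = cpartial j (\<lambda>z. f z t) z" for j z t
  have P_eq: "P j z t = integral {0..1} (\<lambda>\<theta>. f (z + axis j (circlepath 0 \<rho> \<theta>)) t / circlepath 0 \<rho> \<theta>)"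
    if "z \<in> B" "t \<in> {0..1}" for j z t
    unfolding P_def by (rule cpartial_circle_integral) (use \<rho> that in \<open>auto intro!: cd inU\<close>)
  have contP: "continuous_on (B \<times> cbox 0 1) (\<lambda>(z, t). P j z t)" for j
  proof -
    have "continuous_on ((B \<times> cbox 0 1) \<times> cbox 0 1)
        (\<lambda>(p, \<theta>). f (fst p + axis j (circlepath 0 \<rho> \<theta>)) (snd p) / circlepath 0 \<rho> \<theta>)"
    proof -
      have *: "continuous_on ((B \<times> cbox 0 1) \<times> cbox 0 1)
        (\<lambda>q. (\<lambda>(z,t). f z t) (fst (fst q) + axis j (circlepath 0 \<rho> (snd q)), snd (fst q)))"
        by (rule continuous_on_compose2[OF cont])
           (auto intro!: continuous_intros continuous_on_axis continuous_on_circlepath inU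
             simp: circlepath_nonzero \<rho>)
      show ?thesis
        using * unfolding split_beta
        by (auto intro!: continuous_on_divide continuous_on_circlepath continuous_intros
              simp: circlepath_nonzero \<rho>)
    qed
    from integral_continuous_on_param[OF this]
    have "continuous_on (B \<times> cbox 0 1) (\<lambda>p. integral {0..1}
        (\<lambda>\<theta>. f (fst p + axis j (circlepath 0 \<rho> \<theta>)) (snd p) / circlepath 0 \<rho> \<theta>))"
      by simp
    then show ?thesis
      by (rule continuous_on_eq) (auto simp: P_eq)
  qed
  define fx where "fx z t = Blinfun (\<lambda>v. \<Sum>j\<in>UNIV. v $ j * P j z t)" for z t
  have fx: "blinfun_apply (fx z t) = (\<lambda>v. \<Sum>j\<in>UNIV. v $ j * P j z t)" for z t
    unfolding fx_def
    by (rule bounded_linear_Blinfun_apply)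
       (intro bounded_linear_sum bounded_linear_mult_const bounded_linear_vec_nth)
  have contfx: "continuous_on (B \<times> cbox 0 1) (\<lambda>(z, t). fx z t)"
  proof (rule continuous_on_blinfun_componentwise)
    fix i :: "complex^'a"
    have "continuous_on (B \<times> cbox 0 1) (\<lambda>q. \<Sum>j\<in>UNIV. i $ j * (\<lambda>(z, t). P j z t) q)"
      by (intro continuous_on_sum continuous_on_mult continuous_on_const contP)
    then show "continuous_on (B \<times> cbox 0 1) (\<lambda>x. blinfun_apply (case x of (z, t) \<Rightarrow> fx z t) i)"
      by (simp add: split_beta fx)
  qed
  have der: "((\<lambda>z. f z t) has_derivative blinfun_apply (fx z t)) (at z within B)"
    if "z \<in> B" "t \<in> cbox 0 1" for z t
    using complex_differentiable_derivative_eq[OF cd[OF BU[OF that(1)], of t]] that(2)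
    by (auto simp: fx P_def intro: has_derivative_at_withinI)
  have integrable: "f z integrable_on cbox 0 1" if "z \<in> B" for z
  proof -
    have "continuous_on (cbox 0 1) (\<lambda>t. (\<lambda>(z, t). f z t) (z, t))"
      by (rule continuous_on_compose2[OF cont]) (auto intro!: continuous_intros BU that)
    then show ?thesis by (auto intro: integrable_continuous_real)
  qed
  have z0B: "z0 \<in> B" using \<rho> by (simp add: B_def)
  have "((\<lambda>z. integral (cbox 0 1) (f z)) has_derivative integral (cbox 0 1) (fx z0)) (at z0 within B)"
    by (rule leibniz_rule[OF der integrable contfx z0B]) (auto simp: B_def)
  moreover have "at z0 within B = at z0"
    by (rule at_within_open[OF z0B]) (simp add: B_def)
  ultimately have D: "((\<lambda>z. integral {0..1} (f z)) has_derivative integral {0..1} (fx z0)) (at z0)"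
    by (simp only: cbox_interval)
  have intfx: "fx z0 integrable_on {0..1}"
  proof -
    have "continuous_on (cbox 0 1) (\<lambda>t. (\<lambda>(z, t). fx z t) (z0, t))"
      by (rule continuous_on_compose2[OF contfx]) (auto intro!: continuous_intros z0B)
    then show ?thesis using integrable_continuous[of 0 1 "fx z0"] by simp
  qed
  have "blinfun_apply (integral {0..1} (fx z0)) (c *s v) = c * blinfun_apply (integral {0..1} (fx z0)) v" for c v
  proof -
    have "blinfun_apply (fx z0 t) (c *s v) = c * blinfun_apply (fx z0 t) v" for t
      by (simp add: fx sum_distrib_left mult.assoc)
    then show ?thesis
      by (simp add: blinfun_apply_integral[OF intfx] )
  qed
  with D show ?thesis
    unfolding complex_differentiable_at_def by blast
qed

text \<open>
Near \<open>z0\<close> the partial derivative is a circle integral of \<open>g\<close> with a fixed radius, so the parameter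
integral lemma applies.
\<close>

lemma complex_differentiable_cpartial:
  assumes "open U" "\<And>z. z \<in> U \<Longrightarrow> complex_differentiable_at g z" "z0 \<in> U"
  shows "complex_differentiable_at (cpartial j g) z0"
proof -
  obtain e where e: "e > 0" "cball z0 e \<subseteq> U"
    using \<open>open U\<close> \<open>z0 \<in> U\<close> open_contains_cball by blast
  define \<rho> where "\<rho> = e / 2"
  have \<rho>: "\<rho> > 0" using e by (simp add: \<rho>_def)
  define B where "B = ball z0 \<rho>"
  have inU: "z + axis j w \<in> U" if "z \<in> B" "norm w \<le> \<rho>" for z w
  proof -
    have "dist z0 (z + axis j w) \<le> dist z0 z + dist z (z + axis j w)" by (rule dist_triangle)
    also have "\<dots> \<le> e" using that by (simp add: B_def dist_norm norm_axis_complex \<rho>_def)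
    finally show ?thesis using e by auto
  qed
  have z0B: "z0 \<in> B" using \<rho> by (simp add: B_def)
  have contg: "continuous_on U g"
    using assms by (intro continuous_at_imp_continuous_on ballI complex_differentiable_isCont)
  have "complex_differentiable_at
      (\<lambda>z. integral {0..1} (\<lambda>\<theta>. g (z + axis j (circlepath 0 \<rho> \<theta>)) / circlepath 0 \<rho> \<theta>)) z0"
  proof (rule complex_differentiable_parameter_integral[OF _ _ _ z0B])
    show "open B" by (simp add: B_def)
    have *: "continuous_on (B \<times> {0..1}) (\<lambda>q. g (fst q + axis j (circlepath 0 \<rho> (snd q))))"
      by (rule continuous_on_compose2[OF contg])
         (auto intro!: continuous_intros continuous_on_axis continuous_on_circlepath inU simp: circlepath_nonzero \<rho>)
    show "continuous_on (B \<times> {0..1}) (\<lambda>(z, \<theta>). g (z + axis j (circlepath 0 \<rho> \<theta>)) / circlepath 0 \<rho> \<theta>)"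
      using * unfolding split_beta
      by (auto intro!: continuous_on_divide continuous_on_circlepath continuous_intros
              simp: circlepath_nonzero \<rho>)
    fix z :: "complex^'a" and t :: real assume z: "z \<in> B"
    have "complex_differentiable_at (\<lambda>z. g (z + axis j (circlepath 0 \<rho> t))) z"
      by (rule complex_differentiable_compose[where A="\<lambda>z. z + axis j (circlepath 0 \<rho> t)"])
         (auto intro!: assms inU z complex_differentiable_add complex_differentiable_coord
           complex_differentiable_const simp: circlepath_nonzero \<rho>)
    from complex_differentiable_mult[OF this complex_differentiable_const[of "inverse (circlepath 0 \<rho> t)"]]
    show "complex_differentiable_at (\<lambda>z. g (z + axis j (circlepath 0 \<rho> t)) / circlepath 0 \<rho> t) z"
      by (simp add: divide_inverse)
  qed
  then show ?thesis
  proof (rule complex_differentiable_transform)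
    have "\<forall>\<^sub>F z in nhds z0. z \<in> B" using z0B by (intro eventually_nhds_in_open) (auto simp: B_def)
    then show "\<forall>\<^sub>F z in nhds z0. integral {0..1} (\<lambda>\<theta>. g (z + axis j (circlepath 0 \<rho> \<theta>)) / circlepath 0 \<rho> \<theta>) = cpartial j g z"
      by eventually_elim (rule cpartial_circle_integral[symmetric], use \<rho> in \<open>auto intro!: assms inU\<close>)
  qed
qed


definition join :: "complex^'n \<Rightarrow> complex^'m \<Rightarrow> complex^('n::finite + 'm::finite)" where
  "join x s = (\<chi> q. case q of Inl j \<Rightarrow> x $ j | Inr l \<Rightarrow> s $ l)"

lemma join_simps [simp]:
  "xs_x (join x s) = x" "xs_s (join x s) = s" "join (xs_x z) (xs_s z) = z"
  "join x s $ Inl j = x $ j" "join x s $ Inr l = s $ l"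
  by (auto simp: xs_x_def xs_s_def join_def vec_eq_iff split: sum.splits)

definition polybox :: "real \<Rightarrow> real \<Rightarrow> (complex^('n::finite + 'm::finite)) set" where
  "polybox R r = {z. norm (xs_x z) < R \<and> norm (xs_s z) < r}"

lemma continuous_on_vecI:
  fixes f :: "'a::topological_space \<Rightarrow> complex^'b"
  assumes "\<And>i. continuous_on S (\<lambda>z. f z $ i)"
  shows "continuous_on S f"
  using continuous_on_vec_lambda[of S "\<lambda>i z. f z $ i"] assms by simp

lemma continuous_on_xs [continuous_intros]:
  "continuous_on S f \<Longrightarrow> continuous_on S (\<lambda>z. xs_x (f z))"
  "continuous_on S f \<Longrightarrow> continuous_on S (\<lambda>z. xs_s (f z))"
  by (auto intro!: continuous_on_vecI continuous_intros simp: xs_x_def xs_s_def)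

lemma continuous_on_join [continuous_intros]:
  assumes "continuous_on S f" "continuous_on S g"
  shows "continuous_on S (\<lambda>z. join (f z) (g z))"
proof (rule continuous_on_vecI)
  fix q show "continuous_on S (\<lambda>z. join (f z) (g z) $ q)"
    using assms by (cases q) (auto intro!: continuous_intros)
qed

lemma open_polybox: "open (polybox R r)"
  unfolding polybox_def Collect_conj_eq
  by (intro open_Int open_Collect_less continuous_intros)

lemma sum_UNIV_sum_type:
  "(\<Sum>q\<in>UNIV. f q) = (\<Sum>j\<in>UNIV. f (Inl j)) + (\<Sum>l\<in>UNIV. f (Inr l))"
  for f :: "'a::finite + 'b::finite \<Rightarrow> 'c::comm_monoid_add"
  by (simp add: UNIV_Plus_UNIV[symmetric] sum.Plus del: UNIV_Plus_UNIV)

text \<open>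
The quotient \<open>h j\<close> is the mean of the partial derivative in the direction \<open>x\<^sub>j\<close> along the segment
from \<open>p\<close> to \<open>x\<close>. The domain is a ball in \<open>x\<close>, so it contains these segments, and the quotients live
on the same domain as \<open>g\<close>.
\<close>

lemma hadamard_division:
  fixes g :: "complex^('n::finite + 'm::finite) \<Rightarrow> complex"
  assumes g: "\<And>z. z \<in> polybox R r \<Longrightarrow> complex_differentiable_at g z" and p: "norm p < R"
  obtains h where
    "\<And>j z. z \<in> polybox R r \<Longrightarrow> complex_differentiable_at (h j) z"
    "\<And>z. z \<in> polybox R r \<Longrightarrow>
       g z = g (join p (xs_s z)) + (\<Sum>j\<in>UNIV. (xs_x z $ j - p $ j) * h j z)"
proof -
  define seg where "seg t z = join (p + of_real t *s (xs_x z - p)) (xs_s z)"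
    for t :: real and z :: "complex^('n + 'm)"
  have seg_in: "seg t z \<in> polybox R r" if "z \<in> polybox R r" "t \<in> {0..1}" for t z
  proof -
    have "p + of_real t *s (xs_x z - p) = (1 - t) *\<^sub>R p + t *\<^sub>R xs_x z"
      by (simp add: vec_eq_iff scaleR_conv_of_real[where 'a=complex] algebra_simps)
    moreover have "(1 - t) *\<^sub>R p + t *\<^sub>R xs_x z \<in> ball 0 R"
      by (rule convexD[OF convex_ball]) (use that p in \<open>auto simp: polybox_def\<close>)
    ultimately show ?thesis
      using that by (simp add: polybox_def seg_def)
  qed
  define h where "h j z = integral {0..1} (\<lambda>t. cpartial (Inl j) g (seg t z))" for j z
  have cdpd: "complex_differentiable_at (cpartial q g) z" if "z \<in> polybox R r" for q z
    by (rule complex_differentiable_cpartial[OF open_polybox g that])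
  have cont_pd: "continuous_on (polybox R r) (cpartial q g)" for q
    by (intro continuous_at_imp_continuous_on ballI complex_differentiable_isCont cdpd)
  have cont_seg: "continuous_on S (\<lambda>x. seg (f x) (k x))" if "continuous_on S f" "continuous_on S k"
    for S and f :: "'z::topological_space \<Rightarrow> real" and k
  proof -
    have "continuous_on S (\<lambda>x. of_real (f x) *s (xs_x (k x) - p))"
      by (rule continuous_on_vecI) (auto intro!: continuous_intros that simp: vector_scalar_mult_def)
    then show ?thesis
      unfolding seg_def by (intro continuous_on_join continuous_on_add continuous_on_const continuous_on_xs that)
  qed
  have cont: "continuous_on (polybox R r \<times> {0..1}) (\<lambda>(z, t). cpartial q g (seg t z))" for q
    unfolding split_beta
    by (rule continuous_on_compose2[OF cont_pd]) (auto intro!: cont_seg continuous_intros seg_in)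
  have cd_seg: "complex_differentiable_at (\<lambda>z. seg t z $ q) z" for t q z
    by (cases q) (auto simp: seg_def xs_x_def xs_s_def intro!: complex_differentiable_add
      complex_differentiable_mult complex_differentiable_diff complex_differentiable_const complex_differentiable_coord)
  show thesis
  proof
    fix j and z :: "complex^('n + 'm)" assume z: "z \<in> polybox R r"
    show "complex_differentiable_at (h j) z"
      unfolding h_def[abs_def]
      by (rule complex_differentiable_parameter_integral[OF open_polybox cont _ z])
         (rule complex_differentiable_compose[OF cd_seg cdpd[OF seg_in]])
  next
    fix z :: "complex^('n + 'm)" assume z: "z \<in> polybox R r"
    define d where "d t = (\<Sum>j\<in>UNIV. (xs_x z $ j - p $ j) * cpartial (Inl j) g (seg t z))" for t
    have "((\<lambda>t. g (seg t z)) has_vector_derivative d t) (at t within {0..1})" if "t \<in> {0..1}" for t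
    proof -
      define e where "e = join (xs_x z - p) (0 :: complex^'m)"
      have "((\<lambda>t. seg t z) has_derivative (\<lambda>v. \<chi> q. v *\<^sub>R e $ q)) (at t within {0..1})"
      proof (rule has_derivative_vec_lambda)
        fix q show "((\<lambda>t. seg t z $ q) has_derivative (\<lambda>v. v *\<^sub>R e $ q)) (at t within {0..1})"
          by (cases q) (auto simp: seg_def e_def scaleR_conv_of_real algebra_simps intro!: derivative_eq_intros)
      qed
      from has_derivative_compose[OF this
            complex_differentiable_derivative_eq[OF g[OF seg_in[OF z that]]]]
      have "((\<lambda>t. g (seg t z)) has_derivative (\<lambda>v. \<Sum>q\<in>UNIV. (v *\<^sub>R e $ q) * cpartial q g (seg t z))) (at t within {0..1})"
        by (simp only: vec_lambda_beta)
      moreover have "(\<Sum>q\<in>UNIV. (v *\<^sub>R e $ q) * cpartial q g (seg t z)) = v *\<^sub>R d t" for v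
        by (subst sum_UNIV_sum_type) (simp add: e_def d_def scaleR_right.sum)
      ultimately show ?thesis by (simp add: has_vector_derivative_def)
    qed
    from fundamental_theorem_of_calculus[OF _ this]
    have "(d has_integral g (seg 1 z) - g (seg 0 z)) {0..1}" by simp
    moreover have "(d has_integral (\<Sum>j\<in>UNIV. (xs_x z $ j - p $ j) * h j z)) {0..1}"
      unfolding d_def h_def
    proof (intro has_integral_sum has_integral_mult_right integrable_integral)
      fix j
      have "continuous_on {0..1} (\<lambda>t. (\<lambda>(z, t). cpartial (Inl j) g (seg t z)) (z, t))"
        by (rule continuous_on_compose2[OF cont]) (auto intro!: continuous_intros z)
      then show "(\<lambda>t. cpartial (Inl j) g (seg t z)) integrable_on {0..1}"
        using integrable_continuous_real by auto
    qed auto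
    ultimately have "g (seg 1 z) - g (seg 0 z) = (\<Sum>j\<in>UNIV. (xs_x z $ j - p $ j) * h j z)"
      using has_integral_unique by blast
    moreover have "seg 1 z = z" "seg 0 z = join p (xs_s z)"
      by (simp_all add: seg_def vec_eq_iff)
    ultimately show "g z = g (join p (xs_s z)) + (\<Sum>j\<in>UNIV. (xs_x z $ j - p $ j) * h j z)"
      by (simp add: algebra_simps)
  qed
qed

section \<open>A common triangular form for commuting matrices\<close>

text \<open>
Gaussian elimination: an equation that is not trivial expresses one unknown by the others.
\<close>

lemma homogeneous_system_nontrivial_solution:
  fixes M :: "'k \<Rightarrow> 'i \<Rightarrow> 'a::field"
  assumes "finite K" "finite I" "card K < card I"
  shows "\<exists>\<alpha>. (\<exists>i\<in>I. \<alpha> i \<noteq> 0) \<and> (\<forall>k\<in>K. (\<Sum>i\<in>I. \<alpha> i * M k i) = 0)"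
  using assms
proof (induction K arbitrary: I M rule: finite_induct)
  case empty
  then obtain i where "i \<in> I" by (metis card.empty less_irrefl equals0I)
  then show ?case by (intro exI[of _ "\<lambda>_. 1"]) auto
next
  case (insert k K)
  show ?case
  proof (cases "\<forall>i\<in>I. M k i = 0")
    case True
    obtain \<alpha> where "\<exists>i\<in>I. \<alpha> i \<noteq> 0" "\<forall>k\<in>K. (\<Sum>i\<in>I. \<alpha> i * M k i) = 0"
      using insert.IH[of I M] insert.prems insert.hyps by auto
    then show ?thesis using True by (intro exI[of _ \<alpha>]) auto
  next
    case False
    then obtain i0 where i0: "i0 \<in> I" "M k i0 \<noteq> 0" by blast
    define J where "J = I - {i0}"
    have J: "finite J" "card K < card J" "i0 \<notin> J" "I = insert i0 J"
      using insert.prems insert.hyps i0 by (auto simp: J_def)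
    define M' where "M' k' i = M k' i - M k' i0 * M k i / M k i0" for k' i
    obtain \<alpha> where \<alpha>: "\<exists>i\<in>J. \<alpha> i \<noteq> 0" "\<forall>k\<in>K. (\<Sum>i\<in>J. \<alpha> i * M' k i) = 0"
      using insert.IH[of J M'] J by blast
    define S where "S k' = (\<Sum>i\<in>J. \<alpha> i * M k' i)" for k'
    define \<beta> where "\<beta> = \<alpha>(i0 := - S k / M k i0)"
    have sum\<beta>: "(\<Sum>i\<in>I. \<beta> i * M k' i) = - S k / M k i0 * M k' i0 + S k'" for k'
    proof -
      have "(\<Sum>i\<in>J. \<beta> i * M k' i) = S k'"
        unfolding S_def \<beta>_def using J by (intro sum.cong) auto
      then show ?thesis using J by (simp add: \<beta>_def)
    qed
    have "(\<Sum>i\<in>J. \<alpha> i * M' k' i) = S k' - S k * M k' i0 / M k i0" for k'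
      unfolding M'_def S_def right_diff_distrib sum_subtractf sum_distrib_right sum_divide_distrib
      by (simp add: mult_ac)
    with \<alpha>(2) have "S k' = S k * M k' i0 / M k i0" if "k' \<in> K" for k' using that by simp
    then have "\<forall>k'\<in>insert k K. (\<Sum>i\<in>I. \<beta> i * M k' i) = 0"
      using i0 by (simp add: sum\<beta>)
    moreover have "\<exists>i\<in>I. \<beta> i \<noteq> 0"
      using \<alpha>(1) J by (auto simp: \<beta>_def)
    ultimately show ?thesis by blast
  qed
qed

lemma matrix_vector_scale: "A *v (c *s x) = c *s (A *v x)" for A :: "'a::field^'n^'m"
  by (simp add: vec_eq_iff matrix_vector_mult_def sum_distrib_left mult_ac)

lemma matrix_vector_diff: "A *v (x - y) = A *v x - A *v y" for A :: "'a::field^'n^'m"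
  by (simp add: vec_eq_iff matrix_vector_mult_def sum_subtractf algebra_simps)

lemma matrix_vector_commute:
  fixes A B :: "'a::field^'m^'m"
  assumes "A ** B = B ** A" shows "A *v (B *v v) = B *v (A *v v)"
  using assms by (metis matrix_vector_mul_assoc)

text \<open>
The vector \<open>p(M) u\<close>, by Horner's scheme.
\<close>

definition poly_apply :: "complex poly \<Rightarrow> complex^'m^'m \<Rightarrow> complex^'m \<Rightarrow> complex^'m" where
  "poly_apply p M u = fold_coeffs (\<lambda>a w. a *s u + M *v w) p 0"

lemma poly_apply_simps [simp]:
  "poly_apply 0 M u = 0" "poly_apply (pCons a p) M u = a *s u + M *v poly_apply p M u"
proof -
  show "poly_apply 0 M u = 0" by (simp add: poly_apply_def)
  show "poly_apply (pCons a p) M u = a *s u + M *v poly_apply p M u"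
    by (cases "p = 0 \<and> a = 0") (auto simp: poly_apply_def)
qed

lemma poly_apply_add: "poly_apply (p + q) M u = poly_apply p M u + poly_apply q M u"
proof (induction p arbitrary: q)
  case (pCons a p)
  show ?case
  proof (cases q)
    case q: (pCons b q')
    have "poly_apply (pCons a p + q) M u = (a + b) *s u + M *v (poly_apply p M u + poly_apply q' M u)"
      by (simp add: q pCons.IH)
    then show ?thesis
      by (simp add: q matrix_vector_right_distrib vec.scale_left_distrib add_ac)
  qed
qed simp

lemma poly_apply_smult: "poly_apply (smult c p) M u = c *s poly_apply p M u"
  by (induction p) (simp_all add: matrix_vector_scale vec.scale_right_distrib)

lemma poly_apply_linear_factor:
  "poly_apply ([:- l, 1:] * q) M u = M *v poly_apply q M u - l *s poly_apply q M u"
proof -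
  have "[:- l, 1:] * q = smult (- l) q + pCons 0 q" by (simp add: algebra_simps)
  then show ?thesis
    by (simp only: poly_apply_add poly_apply_smult poly_apply_simps) simp
qed

lemma poly_apply_in_subspace:
  assumes "vec.subspace U" "\<And>v. v \<in> U \<Longrightarrow> M *v v \<in> U" "u \<in> U"
  shows "poly_apply p M u \<in> U"
  by (induction p) (auto intro: vec.subspace_0 vec.subspace_add vec.subspace_scale assms)

lemma annihilating_poly:
  fixes M :: "complex^'m^'m"
  obtains p where "p \<noteq> 0" "poly_apply p M u = 0"
proof -
  define x where "x k = (((*v) M) ^^ k) u" for k
  have "\<exists>\<alpha>. (\<exists>k\<in>{..CARD('m)}. \<alpha> k \<noteq> 0) \<and> (\<forall>i\<in>UNIV. (\<Sum>k\<in>{..CARD('m)}. \<alpha> k * x k $ i) = 0)"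
    by (rule homogeneous_system_nontrivial_solution) auto
  then obtain \<alpha> where \<alpha>: "\<exists>k\<le>CARD('m). \<alpha> k \<noteq> 0" "\<And>i. (\<Sum>k\<le>CARD('m). \<alpha> k * x k $ i) = 0" by auto
  define p where "p = (\<Sum>k\<le>CARD('m). monom (\<alpha> k) k)"
  have mon: "poly_apply (monom c k) M u = c *s x k" for c k
    by (induction k) (simp_all add: monom_0 monom_Suc x_def matrix_vector_scale)
  have "poly_apply (\<Sum>k\<in>A. monom (\<alpha> k) k) M u = (\<Sum>k\<in>A. \<alpha> k *s x k)" for A
    by (induction A rule: infinite_finite_induct) (simp_all add: poly_apply_add mon)
  then have "poly_apply p M u = 0"
    using \<alpha>(2) by (simp add: p_def vec_eq_iff)
  moreover have "p \<noteq> 0"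
  proof
    assume "p = 0"
    have "coeff p k = \<alpha> k" if "k \<le> CARD('m)" for k
      using that by (simp add: p_def coeff_sum)
    with \<open>p = 0\<close> \<alpha>(1) show False by auto
  qed
  ultimately show thesis using that by blast
qed

text \<open>
Among the nonzero polynomials with \<open>p(M) u \<in> V\<close> take one of least degree, and a root \<open>l\<close> of it. With
\<open>p = (X - l) q\<close>, minimality puts \<open>b = q(M) u\<close> outside \<open>V\<close>.
\<close>

lemma eigenvalue_modulo_subspace:
  fixes M :: "complex^'m^'m"
  assumes "vec.subspace U" "\<And>v. v \<in> U \<Longrightarrow> M *v v \<in> U" "vec.subspace V" "u \<in> U" "u \<notin> V"
  obtains b l where "b \<in> U" "b \<notin> V" "M *v b - l *s b \<in> V"
proof -
  define P where "P p \<longleftrightarrow> p \<noteq> 0 \<and> poly_apply p M u \<in> V" for p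
  have "\<exists>p. P p"
    by (rule annihilating_poly[of M u]) (use vec.subspace_0[OF assms(3)] in \<open>auto simp: P_def\<close>)
  then obtain p where p: "P p" "\<And>q. P q \<Longrightarrow> degree p \<le> degree q"
    using ex_has_least_nat[of P _ degree] by blast
  have "degree p \<noteq> 0"
  proof
    assume "degree p = 0"
    then obtain c where c: "p = [:c:]" by (rule degree_eq_zeroE)
    then have "c \<noteq> 0" "c *s u \<in> V" using p(1) by (auto simp: P_def)
    then have "inverse c *s (c *s u) \<in> V" using vec.subspace_scale[OF assms(3)] by blast
    with \<open>c \<noteq> 0\<close> \<open>u \<notin> V\<close> show False by (simp add: vector_smult_assoc)
  qed
  then have "\<exists>i\<in>{1..degree p}. coeff p i \<noteq> 0"
    by (intro bexI[of _ "degree p"]) auto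
  then obtain l where "(\<Sum>i\<le>degree p. coeff p i * l ^ i) = 0"
    using fundamental_theorem_of_algebra[of "coeff p" "degree p"] by blast
  then have "poly p l = 0" by (simp add: poly_altdef)
  then obtain q where q: "p = [:- l, 1:] * q" by (metis poly_eq_0_iff_dvd dvdE)
  have "q \<noteq> 0" using q p(1) by (auto simp: P_def)
  then have "degree q < degree p"
    unfolding q by (subst degree_mult_eq) auto
  with p(2)[of q] \<open>q \<noteq> 0\<close> have "poly_apply q M u \<notin> V" by (force simp: P_def)
  moreover have "M *v poly_apply q M u - l *s poly_apply q M u \<in> V"
    using p(1) unfolding P_def q poly_apply_linear_factor by blast
  moreover have "poly_apply q M u \<in> U" by (rule poly_apply_in_subspace) (use assms in auto)
  ultimately show thesis using that by blast
qed

text \<open>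
Let \<open>U\<close> be an invariant subspace of least dimension strictly above \<open>V\<close>. For \<open>M\<close> in the family and an
eigenvalue \<open>l\<close> of \<open>M\<close> on \<open>U / V\<close>, the vectors of \<open>U\<close> on which \<open>M\<close> acts as \<open>l\<close> modulo \<open>V\<close> form another
such subspace, because the family commutes. By minimality it is all of \<open>U\<close>: every \<open>M\<close> acts on
\<open>U / V\<close> as a scalar, and any \<open>b\<close> in \<open>U\<close> outside \<open>V\<close> will do.
\<close>

lemma common_eigenvector_modulo_subspace:
  fixes \<M> :: "(complex^'m^'m) set"
  assumes comm: "\<And>A B. A \<in> \<M> \<Longrightarrow> B \<in> \<M> \<Longrightarrow> A ** B = B ** A"
    and V: "vec.subspace V" "\<And>M v. M \<in> \<M> \<Longrightarrow> v \<in> V \<Longrightarrow> M *v v \<in> V" "V \<noteq> UNIV"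
  obtains b \<kappa> where "b \<notin> V" "\<And>M. M \<in> \<M> \<Longrightarrow> M *v b - \<kappa> M *s b \<in> V"
proof -
  define S where "S U \<longleftrightarrow> vec.subspace U \<and> (\<forall>M\<in>\<M>. \<forall>v\<in>U. M *v v \<in> U) \<and> V \<subset> U" for U
  have "S UNIV" using V by (auto simp: S_def)
  then obtain U where U: "S U" "\<And>W. S W \<Longrightarrow> vec.dim U \<le> vec.dim W"
    using ex_has_least_nat[of S _ vec.dim] by blast
  obtain b where b: "b \<in> U" "b \<notin> V" using U(1) by (auto simp: S_def)
  have "\<exists>l. M *v b - l *s b \<in> V" if M: "M \<in> \<M>" for M
  proof -
    obtain c l where c: "c \<in> U" "c \<notin> V" "M *v c - l *s c \<in> V"
      by (rule eigenvalue_modulo_subspace[of U M V b]) (use U(1) M V b in \<open>auto simp: S_def\<close>)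
    define W where "W = {u \<in> U. M *v u - l *s u \<in> V}"
    have "vec.subspace W"
    proof (rule vec.subspaceI)
      show "0 \<in> W" using U(1) vec.subspace_0 V(1) by (auto simp: W_def S_def)
      fix x y assume xy: "x \<in> W" "y \<in> W"
      have "(M *v x - l *s x) + (M *v y - l *s y) \<in> V" "x + y \<in> U"
        using xy U(1) by (auto simp: W_def S_def intro!: vec.subspace_add V(1))
      moreover have "M *v (x + y) - l *s (x + y) = (M *v x - l *s x) + (M *v y - l *s y)"
        by (simp add: matrix_vector_right_distrib vec.scale_right_distrib)
      ultimately show "x + y \<in> W"
        unfolding W_def by (metis (mono_tags, lifting) mem_Collect_eq)
    next
      fix c x assume x: "x \<in> W"
      have "c *s (M *v x - l *s x) \<in> V" "c *s x \<in> U"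
        using x U(1) vec.subspace_scale V(1) unfolding W_def S_def by blast+
      moreover have "M *v (c *s x) - l *s (c *s x) = c *s (M *v x - l *s x)"
        by (simp add: matrix_vector_scale vec.scale_right_diff_distrib vector_smult_assoc mult.commute)
      ultimately show "c *s x \<in> W"
        unfolding W_def by (metis (mono_tags, lifting) mem_Collect_eq)
    qed
    moreover have "N *v u \<in> W" if N: "N \<in> \<M>" and u: "u \<in> W" for N u
    proof -
      have "M *v (N *v u) - l *s (N *v u) = N *v (M *v u - l *s u)"
        by (simp add: matrix_vector_commute[OF comm[OF M N]] matrix_vector_diff matrix_vector_scale)
      then show ?thesis using u N U(1) V(2) by (auto simp: W_def S_def)
    qed
    moreover have "V \<subset> W"
    proof -
      have "V \<subseteq> W"
        using U(1) V M by (auto simp: W_def S_def intro!: vec.subspace_diff vec.subspace_scale)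
      then show ?thesis using c by (auto simp: W_def)
    qed
    ultimately have "S W" by (auto simp: S_def)
    have "W = U"
    proof (rule ccontr)
      assume "W \<noteq> U"
      then have "W \<subset> U" by (auto simp: W_def)
      moreover have "vec.span W = W" "vec.span U = U"
        using \<open>S W\<close> U(1) by (auto simp: S_def vec.span_eq_iff)
      ultimately have "vec.dim W < vec.dim U" by (metis vec.dim_psubset)
      with U(2)[OF \<open>S W\<close>] show False by simp
    qed
    with b show ?thesis by (auto simp: W_def)
  qed
  then obtain \<kappa> where "\<And>M. M \<in> \<M> \<Longrightarrow> M *v b - \<kappa> M *s b \<in> V" by metis
  with b(2) show thesis using that by blast
qed


text \<open>
The vectors \<open>b 0, \<dots>, b (n - 1)\<close> are independent and triangularize every matrix of the family on
their span; \<open>\<kappa> i M\<close> is the \<open>i\<close>-th diagonal entry of \<open>M\<close>.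
\<close>

definition is_flag :: "(complex^'m^'m) set \<Rightarrow> nat \<Rightarrow> (nat \<Rightarrow> complex^'m) \<Rightarrow> (nat \<Rightarrow> complex^'m^'m \<Rightarrow> complex) \<Rightarrow> bool" where
  "is_flag \<M> n b \<kappa> \<longleftrightarrow> (\<forall>i<n. b i \<notin> vec.span (b ` {..<i}) \<and>
     (\<forall>M\<in>\<M>. M *v b i - \<kappa> i M *s b i \<in> vec.span (b ` {..<i})))"

lemma is_flag_invariant:
  assumes "is_flag \<M> n b \<kappa>" "M \<in> \<M>" "j \<le> n" "v \<in> vec.span (b ` {..<j})"
  shows "M *v v \<in> vec.span (b ` {..<j})"
proof -
  have "b ` {..<j} \<subseteq> {v. M *v v \<in> vec.span (b ` {..<j})}"
  proof safe
    fix i assume "i < j"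
    then have "M *v b i - \<kappa> i M *s b i \<in> vec.span (b ` {..<i})"
      using assms by (auto simp: is_flag_def)
    then have "M *v b i - \<kappa> i M *s b i \<in> vec.span (b ` {..<j})"
      using \<open>i < j\<close> vec.span_mono[of "b ` {..<i}" "b ` {..<j}"] by force
    moreover have "\<kappa> i M *s b i \<in> vec.span (b ` {..<j})"
      using \<open>i < j\<close> by (intro vec.span_scale vec.span_base) auto
    ultimately show "M *v b i \<in> vec.span (b ` {..<j})"
      using vec.span_add by fastforce
  qed
  moreover have "vec.subspace {v. M *v v \<in> vec.span (b ` {..<j})}"
    by (rule vec.subspaceI)
       (auto simp: matrix_vector_right_distrib matrix_vector_scale vec.span_zero intro: vec.span_add vec.span_scale)
  ultimately show ?thesis
    using vec.span_minimal assms(4) by blast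
qed

lemma is_flag_dim: "is_flag \<M> n b \<kappa> \<Longrightarrow> j \<le> n \<Longrightarrow> vec.dim (b ` {..<j}) = j"
proof (induction j)
  case (Suc j)
  then show ?case
    by (simp add: lessThan_Suc vec.dim_insert is_flag_def)
qed simp

lemma flag_exists:
  fixes \<M> :: "(complex^'m^'m) set"
  assumes comm: "\<And>A B. A \<in> \<M> \<Longrightarrow> B \<in> \<M> \<Longrightarrow> A ** B = B ** A"
  shows "\<exists>b \<kappa>. is_flag \<M> CARD('m) b \<kappa>"
proof -
  have "n \<le> CARD('m) \<Longrightarrow> \<exists>b \<kappa>. is_flag \<M> n b \<kappa>" for n
  proof (induction n)
    case 0
    then show ?case by (auto simp: is_flag_def)
  next
    case (Suc n)
    then obtain b \<kappa> where f: "is_flag \<M> n b \<kappa>" by auto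
    let ?V = "vec.span (b ` {..<n})"
    have "vec.dim ?V = n" using is_flag_dim[OF f, of n] by simp
    then have "?V \<noteq> UNIV"
      using Suc.prems vec_dim_card[where 'a=complex and 'n='m] by (metis Suc_n_not_le_n)
    obtain c \<psi> where c: "c \<notin> ?V" "\<And>M. M \<in> \<M> \<Longrightarrow> M *v c - \<psi> M *s c \<in> ?V"
    proof (rule common_eigenvector_modulo_subspace[of \<M> ?V])
      show "M *v v \<in> ?V" if "M \<in> \<M>" "v \<in> ?V" for M v
        by (rule is_flag_invariant[OF f that(1) order_refl that(2)])
    qed (use \<open>?V \<noteq> UNIV\<close> comm in auto)
    define b' where "b' = b(n := c)"
    define \<kappa>' where "\<kappa>' = \<kappa>(n := \<psi>)"
    have im: "b' ` {..<i} = b ` {..<i}" if "i \<le> n" for i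
      using that by (intro image_cong) (auto simp: b'_def)
    have "is_flag \<M> (Suc n) b' \<kappa>'"
      unfolding is_flag_def
    proof (intro allI impI)
      fix i assume "i < Suc n"
      then consider "i < n" | "i = n" by linarith
      then show "b' i \<notin> vec.span (b' ` {..<i}) \<and>
         (\<forall>M\<in>\<M>. M *v b' i - \<kappa>' i M *s b' i \<in> vec.span (b' ` {..<i}))"
      proof cases
        case 1
        then have "b' i = b i" "\<kappa>' i = \<kappa> i" by (auto simp: b'_def \<kappa>'_def)
        then show ?thesis using 1 f im[of i] unfolding is_flag_def by simp
      next
        case 2
        then have "b' i = c" "\<kappa>' i = \<psi>" by (auto simp: b'_def \<kappa>'_def)
        then show ?thesis using 2 c im[of n] by simp
      qed
    qed
    then show ?case by blast
  qed
  then show ?thesis by blast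
qed

lemma is_flag_span: 
  fixes \<M> :: "(complex^'m^'m) set"
  assumes "is_flag \<M> CARD('m) b \<kappa>" shows "vec.span (b ` {..<CARD('m)}) = UNIV"
proof -
  have "vec.dim (b ` {..<CARD('m)}) = vec.dim (UNIV :: (complex^'m) set)"
    using is_flag_dim[OF assms order_refl] vec_dim_card[where 'a=complex and 'n='m] by metis
  then show ?thesis by (metis vec.dim_eq_span vec.span_UNIV subset_UNIV order_refl)
qed

lemma is_flag_least_step:
  fixes \<M> :: "(complex^'m^'m) set"
  assumes f: "is_flag \<M> CARD('m) b \<kappa>" and "v \<noteq> 0"
  obtains j a where "j < CARD('m)" "a \<noteq> 0" "v - a *s b j \<in> vec.span (b ` {..<j})"
proof -
  let ?P = "\<lambda>n. v \<in> vec.span (b ` {..<n})"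
  define n where "n = (LEAST n. ?P n)"
  have P: "?P CARD('m)" using is_flag_span[OF f] by simp
  then have "?P n" "n \<le> CARD('m)" unfolding n_def by (auto intro: LeastI Least_le)
  moreover have "n \<noteq> 0" using \<open>?P n\<close> \<open>v \<noteq> 0\<close> by (intro notI) auto
  then obtain j where j: "n = Suc j" by (cases n) auto
  have nP: "\<not> ?P j" using j not_less_Least[of j ?P] by (simp add: n_def)
  obtain a where a: "v - a *s b j \<in> vec.span (b ` {..<j})"
    using \<open>?P n\<close> unfolding j by (auto simp: lessThan_Suc vec.span_breakdown_eq)
  moreover have "a \<noteq> 0" using a nP by auto
  ultimately show thesis using that[of j a] \<open>n \<le> CARD('m)\<close> j by auto
qed

text \<open>
The step \<open>j\<close> at which an eigenvector enters the flag is the same for all matrices, and the coefficient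
of \<open>b j\<close> determines the eigenvalue.
\<close>

lemma is_flag_eigen:
  fixes \<M> :: "(complex^'m^'m) set"
  assumes f: "is_flag \<M> CARD('m) b \<kappa>" and "v \<noteq> 0"
  obtains j where "j < CARD('m)" "\<And>M l. M \<in> \<M> \<Longrightarrow> M *v v = l *s v \<Longrightarrow> \<kappa> j M = l"
proof -
  obtain j a where j: "j < CARD('m)" "a \<noteq> 0" and a: "v - a *s b j \<in> vec.span (b ` {..<j})"
    using is_flag_least_step[OF f \<open>v \<noteq> 0\<close>] by blast
  let ?V = "vec.span (b ` {..<j})"
  have "\<kappa> j M = l" if M: "M \<in> \<M>" and e: "M *v v = l *s v" for M l
  proof (rule ccontr)
    assume ne: "\<kappa> j M \<noteq> l"
    have 1: "M *v (v - a *s b j) \<in> ?V" by (rule is_flag_invariant[OF f M _ a]) (use j in simp)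
    have 2: "M *v b j - \<kappa> j M *s b j \<in> ?V" using f M j by (auto simp: is_flag_def)
    have "M *v (v - a *s b j) - l *s (v - a *s b j) + a *s (M *v b j - \<kappa> j M *s b j)
        = (a * (l - \<kappa> j M)) *s b j"
      by (simp add: matrix_vector_diff matrix_vector_scale e vec_eq_iff algebra_simps)
    moreover have "M *v (v - a *s b j) - l *s (v - a *s b j) + a *s (M *v b j - \<kappa> j M *s b j) \<in> ?V"
      by (intro vec.span_add vec.span_diff vec.span_scale 1 2 a)
    ultimately have "(a * (l - \<kappa> j M)) *s b j \<in> ?V" by simp
    then have "inverse (a * (l - \<kappa> j M)) *s ((a * (l - \<kappa> j M)) *s b j) \<in> ?V"
      by (rule vec.span_scale)
    moreover have "a * (l - \<kappa> j M) \<noteq> 0" using j ne by simp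
    ultimately have "b j \<in> ?V"
      by (metis vector_smult_assoc left_inverse vec.scale_one)
    then show False using f j by (auto simp: is_flag_def)
  qed
  with j that show thesis by blast
qed

lemma is_flag_nilpotent:
  fixes \<M> :: "(complex^'m^'m) set"
  assumes f: "is_flag \<M> CARD('m) b \<kappa>" and M: "M \<in> \<M>" and z: "\<And>j. j < CARD('m) \<Longrightarrow> \<kappa> j M = 0"
  shows "((*v) M ^^ CARD('m)) v = 0"
proof -
  have step: "M *v v \<in> vec.span (b ` {..<j})" if v: "v \<in> vec.span (b ` {..<Suc j})" and j: "j < CARD('m)" for v j
  proof -
    obtain a where a: "v - a *s b j \<in> vec.span (b ` {..<j})"
      using v by (auto simp: lessThan_Suc vec.span_breakdown_eq)
    have "M *v b j \<in> vec.span (b ` {..<j})" using f M j z[OF j] by (force simp: is_flag_def)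
    moreover have "M *v (v - a *s b j) \<in> vec.span (b ` {..<j})"
      by (rule is_flag_invariant[OF f M _ a]) (use j in simp)
    ultimately have "M *v (v - a *s b j) + a *s (M *v b j) \<in> vec.span (b ` {..<j})"
      by (intro vec.span_add vec.span_scale)
    then show ?thesis by (simp add: matrix_vector_diff matrix_vector_scale)
  qed
  have "j \<le> CARD('m) \<Longrightarrow> ((*v) M ^^ j) v \<in> vec.span (b ` {..<CARD('m) - j})" for j
  proof (induction j)
    case 0
    then show ?case using is_flag_span[OF f] by simp
  next
    case (Suc j)
    then have "((*v) M ^^ j) v \<in> vec.span (b ` {..<Suc (CARD('m) - Suc j)})"
      by (simp add: Suc_diff_Suc)
    from step[OF this] Suc.prems show ?case by simp
  qed
  from this[of "CARD('m)"] show ?thesis by simp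
qed

text \<open>
With \<open>B\<close> the matrix of the basis and \<open>C\<close> its inverse, \<open>tr M = tr (C M B)\<close>, and the diagonal of
\<open>C M B\<close> consists of the \<open>\<kappa> j M\<close>. The bijection \<open>h\<close> orders the index type.
\<close>

lemma is_flag_trace:
  fixes \<M> :: "(complex^'m^'m) set"
  assumes f: "is_flag \<M> CARD('m) b \<kappa>" and M: "M \<in> \<M>"
  shows "trace M = (\<Sum>j<CARD('m). \<kappa> j M)"
proof -
  obtain h :: "'m \<Rightarrow> nat" where h: "bij_betw h UNIV {..<CARD('m)}"
    using ex_bij_betw_finite_nat[of "UNIV :: 'm set"] by (auto simp: atLeast0LessThan)
  define B :: "complex^'m^'m" where "B = (\<chi> i j. b (h j) $ i)"
  have colB: "column j B = b (h j)" for j by (simp add: column_def B_def vec_eq_iff)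
  have "columns B = b ` {..<CARD('m)}"
  proof -
    have "columns B = range (\<lambda>j. b (h j))" unfolding columns_def by (auto simp: colB)
    also have "\<dots> = b ` range h" by auto
    finally show ?thesis using bij_betw_imp_surj_on[OF h] by simp
  qed
  then have "vec.span (columns B) = UNIV" using is_flag_span[OF f] by simp
  then obtain C where C: "B ** C = mat 1" using matrix_right_invertible_span_columns by blast
  then have CB: "C ** B = mat 1" by (simp add: matrix_left_right_inverse)
  have Cb: "C *v b (h j) = axis j 1" for j
  proof -
    have "C *v (B *v axis j 1) = axis j 1" by (simp add: matrix_vector_mul_assoc CB)
    moreover have "B *v axis j 1 = b (h j)"
      by (simp add: vec_eq_iff matrix_vector_mult_def B_def axis_def if_distrib[of "(*) _"] cong: if_cong)
    ultimately show ?thesis by simp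
  qed
  have vanish: "(C *v v) $ j = 0" if "v \<in> vec.span (b ` {..<h j})" for v j
  proof -
    have "b ` {..<h j} \<subseteq> {v. (C *v v) $ j = 0}"
    proof safe
      fix i assume i: "i < h j"
      have "h j < CARD('m)" using h by (auto simp: bij_betw_def)
      then have "i \<in> range h" using i bij_betw_imp_surj_on[OF h] by simp
      then obtain k where "i = h k" by blast
      then show "(C *v b i) $ j = 0" using i by (auto simp: Cb axis_def)
    qed
    moreover have "vec.subspace {v. (C *v v) $ j = 0}"
      by (rule vec.subspaceI) (auto simp: matrix_vector_right_distrib matrix_vector_scale)
    ultimately show ?thesis using that vec.span_minimal by blast
  qed
  have diag: "(C *v (M *v b (h j))) $ j = \<kappa> (h j) M" for j
  proof -
    have "h j < CARD('m)" using h by (auto simp: bij_betw_def)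
    then have "M *v b (h j) - \<kappa> (h j) M *s b (h j) \<in> vec.span (b ` {..<h j})"
      using f M by (auto simp: is_flag_def)
    from vanish[OF this] show ?thesis by (simp add: matrix_vector_diff matrix_vector_scale Cb axis_def)
  qed
  have "trace M = trace (M ** (B ** C))" by (simp add: C)
  also have "\<dots> = trace (C ** (M ** B))" by (metis matrix_mul_assoc trace_mul_sym)
  also have "\<dots> = (\<Sum>j\<in>UNIV. (C *v (M *v b (h j))) $ j)"
  proof -
    have "column j (M ** B) = M *v b (h j)" for j
      by (simp add: column_def B_def matrix_matrix_mult_def matrix_vector_mult_def vec_eq_iff)
    then have "(C ** (M ** B)) $ j $ j = (C *v (M *v b (h j))) $ j" for j
      by (simp add: matrix_matrix_mult_def matrix_vector_mult_def column_def vec_eq_iff B_def)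
    then show ?thesis by (simp add: trace_def)
  qed
  also have "\<dots> = (\<Sum>j\<in>UNIV. \<kappa> (h j) M)" by (simp add: diag)
  also have "\<dots> = (\<Sum>j<CARD('m). \<kappa> j M)" by (rule sum.reindex_bij_betw[OF h])
  finally show ?thesis .
qed

section \<open>Characters of a finite-dimensional commutative algebra\<close>

text \<open>
The characters of the algebra with basis \<open>\<phi>\<^sub>l\<close> and table \<open>\<phi>\<^sub>i \<phi>\<^sub>j = \<Sum>\<^sub>l w i j l \<phi>\<^sub>l\<close>, each given
by its values on the basis. In the presence of a unit, a multiplicative functional is nonzero iff it
sends the unit to \<open>1\<close>.
\<close>

definition algebra_chars :: "('m::finite \<Rightarrow> 'm \<Rightarrow> 'm \<Rightarrow> complex) \<Rightarrow> (complex^'m) set" where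
  "algebra_chars w = {y. y \<noteq> 0 \<and> (\<forall>i j. y $ i * y $ j = (\<Sum>l\<in>UNIV. w i j l * y $ l))}"

text \<open>
Multiplication by \<open>\<Sum>\<^sub>l a\<^sub>l \<phi>\<^sub>l\<close>: row \<open>i\<close> holds the coefficients of the product with \<open>\<phi>\<^sub>i\<close>. With
this convention the column of values of a character is an eigenvector (\<open>mulmat_char\<close>).
\<close>

definition mulmat :: "('m::finite \<Rightarrow> 'm \<Rightarrow> 'm \<Rightarrow> complex) \<Rightarrow> complex^'m \<Rightarrow> complex^'m^'m" where
  "mulmat w a = (\<chi> i b. \<Sum>l\<in>UNIV. a $ l * w l i b)"

definition alg_mult :: "('m::finite \<Rightarrow> 'm \<Rightarrow> 'm \<Rightarrow> complex) \<Rightarrow> complex^'m \<Rightarrow> complex^'m \<Rightarrow> complex^'m" where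
  "alg_mult w a b = (\<chi> l. \<Sum>i\<in>UNIV. \<Sum>j\<in>UNIV. a $ i * b $ j * w i j l)"

text \<open>
The value at \<open>\<Sum>\<^sub>l a\<^sub>l \<phi>\<^sub>l\<close> of the functional with the values \<open>y\<close> on the basis.
\<close>

definition pairing :: "complex^'m \<Rightarrow> complex^'m \<Rightarrow> complex" where
  "pairing a y = (\<Sum>l\<in>UNIV. a $ l * y $ l)"

lemma pairing_linear:
  "pairing (a + b) y = pairing a y + pairing b y" "pairing (a - b) y = pairing a y - pairing b y"
  "pairing (c *s a) y = c * pairing a y" "pairing (axis l 1) y = y $ l" "pairing 0 y = 0"
  by (simp_all add: pairing_def algebra_simps sum.distrib sum_subtractf sum_distrib_left
      axis_def if_distrib[of "\<lambda>x. x * _"] if_distrib[of "(*) _"] cong: if_cong)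

lemma pairing_sum: "pairing (\<Sum>i\<in>A. f i) y = (\<Sum>i\<in>A. pairing (f i) y)"
  by (induction A rule: infinite_finite_induct) (auto simp: pairing_linear)

lemma mulmat_char:
  assumes "y \<in> algebra_chars w" shows "mulmat w a *v y = pairing a y *s y"
proof -
  have "(mulmat w a *v y) $ i = (pairing a y *s y) $ i" for i
  proof -
    have "(mulmat w a *v y) $ i = (\<Sum>b\<in>UNIV. \<Sum>l\<in>UNIV. a $ l * (w l i b * y $ b))"
      by (simp add: mulmat_def matrix_vector_mult_def sum_distrib_right mult.assoc)
    also have "\<dots> = (\<Sum>l\<in>UNIV. a $ l * (\<Sum>b\<in>UNIV. w l i b * y $ b))"
      by (subst sum.swap) (simp add: sum_distrib_left)
    also have "\<dots> = (\<Sum>l\<in>UNIV. a $ l * (y $ l * y $ i))"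
      using assms by (simp add: algebra_chars_def)
    finally show ?thesis by (simp add: pairing_def sum_distrib_right mult.assoc)
  qed
  then show ?thesis by (simp add: vec_eq_iff)
qed

lemma pairing_amul:
  assumes "y \<in> algebra_chars w" shows "pairing (alg_mult w a b) y = pairing a y * pairing b y"
proof -
  have "pairing (alg_mult w a b) y = (\<Sum>l\<in>UNIV. \<Sum>i\<in>UNIV. \<Sum>j\<in>UNIV. a $ i * b $ j * (w i j l * y $ l))"
    by (simp add: pairing_def alg_mult_def sum_distrib_right mult.assoc)
  also have "\<dots> = (\<Sum>i\<in>UNIV. \<Sum>l\<in>UNIV. \<Sum>j\<in>UNIV. a $ i * b $ j * (w i j l * y $ l))"
    by (rule sum.swap)
  also have "\<dots> = (\<Sum>i\<in>UNIV. \<Sum>j\<in>UNIV. \<Sum>l\<in>UNIV. a $ i * b $ j * (w i j l * y $ l))"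
    by (rule sum.cong[OF refl], rule sum.swap)
  also have "\<dots> = (\<Sum>i\<in>UNIV. \<Sum>j\<in>UNIV. a $ i * b $ j * (y $ i * y $ j))"
    using assms by (simp add: algebra_chars_def sum_distrib_left)
  also have "\<dots> = pairing a y * pairing b y"
    by (simp add: pairing_def sum_product mult_ac)
  finally show ?thesis .
qed

text \<open>
The table \<open>w\<close> of a commutative associative algebra in which \<open>un\<close> holds the coefficients of the unit.
\<close>

locale structure_constants =
  fixes w :: "'m::finite \<Rightarrow> 'm \<Rightarrow> 'm \<Rightarrow> complex" and unit_coeffs :: "complex^'m"
  assumes comm: "w i j l = w j i l"
    and assoc: "(\<Sum>l\<in>UNIV. w i j l * w l k b) = (\<Sum>l\<in>UNIV. w j k l * w i l b)"
    and unit: "(\<Sum>l\<in>UNIV. unit_coeffs $ l * w l i b) = (if i = b then 1 else 0)"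
begin

lemma mulmat_un: "mulmat w unit_coeffs = mat 1"
  by (simp add: mulmat_def mat_def unit)

lemma mulmat_mult: "mulmat w a ** mulmat w b = mulmat w (alg_mult w a b)"
proof -
  have "(mulmat w a ** mulmat w b) $ i $ c = mulmat w (alg_mult w a b) $ i $ c" for i c
  proof -
    have key: "(\<Sum>d\<in>UNIV. w p i d * w q d c) = (\<Sum>l\<in>UNIV. w p q l * w l i c)" for p q
      by (subst comm[of p q]) (rule assoc[symmetric])
    have "(mulmat w a ** mulmat w b) $ i $ c
        = (\<Sum>d\<in>UNIV. \<Sum>p\<in>UNIV. \<Sum>q\<in>UNIV. a $ p * b $ q * (w p i d * w q d c))"
      by (simp add: mulmat_def matrix_matrix_mult_def sum_product mult_ac)
    also have "\<dots> = (\<Sum>p\<in>UNIV. \<Sum>d\<in>UNIV. \<Sum>q\<in>UNIV. a $ p * b $ q * (w p i d * w q d c))"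
      by (rule sum.swap)
    also have "\<dots> = (\<Sum>p\<in>UNIV. \<Sum>q\<in>UNIV. \<Sum>d\<in>UNIV. a $ p * b $ q * (w p i d * w q d c))"
      by (rule sum.cong[OF refl], rule sum.swap)
    also have "\<dots> = (\<Sum>p\<in>UNIV. \<Sum>q\<in>UNIV. \<Sum>l\<in>UNIV. a $ p * b $ q * (w p q l * w l i c))"
      by (simp only: sum_distrib_left[symmetric] key)
    also have "\<dots> = (\<Sum>p\<in>UNIV. \<Sum>l\<in>UNIV. \<Sum>q\<in>UNIV. a $ p * b $ q * (w p q l * w l i c))"
      by (rule sum.cong[OF refl], rule sum.swap)
    also have "\<dots> = (\<Sum>l\<in>UNIV. \<Sum>p\<in>UNIV. \<Sum>q\<in>UNIV. a $ p * b $ q * (w p q l * w l i c))"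
      by (rule sum.swap)
    also have "\<dots> = mulmat w (alg_mult w a b) $ i $ c"
      by (simp add: mulmat_def alg_mult_def sum_distrib_right mult.assoc)
    finally show ?thesis .
  qed
  then show ?thesis by (simp add: vec_eq_iff)
qed

lemma alg_mult_commute: "alg_mult w a b = alg_mult w b a"
proof -
  have "(\<Sum>i\<in>UNIV. \<Sum>j\<in>UNIV. a $ i * b $ j * w i j l) = (\<Sum>i\<in>UNIV. \<Sum>j\<in>UNIV. b $ i * a $ j * w i j l)" for l
    by (subst sum.swap) (simp add: comm[of _ _ l] mult_ac)
  then show ?thesis by (simp add: alg_mult_def vec_eq_iff)
qed

lemma pairing_un: "y \<in> algebra_chars w \<Longrightarrow> pairing unit_coeffs y = 1"
proof -
  assume y: "y \<in> algebra_chars w"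
  have "pairing unit_coeffs y *s y = y" using mulmat_char[OF y, of unit_coeffs] by (simp add: mulmat_un)
  moreover have "y \<noteq> 0" using y by (simp add: algebra_chars_def)
  ultimately show ?thesis
    by (metis vec.scale_cancel_right vec.scale_one)
qed

text \<open>
In a common triangular form of all multiplications the diagonal entries at a fixed place are
multiplicative, hence form a character. Conversely the values of a character are a common
eigenvector, so the character occurs on the diagonal.
\<close>

lemma chars_flag:
  obtains b \<kappa> Y where "is_flag (range (mulmat w)) CARD('m) b \<kappa>"
    "\<forall>j<CARD('m). \<forall>a. \<kappa> j (mulmat w a) = pairing a (Y j)"
    "Y ` {..<CARD('m)} = algebra_chars w"
proof -
  obtain b \<kappa> where f: "is_flag (range (mulmat w)) CARD('m) b \<kappa>"
  proof -
    have "A ** B = B ** A" if "A \<in> range (mulmat w)" "B \<in> range (mulmat w)" for A B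
      using that by (auto simp: mulmat_mult) (metis alg_mult_commute)
    from flag_exists[OF this] show ?thesis using that by blast
  qed
  have uniq: "\<kappa> j (mulmat w a) = c"
    if j: "j < CARD('m)" and c: "mulmat w a *v b j - c *s b j \<in> vec.span (b ` {..<j})" for j a c
  proof (rule ccontr)
    let ?k = "\<kappa> j (mulmat w a)"
    assume ne: "?k \<noteq> c"
    have "mulmat w a *v b j - ?k *s b j \<in> vec.span (b ` {..<j})"
      using f j by (auto simp: is_flag_def)
    from vec.span_diff[OF c this] have "(?k - c) *s b j \<in> vec.span (b ` {..<j})"
      by (simp add: vec.scale_left_diff_distrib)
    then have "inverse (?k - c) *s ((?k - c) *s b j) \<in> vec.span (b ` {..<j})"
      by (rule vec.span_scale)
    moreover have "?k - c \<noteq> 0" using ne by simp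
    ultimately have "b j \<in> vec.span (b ` {..<j})"
      by (metis vector_smult_assoc left_inverse vec.scale_one)
    then show False using f j by (auto simp: is_flag_def)
  qed
  define Y where "Y j = (\<chi> l. \<kappa> j (mulmat w (axis l 1)))" for j
  have lin: "\<kappa> j (mulmat w a) = pairing a (Y j)" if j: "j < CARD('m)" for j a
  proof (rule uniq[OF j])
    have "mulmat w a *v b j - pairing a (Y j) *s b j
        = (\<Sum>l\<in>UNIV. a $ l *s (mulmat w (axis l 1) *v b j - Y j $ l *s b j))"
    proof -
      have 1: "(mulmat w a *v b j) $ i = (\<Sum>l\<in>UNIV. a $ l * (mulmat w (axis l 1) *v b j) $ i)" for i
      proof -
        have "mulmat w (axis l 1) $ i $ d = w l i d" for l d
          by (simp add: mulmat_def axis_def if_distrib[of "\<lambda>x. x * _"] if_distrib[of "(*) _"] cong: if_cong)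
        then have "(\<Sum>l\<in>UNIV. a $ l * (mulmat w (axis l 1) *v b j) $ i)
            = (\<Sum>l\<in>UNIV. \<Sum>d\<in>UNIV. a $ l * w l i d * b j $ d)"
          by (simp add: matrix_vector_mult_def sum_distrib_left mult.assoc)
        also have "\<dots> = (\<Sum>d\<in>UNIV. \<Sum>l\<in>UNIV. a $ l * w l i d * b j $ d)" by (rule sum.swap)
        also have "\<dots> = (mulmat w a *v b j) $ i"
          by (simp add: matrix_vector_mult_def mulmat_def sum_distrib_right)
        finally show ?thesis by simp
      qed
      show ?thesis
        by (simp add: vec_eq_iff 1 pairing_def sum_distrib_right right_diff_distrib sum_subtractf mult.assoc)
    qed
    also have "\<dots> \<in> vec.span (b ` {..<j})"
      using f j by (intro vec.span_sum vec.span_scale) (auto simp: is_flag_def Y_def)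
    finally show "mulmat w a *v b j - pairing a (Y j) *s b j \<in> vec.span (b ` {..<j})" .
  qed
  have mult: "pairing (alg_mult w a c) (Y j) = pairing a (Y j) * pairing c (Y j)" if j: "j < CARD('m)" for j a c
  proof -
    let ?V = "vec.span (b ` {..<j})"
    have "mulmat w c *v b j - \<kappa> j (mulmat w c) *s b j \<in> ?V"
      using f j unfolding is_flag_def by blast
    then have "mulmat w c *v b j - pairing c (Y j) *s b j \<in> ?V"
      by (simp only: lin[OF j])
    then have 1: "mulmat w a *v (mulmat w c *v b j - pairing c (Y j) *s b j) \<in> ?V"
      using is_flag_invariant[OF f] j by auto
    have "mulmat w a *v b j - \<kappa> j (mulmat w a) *s b j \<in> ?V"
      using f j unfolding is_flag_def by blast
    then have "mulmat w a *v b j - pairing a (Y j) *s b j \<in> ?V"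
      by (simp only: lin[OF j])
    then have "pairing c (Y j) *s (mulmat w a *v b j - pairing a (Y j) *s b j) \<in> ?V"
      by (rule vec.span_scale)
    from vec.span_add[OF 1 this]
    have "mulmat w (alg_mult w a c) *v b j - (pairing a (Y j) * pairing c (Y j)) *s b j \<in> ?V"
      by (simp add: matrix_vector_diff matrix_vector_scale vec.scale_right_diff_distrib vector_smult_assoc
          matrix_vector_mul_assoc mulmat_mult mult.commute)
    from uniq[OF j this] show ?thesis by (simp add: lin[OF j])
  qed
  have chars: "Y j \<in> algebra_chars w" if j: "j < CARD('m)" for j
  proof -
    have "pairing unit_coeffs (Y j) = 1"
      unfolding lin[OF j, symmetric] by (rule uniq[OF j]) (simp add: mulmat_un vec.span_zero)
    then have "Y j \<noteq> 0" by (auto simp: pairing_def)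
    moreover have "Y j $ i * Y j $ k = (\<Sum>l\<in>UNIV. w i k l * Y j $ l)" for i k
    proof -
      have "alg_mult w (axis i 1) (axis k 1) = (\<chi> l. w i k l)"
        by (simp add: alg_mult_def axis_def vec_eq_iff if_distrib[of "\<lambda>x. x * _"] if_distrib[of "(*) _"] cong: if_cong)
      then have "pairing (alg_mult w (axis i 1) (axis k 1)) (Y j) = (\<Sum>l\<in>UNIV. w i k l * Y j $ l)"
        by (simp add: pairing_def)
      then show ?thesis using mult[OF j, of "axis i 1" "axis k 1"] by (simp add: pairing_linear)
    qed
    ultimately show ?thesis by (simp add: algebra_chars_def)
  qed
  have "y \<in> Y ` {..<CARD('m)}" if y: "y \<in> algebra_chars w" for y
  proof -
    have "y \<noteq> 0" using y by (simp add: algebra_chars_def)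
    then obtain j where j: "j < CARD('m)"
      "\<And>M l. M \<in> range (mulmat w) \<Longrightarrow> M *v y = l *s y \<Longrightarrow> \<kappa> j M = l"
      using is_flag_eigen[OF f] by blast
    have "\<kappa> j (mulmat w a) = pairing a y" for a
      by (rule j(2)) (auto simp: mulmat_char[OF y])
    then have "Y j = y" by (simp add: Y_def vec_eq_iff pairing_linear)
    then show ?thesis using j(1) by blast
  qed
  with chars have "Y ` {..<CARD('m)} = algebra_chars w" by auto
  with f lin that show thesis by blast
qed

lemma finite_chars: "finite (algebra_chars w)"
proof -
  obtain b \<kappa> Y where f: "is_flag (range (mulmat w)) CARD('m) b \<kappa>"
    "\<forall>j<CARD('m). \<forall>a. \<kappa> j (mulmat w a) = pairing a (Y j)"
    "Y ` {..<CARD('m)} = algebra_chars w" by (rule chars_flag)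
  then show ?thesis by (metis finite_imageI finite_lessThan)
qed

text \<open>
The multiplicity \<open>m y\<close> counts the occurrences of \<open>y\<close> on the common diagonal.
\<close>

lemma trace_eq_sum_chars:
  obtains m :: "complex^'m \<Rightarrow> nat" where
    "\<forall>y\<in>algebra_chars w. m y > 0"
    "\<forall>a. trace (mulmat w a) = (\<Sum>y\<in>algebra_chars w. of_nat (m y) * pairing a y)"
proof -
  obtain b \<kappa> Y where f: "is_flag (range (mulmat w)) CARD('m) b \<kappa>"
    "\<forall>j<CARD('m). \<forall>a. \<kappa> j (mulmat w a) = pairing a (Y j)"
    "Y ` {..<CARD('m)} = algebra_chars w" by (rule chars_flag)
  define m where "m y = card {j \<in> {..<CARD('m)}. Y j = y}" for y
  show thesis
  proof (rule that; safe)
    fix y assume "y \<in> algebra_chars w"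
    then show "m y > 0" unfolding m_def f(3)[symmetric] by (auto simp: card_gt_0_iff)
  next
    fix a
    have "trace (mulmat w a) = (\<Sum>j<CARD('m). pairing a (Y j))"
      using is_flag_trace[OF f(1)] f(2) by simp
    also have "\<dots> = (\<Sum>y\<in>Y ` {..<CARD('m)}. \<Sum>j\<in>{j\<in>{..<CARD('m)}. Y j = y}. pairing a (Y j))"
      by (rule sum.image_gen) simp
    also have "\<dots> = (\<Sum>y\<in>algebra_chars w. of_nat (m y) * pairing a y)"
      unfolding f(3) by (rule sum.cong) (auto simp: m_def)
    finally show "trace (mulmat w a) = (\<Sum>y\<in>algebra_chars w. of_nat (m y) * pairing a y)" .
  qed
qed

text \<open>
A kernel vector of the multiplication enters the flag at some step, and the diagonal entry there
is \<open>0\<close>.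
\<close>

lemma singular_mulmat_char:
  assumes "det (mulmat w a) = 0" shows "\<exists>y\<in>algebra_chars w. pairing a y = 0"
proof -
  obtain b \<kappa> Y where f: "is_flag (range (mulmat w)) CARD('m) b \<kappa>"
    "\<forall>j<CARD('m). \<forall>a. \<kappa> j (mulmat w a) = pairing a (Y j)"
    "Y ` {..<CARD('m)} = algebra_chars w" by (rule chars_flag)
  have "\<not> invertible (mulmat w a)" using assms by (simp add: invertible_det_nz)
  then have "\<not> inj ((*v) (mulmat w a))"
    by (simp add: invertible_left_inverse matrix_left_invertible_injective)
  then obtain v where v: "v \<noteq> 0" "mulmat w a *v v = 0"
    using vec.inj_iff_eq_0 by blast
  obtain j where j: "j < CARD('m)"
      "\<And>M l. M \<in> range (mulmat w) \<Longrightarrow> M *v v = l *s v \<Longrightarrow> \<kappa> j M = l"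
    using is_flag_eigen[OF f(1) v(1)] by blast
  have "pairing a (Y j) = 0" using j(2)[of "mulmat w a" 0] v f(2) j(1) by simp
  moreover have "Y j \<in> algebra_chars w" using j(1) f(3) by auto
  ultimately show ?thesis by blast
qed

lemma nilpotent_mulmat:
  assumes "\<And>y. y \<in> algebra_chars w \<Longrightarrow> pairing a y = 0"
  shows "((*v) (mulmat w a) ^^ CARD('m)) v = 0"
proof -
  obtain b \<kappa> Y where f: "is_flag (range (mulmat w)) CARD('m) b \<kappa>"
    "\<forall>j<CARD('m). \<forall>a. \<kappa> j (mulmat w a) = pairing a (Y j)"
    "Y ` {..<CARD('m)} = algebra_chars w" by (rule chars_flag)
  show ?thesis
  proof (rule is_flag_nilpotent[OF f(1)])
    show "\<kappa> j (mulmat w a) = 0" if "j < CARD('m)" for j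
      using that f(2) f(3) assms[of "Y j"] by (metis image_eqI lessThan_iff)
  qed auto
qed

text \<open>
Interpolation: multiply the elements \<open>(\<phi>\<^sub>l - y'\<^sub>l) / (y\<^sub>l - y'\<^sub>l)\<close>, where for each of the other
characters \<open>y'\<close> the index \<open>l\<close> separates it from \<open>y\<close>. In particular distinct characters are linearly
independent.
\<close>

lemma dual_char:
  assumes y: "y \<in> algebra_chars w"
  obtains z where "pairing z y = 1" "\<forall>y'\<in>algebra_chars w - {y}. pairing z y' = 0"
proof -
  have "finite S \<Longrightarrow> S \<subseteq> algebra_chars w - {y} \<Longrightarrow> \<exists>z. pairing z y = 1 \<and> (\<forall>y'\<in>S. pairing z y' = 0)" for S
  proof (induction S rule: finite_induct)
    case empty
    then show ?case using pairing_un[OF y] by blast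
  next
    case (insert y1 S)
    then obtain z where z: "pairing z y = 1" "\<forall>y'\<in>S. pairing z y' = 0" by auto
    have y1: "y1 \<in> algebra_chars w" "y1 \<noteq> y" using insert.prems by auto
    then obtain l where l: "y $ l \<noteq> y1 $ l" by (metis vec_eq_iff)
    define c where "c = inverse (y $ l - y1 $ l) *s (axis l 1 - y1 $ l *s unit_coeffs)"
    have "pairing c y = inverse (y $ l - y1 $ l) * (y $ l - y1 $ l)"
      by (simp only: c_def pairing_linear pairing_un[OF y] mult_1_right)
    then have "pairing (alg_mult w z c) y = 1"
      using l by (simp only: pairing_amul[OF y] z(1)) simp
    moreover have "pairing (alg_mult w z c) y1 = 0"
      by (simp add: pairing_amul[OF y1(1)] c_def pairing_linear pairing_un[OF y1(1)])
    moreover have "pairing (alg_mult w z c) y' = 0" if "y' \<in> S" for y'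
      using that z insert.prems by (subst pairing_amul) auto
    ultimately show ?case by auto
  qed
  from this[of "algebra_chars w - {y}"] finite_chars that show thesis by auto
qed

end

section \<open>Germs along the slab and the free quotient\<close>

lemma eventually_nhds_compose:
  assumes "isCont f p" "eventually P (nhds (f p))"
  shows "\<forall>\<^sub>F z in nhds p. P (f z)"
proof -
  have "filterlim f (nhds (f p)) (nhds p)"
    using assms(1) by (simp add: isCont_def tendsto_at_iff_tendsto_nhds)
  then show ?thesis using assms(2) by (rule eventually_compose_filterlim[rotated])
qed

lemma isCont_xs: "isCont xs_x p" "isCont xs_s p"
  by (rule continuous_on_interior[OF continuous_on_xs(1)[OF continuous_on_id, of UNIV]], simp)
     (rule continuous_on_interior[OF continuous_on_xs(2)[OF continuous_on_id, of UNIV]], simp)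

lemma isCont_join: "isCont (join x) s"
  by (rule continuous_on_interior[OF continuous_on_join[OF continuous_on_const continuous_on_id, of UNIV]]) simp

lemma hol_const: "(\<lambda>_. c) \<in> hol K"
  by (auto simp: hol_def intro!: always_eventually complex_differentiable_const)

lemma hol_everywhere: "(\<And>z. complex_differentiable_at f z) \<Longrightarrow> f \<in> hol K"
  by (auto simp: hol_def intro!: always_eventually)

lemma hol_add: "f \<in> hol K \<Longrightarrow> g \<in> hol K \<Longrightarrow> (\<lambda>z. f z + g z) \<in> hol K"
  unfolding hol_def by (auto elim!: eventually_elim2 intro: complex_differentiable_add)

lemma hol_diff: "f \<in> hol K \<Longrightarrow> g \<in> hol K \<Longrightarrow> (\<lambda>z. f z - g z) \<in> hol K"
  unfolding hol_def by (auto elim!: eventually_elim2 intro: complex_differentiable_diff)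

lemma hol_mult: "f \<in> hol K \<Longrightarrow> g \<in> hol K \<Longrightarrow> (\<lambda>z. f z * g z) \<in> hol K"
  unfolding hol_def by (auto elim!: eventually_elim2 intro: complex_differentiable_mult)

lemma hol_sum: "(\<And>i. i \<in> A \<Longrightarrow> f i \<in> hol K) \<Longrightarrow> (\<lambda>z. \<Sum>i\<in>A. f i z) \<in> hol K"
  by (induction A rule: infinite_finite_induct) (auto intro: hol_add hol_const)

lemma hol_prod: "(\<And>i. i \<in> A \<Longrightarrow> f i \<in> hol K) \<Longrightarrow> (\<lambda>z. \<Prod>i\<in>A. f i z) \<in> hol K"
  by (induction A rule: infinite_finite_induct) (auto intro: hol_mult hol_const)

lemma hol_comp_x:
  fixes X :: "(complex^'n::finite) set"
  assumes "f \<in> hol X" shows "(\<lambda>z. f (xs_x z)) \<in> hol (slab X :: (complex^('n + 'm::finite)) set)"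
  unfolding hol_def
proof safe
  fix p :: "complex^('n + 'm)" assume "p \<in> slab X"
  then have "\<forall>\<^sub>F x in nhds (xs_x p). complex_differentiable_at f x"
    using assms by (auto simp: hol_def slab_def)
  then have "\<forall>\<^sub>F z in nhds p. complex_differentiable_at f (xs_x z)"
    by (rule eventually_nhds_compose[OF isCont_xs(1)])
  then show "\<forall>\<^sub>F z in nhds p. complex_differentiable_at (\<lambda>z. f (xs_x z)) z"
    by eventually_elim
       (rule complex_differentiable_compose, auto simp: xs_x_def complex_differentiable_coord)
qed

lemma hol_comp_s:
  fixes X :: "(complex^'n::finite) set" and f :: "complex^'m::finite \<Rightarrow> complex"
  assumes "f \<in> hol {0}" shows "(\<lambda>z. f (xs_s z)) \<in> hol (slab X)"
  unfolding hol_def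
proof safe
  fix p :: "complex^('n + 'm)" assume "p \<in> slab X"
  then have "\<forall>\<^sub>F x in nhds (xs_s p). complex_differentiable_at f x"
    using assms by (auto simp: hol_def slab_def)
  then have "\<forall>\<^sub>F z in nhds p. complex_differentiable_at f (xs_s z)"
    by (rule eventually_nhds_compose[OF isCont_xs(2)])
  then show "\<forall>\<^sub>F z in nhds p. complex_differentiable_at (\<lambda>z. f (xs_s z)) z"
    by eventually_elim
       (rule complex_differentiable_compose, auto simp: xs_s_def complex_differentiable_coord)
qed

lemma join_in_slab: "join p 0 \<in> slab X \<longleftrightarrow> p \<in> X"
  by (simp add: slab_def)

lemma complex_differentiable_join: "complex_differentiable_at (\<lambda>s. join x s $ q) s"
  by (cases q) (auto simp: complex_differentiable_const complex_differentiable_coord)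

lemma hol_at_point:
  assumes "g \<in> hol (slab X)" "p \<in> X" shows "(\<lambda>s. g (join p s)) \<in> hol {0}"
proof -
  have "\<forall>\<^sub>F z in nhds (join p 0). complex_differentiable_at g z"
    using assms by (auto simp: hol_def join_in_slab)
  then have "\<forall>\<^sub>F s in nhds 0. complex_differentiable_at g (join p s)"
    by (rule eventually_nhds_compose[OF isCont_join])
  then have "\<forall>\<^sub>F s in nhds 0. complex_differentiable_at (\<lambda>s. g (join p s)) s"
    by eventually_elim (rule complex_differentiable_compose, auto intro: complex_differentiable_join)
  then show ?thesis by (simp add: hol_def)
qed

lemma xs_x_coord_hol: "(\<lambda>z. xs_x z $ j) \<in> hol K"
  by (rule hol_everywhere) (simp add: xs_x_def complex_differentiable_coord)

lemma holv_simps: "c \<in> holv K \<longleftrightarrow> (\<forall>l. (\<lambda>z. c z $ l) \<in> hol K)"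
  by (simp add: holv_def)

lemma eq_near_hol: "f \<in> hol K \<Longrightarrow> eq_near K f g \<Longrightarrow> g \<in> hol K"
  unfolding hol_def eq_near_def
proof safe
  fix p assume a: "\<forall>p\<in>K. \<forall>\<^sub>F z in nhds p. complex_differentiable_at f z"
    "\<forall>p\<in>K. \<forall>\<^sub>F z in nhds p. f z = g z" "p \<in> K"
  then have "\<forall>\<^sub>F z in nhds p. complex_differentiable_at f z \<and> (\<forall>\<^sub>F z in nhds z. f z = g z)"
    by (auto simp: eventually_eventually intro: eventually_conj)
  then show "\<forall>\<^sub>F z in nhds p. complex_differentiable_at g z"
    by eventually_elim (auto intro: complex_differentiable_transform)
qed

lemma alg_mult_axis:
  "alg_mult w a (axis k 1) $ b = (\<Sum>l\<in>UNIV. a $ l * w l k b)"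
  "alg_mult w (axis i 1) a $ b = (\<Sum>l\<in>UNIV. a $ l * w i l b)"
proof -
  note ifd = if_distrib[of "\<lambda>x. x * _"] if_distrib[of "(*) _"]
  show "alg_mult w a (axis k 1) $ b = (\<Sum>l\<in>UNIV. a $ l * w l k b)"
    by (simp add: alg_mult_def axis_def ifd cong: if_cong)
  have "alg_mult w (axis i 1) a $ b = (\<Sum>j\<in>UNIV. \<Sum>i'\<in>UNIV. axis i 1 $ i' * a $ j * w i' j b)"
    unfolding alg_mult_def vec_lambda_beta by (rule sum.swap)
  then show "alg_mult w (axis i 1) a $ b = (\<Sum>l\<in>UNIV. a $ l * w i l b)"
    by (simp add: axis_def ifd cong: if_cong)
qed

text \<open>
An ideal \<open>J\<close> of germs along \<open>X \<times> {0}\<close> such that the germs modulo \<open>J\<close> are free over the germs in \<open>s\<close>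
on the classes of the functions \<open>\<phi> l\<close>, with the multiplication table \<open>w\<close>. A germ in \<open>s\<close> is a
function on a neighbourhood of \<open>0\<close> that depends on it, so identities are stated for \<open>s\<close> eventually
near \<open>0\<close>.
\<close>

locale free_family =
  fixes \<delta> :: real and X :: "(complex^'n::finite) set"
    and J :: "(complex^('n + 'm::finite) \<Rightarrow> complex) set"
    and \<phi> :: "'m \<Rightarrow> complex^'n \<Rightarrow> complex"
    and w :: "'m \<Rightarrow> 'm \<Rightarrow> 'm \<Rightarrow> complex^'m \<Rightarrow> complex"
  assumes \<delta>: "\<delta> > 0" and X: "X = cball 0 \<delta>"
    and J_hol: "g \<in> J \<Longrightarrow> g \<in> hol (slab X)"
    and J_zero: "(\<lambda>_. 0) \<in> J"
    and J_add: "g \<in> J \<Longrightarrow> h \<in> J \<Longrightarrow> (\<lambda>z. g z + h z) \<in> J"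
    and J_mult: "a \<in> hol (slab X) \<Longrightarrow> g \<in> J \<Longrightarrow> (\<lambda>z. a z * g z) \<in> J"
    and J_near: "g \<in> J \<Longrightarrow> eq_near (slab X) g h \<Longrightarrow> h \<in> J"
    and phi_hol: "\<phi> l \<in> hol X"
    and generating: "h \<in> hol (slab X) \<Longrightarrow> \<exists>c\<in>holv {0}. (\<lambda>z. h z - (\<Sum>l\<in>UNIV. c (xs_s z) $ l * \<phi> l (xs_x z))) \<in> J"
    and free: "c \<in> holv {0} \<Longrightarrow> (\<lambda>z. \<Sum>l\<in>UNIV. c (xs_s z) $ l * \<phi> l (xs_x z)) \<in> J \<Longrightarrow> eq_near {0} c (\<lambda>_. 0)"
    and w_hol: "w i j l \<in> hol {0}"
    and w_rel: "(\<lambda>z. \<phi> i (xs_x z) * \<phi> j (xs_x z) - (\<Sum>l\<in>UNIV. w i j l (xs_s z) * \<phi> l (xs_x z))) \<in> J"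
begin

abbreviation "K \<equiv> slab X :: (complex^('n + 'm)) set"
abbreviation "w_at s \<equiv> (\<lambda>i j l. w i j l s)"

text \<open>
The germ \<open>g\<close> has the coefficients \<open>c\<close> modulo \<open>J\<close>.
\<close>

definition represents :: "(complex^('n + 'm) \<Rightarrow> complex) \<Rightarrow> (complex^'m \<Rightarrow> complex^'m) \<Rightarrow> bool" where
  "represents g c \<longleftrightarrow> g \<in> hol K \<and> c \<in> holv {0} \<and>
     (\<lambda>z. g z - (\<Sum>l\<in>UNIV. c (xs_s z) $ l * \<phi> l (xs_x z))) \<in> J"

lemma J_minus: "g \<in> J \<Longrightarrow> (\<lambda>z. - g z) \<in> J"
  using J_mult[OF hol_const[of "-1"]] by simp

lemma J_diff: "g \<in> J \<Longrightarrow> h \<in> J \<Longrightarrow> (\<lambda>z. g z - h z) \<in> J"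
  using J_add[OF _ J_minus, of g h] by simp


text \<open>
Freeness, as uniqueness of coefficients.
\<close>

lemma represents_congruent:
  assumes "represents g c" "represents h d" "(\<lambda>z. g z - h z) \<in> J"
  shows "\<forall>\<^sub>F s in nhds 0. c s = d s"
proof -
  have "(\<lambda>z. (g z - h z) - (g z - (\<Sum>l\<in>UNIV. c (xs_s z) $ l * \<phi> l (xs_x z)))
      + (h z - (\<Sum>l\<in>UNIV. d (xs_s z) $ l * \<phi> l (xs_x z)))) \<in> J"
    using assms unfolding represents_def by (intro J_add[OF J_diff[OF assms(3)]]) blast+
  also have "(\<lambda>z. (g z - h z) - (g z - (\<Sum>l\<in>UNIV. c (xs_s z) $ l * \<phi> l (xs_x z)))
      + (h z - (\<Sum>l\<in>UNIV. d (xs_s z) $ l * \<phi> l (xs_x z)))) =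
    (\<lambda>z. \<Sum>l\<in>UNIV. (\<lambda>s. c s - d s) (xs_s z) $ l * \<phi> l (xs_x z))"
    by (simp add: left_diff_distrib sum_subtractf)
  finally have "(\<lambda>z. \<Sum>l\<in>UNIV. (\<lambda>s. c s - d s) (xs_s z) $ l * \<phi> l (xs_x z)) \<in> J" .
  moreover have "(\<lambda>s. c s - d s) \<in> holv {0}"
    using assms by (auto simp: represents_def holv_simps intro: hol_diff)
  ultimately have "eq_near {0} (\<lambda>s. c s - d s) (\<lambda>_. 0)" by (rule free[rotated])
  then show ?thesis by (simp add: eq_near_def)
qed

lemma represents_unique: "represents g c \<Longrightarrow> represents g d \<Longrightarrow> \<forall>\<^sub>F s in nhds 0. c s = d s"
  by (rule represents_congruent) (auto simp: J_zero)

lemma represents_add: "represents g c \<Longrightarrow> represents h d \<Longrightarrow> represents (\<lambda>z. g z + h z) (\<lambda>s. c s + d s)"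
proof -
  assume a: "represents g c" "represents h d"
  have "(\<lambda>z. (g z - (\<Sum>l\<in>UNIV. c (xs_s z) $ l * \<phi> l (xs_x z)))
      + (h z - (\<Sum>l\<in>UNIV. d (xs_s z) $ l * \<phi> l (xs_x z)))) \<in> J"
    using a by (intro J_add) (auto simp: represents_def)
  then show ?thesis using a
    by (auto simp: represents_def holv_simps algebra_simps sum.distrib intro: hol_add)
qed

lemma represents_zero: "represents (\<lambda>_. 0) (\<lambda>_. 0)"
  by (simp add: represents_def holv_simps hol_const J_zero)

lemma represents_sum: "(\<And>i. i \<in> A \<Longrightarrow> represents (g i) (c i)) \<Longrightarrow> represents (\<lambda>z. \<Sum>i\<in>A. g i z) (\<lambda>s. \<Sum>i\<in>A. c i s)"
  by (induction A rule: infinite_finite_induct) (auto intro: represents_add represents_zero)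

lemma phi_hol': "(\<lambda>z. \<phi> l (xs_x z)) \<in> hol K"
  by (rule hol_comp_x[OF phi_hol])

lemma represents_phi: "represents (\<lambda>z. \<phi> l (xs_x z)) (\<lambda>_. axis l 1)"
  by (simp add: represents_def phi_hol' holv_simps hol_const axis_def J_zero
      if_distrib[of "\<lambda>x. x * _"] cong: if_cong)

lemma represents_scale:
  assumes "\<alpha> \<in> hol {0}" "represents g c"
  shows "represents (\<lambda>z. \<alpha> (xs_s z) * g z) (\<lambda>s. \<alpha> s *s c s)"
proof -
  have "(\<lambda>z. \<alpha> (xs_s z) * (g z - (\<Sum>l\<in>UNIV. c (xs_s z) $ l * \<phi> l (xs_x z)))) \<in> J"
    using assms by (intro J_mult hol_comp_s) (auto simp: represents_def)
  then show ?thesis using assms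
    by (auto simp: represents_def holv_simps algebra_simps sum_distrib_left intro: hol_mult hol_comp_s)
qed

lemma represents_const_scale: "represents g c \<Longrightarrow> represents (\<lambda>z. a * g z) (\<lambda>s. a *s c s)"
  using represents_scale[OF hol_const] .

lemma represents_w: "represents (\<lambda>z. \<phi> i (xs_x z) * \<phi> j (xs_x z)) (\<lambda>s. \<chi> l. w i j l s)"
  using w_rel by (simp add: represents_def holv_simps w_hol hol_mult phi_hol')

text \<open>
Multiply out \<open>(\<Sum> c\<^sub>i \<phi>\<^sub>i) (\<Sum> d\<^sub>j \<phi>\<^sub>j)\<close> and replace the products of basis functions by their table.
\<close>

lemma represents_mult:
  assumes g: "represents g c" and h: "represents h d"
  shows "represents (\<lambda>z. g z * h z) (\<lambda>s. alg_mult (w_at s) (c s) (d s))"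
proof -
  have ch: "(\<lambda>s. c s $ l) \<in> hol {0}" "(\<lambda>s. d s $ l) \<in> hol {0}" for l
    using g h by (auto simp: represents_def holv_simps)
  have gh: "g \<in> hol K" "h \<in> hol K" using g h by (auto simp: represents_def)
  define G where "G z = (\<Sum>l\<in>UNIV. c (xs_s z) $ l * \<phi> l (xs_x z))" for z :: "complex^('n + 'm)"
  define H where "H z = (\<Sum>l\<in>UNIV. d (xs_s z) $ l * \<phi> l (xs_x z))" for z :: "complex^('n + 'm)"
  have Gh: "G \<in> hol K"
    unfolding G_def[abs_def] by (intro hol_sum hol_mult phi_hol' hol_comp_s ch)
  have 1: "(\<lambda>z. h z * (g z - G z)) \<in> J"
    using g by (intro J_mult gh) (auto simp: represents_def G_def)
  have 2: "(\<lambda>z. G z * (h z - H z)) \<in> J"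
    using h by (intro J_mult Gh) (auto simp: represents_def H_def)
  have 3: "represents (\<lambda>z. \<Sum>i\<in>UNIV. \<Sum>j\<in>UNIV. (c (xs_s z) $ i * d (xs_s z) $ j) * (\<phi> i (xs_x z) * \<phi> j (xs_x z)))
     (\<lambda>s. \<Sum>i\<in>UNIV. \<Sum>j\<in>UNIV. (c s $ i * d s $ j) *s (\<chi> l. w i j l s))"
    by (intro represents_sum represents_scale hol_mult ch represents_w)
  have 4: "(\<Sum>i\<in>UNIV. \<Sum>j\<in>UNIV. (c s $ i * d s $ j) *s (\<chi> l. w i j l s)) = alg_mult (w_at s) (c s) (d s)" for s
    by (simp add: vec_eq_iff alg_mult_def)
  have 5: "(\<Sum>i\<in>UNIV. \<Sum>j\<in>UNIV. (c (xs_s z) $ i * d (xs_s z) $ j) * (\<phi> i (xs_x z) * \<phi> j (xs_x z))) = G z * H z"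
    for z :: "complex^('n + 'm)"
    by (simp add: G_def H_def sum_product mult_ac)
  have 6: "represents (\<lambda>z. G z * H z) (\<lambda>s. alg_mult (w_at s) (c s) (d s))"
    using 3 unfolding 4 5 .
  have "(\<lambda>z. h z * (g z - G z) + G z * (h z - H z)
     + (G z * H z - (\<Sum>l\<in>UNIV. alg_mult (w_at (xs_s z)) (c (xs_s z)) (d (xs_s z)) $ l * \<phi> l (xs_x z)))) \<in> J"
    by (intro J_add 1 2) (use 6 in \<open>auto simp: represents_def\<close>)
  then have "(\<lambda>z. g z * h z - (\<Sum>l\<in>UNIV. alg_mult (w_at (xs_s z)) (c (xs_s z)) (d (xs_s z)) $ l * \<phi> l (xs_x z))) \<in> J"
    by (simp add: algebra_simps)
  then show ?thesis
    using 6 by (auto simp: represents_def intro: hol_mult gh)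
qed

definition coeffs_of :: "(complex^('n + 'm) \<Rightarrow> complex) \<Rightarrow> complex^'m \<Rightarrow> complex^'m" where
  "coeffs_of g = (SOME c. represents g c)"

lemma represents_cf: "g \<in> hol K \<Longrightarrow> represents g (coeffs_of g)"
proof -
  assume "g \<in> hol K"
  then have "\<exists>c. represents g c" using generating[of g] unfolding represents_def by blast
  then show ?thesis unfolding coeffs_of_def by (rule someI_ex)
qed

lemma coeffs_of_hol: "g \<in> hol K \<Longrightarrow> (\<lambda>s. coeffs_of g s $ l) \<in> hol {0}"
  using represents_cf by (auto simp: represents_def holv_simps)

definition unit_coeffs :: "complex^'m \<Rightarrow> complex^'m" where "unit_coeffs = coeffs_of (\<lambda>_. 1)"

lemma represents_un: "represents (\<lambda>_. 1) unit_coeffs" unfolding unit_coeffs_def by (rule represents_cf[OF hol_const])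

text \<open>
Commutativity, associativity and the unit law hold among germs modulo \<open>J\<close>. By uniqueness they become
identities between finitely many coefficient functions, valid on a common neighbourhood of \<open>0\<close>.
\<close>

lemma eventually_structure: "\<forall>\<^sub>F s in nhds 0. structure_constants (w_at s) (unit_coeffs s)"
proof -
  have cm: "\<forall>\<^sub>F s in nhds 0. (\<chi> l. w i j l s) = (\<chi> l. w j i l s)" for i j
    by (rule represents_unique[OF represents_w]) (use represents_w[of j i] in \<open>simp add: mult.commute\<close>)
  have as: "\<forall>\<^sub>F s in nhds 0. alg_mult (w_at s) (\<chi> l. w i j l s) (axis k 1) = alg_mult (w_at s) (axis i 1) (\<chi> l. w j k l s)" for i j k
    by (rule represents_unique[OF represents_mult[OF represents_w represents_phi]])
       (use represents_mult[OF represents_phi represents_w, of i j k] in \<open>simp add: mult.assoc\<close>)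
  have u: "\<forall>\<^sub>F s in nhds 0. alg_mult (w_at s) (unit_coeffs s) (axis i 1) = axis i 1" for i
    by (rule represents_unique[OF represents_mult[OF represents_un represents_phi]]) (use represents_phi[of i] in simp)
  have "\<forall>\<^sub>F s in nhds 0. (\<forall>i j. (\<chi> l. w i j l s) = (\<chi> l. w j i l s)) \<and>
     (\<forall>i j k. alg_mult (w_at s) (\<chi> l. w i j l s) (axis k 1) = alg_mult (w_at s) (axis i 1) (\<chi> l. w j k l s)) \<and>
     (\<forall>i. alg_mult (w_at s) (unit_coeffs s) (axis i 1) = axis i 1)"
    by (intro eventually_conj eventually_all_finite cm as u)
  then show ?thesis
  proof eventually_elim
    case (elim s)
    show ?case
    proof
      show "w i j l s = w j i l s" for i j l
        using elim by (simp add: vec_eq_iff)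
      show "(\<Sum>l\<in>UNIV. w i j l s * w l k b s) = (\<Sum>l\<in>UNIV. w j k l s * w i l b s)" for i j k b
      proof -
        have "alg_mult (w_at s) (\<chi> l. w i j l s) (axis k 1) $ b = alg_mult (w_at s) (axis i 1) (\<chi> l. w j k l s) $ b"
          using elim by simp
        then show ?thesis by (simp add: alg_mult_axis)
      qed
      show "(\<Sum>l\<in>UNIV. unit_coeffs s $ l * w l i b s) = (if i = b then 1 else 0)" for i b
      proof -
        have "alg_mult (w_at s) (unit_coeffs s) (axis i 1) $ b = axis i 1 $ b" using elim by simp
        then show ?thesis by (simp add: alg_mult_axis) (simp add: axis_def eq_commute)
      qed
    qed
  qed
qed

abbreviation Ch :: "complex^'m \<Rightarrow> (complex^'m) set" where "Ch s \<equiv> algebra_chars (w_at s)"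

lemma pairing_coeffs_of:
  assumes "represents g c" shows "\<forall>\<^sub>F s in nhds 0. \<forall>y. pairing (coeffs_of g s) y = pairing (c s) y"
  using represents_unique[OF represents_cf assms] assms by (auto simp: represents_def elim: eventually_mono)

lemma pairing_unit_coeffs: "\<forall>\<^sub>F s in nhds 0. \<forall>y\<in>Ch s. pairing (unit_coeffs s) y = 1"
  using eventually_structure by eventually_elim (auto intro: structure_constants.pairing_un)

end

section \<open>Characters near the special fibre\<close>

lemma max_component:
  fixes y :: "complex^'m" obtains j where "\<forall>i. norm (y $ i) \<le> norm (y $ j)"
proof -
  have "Max (range (\<lambda>i. norm (y $ i))) \<in> range (\<lambda>i. norm (y $ i))"
    by (rule Max_in) auto
  then obtain j where "Max (range (\<lambda>i. norm (y $ i))) = norm (y $ j)" by (rule imageE)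
  moreover have "\<forall>i. norm (y $ i) \<le> Max (range (\<lambda>i. norm (y $ i)))" by auto
  ultimately show thesis using that by metis
qed

text \<open>
Compare the entries of \<open>y\<^sub>l y = M\<^sub>l y\<close> at the index where \<open>|y\<^sub>j|\<close> is largest; \<open>M\<^sub>l\<close> is the matrix of
multiplication by \<open>\<phi>\<^sub>l\<close>.
\<close>

lemma char_norm_bound:
  fixes y :: "complex^'m::finite" and B :: real
  assumes y: "y \<in> algebra_chars w" and B: "\<And>i j l. norm (w i j l) \<le> B"
  shows "norm (y $ l) \<le> CARD('m) * B"
proof -
  obtain j where j: "\<forall>i. norm (y $ i) \<le> norm (y $ j)" by (rule max_component)
  have "y \<noteq> 0" using y by (simp add: algebra_chars_def)
  then obtain i where "y $ i \<noteq> 0" by (metis vec_eq_iff zero_index)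
  then have "0 < norm (y $ i)" by simp
  then have pos: "norm (y $ j) > 0" using j by (metis less_le_trans)
  have "norm (y $ l) * norm (y $ j) = norm (\<Sum>b\<in>UNIV. w l j b * y $ b)"
    using y by (simp add: algebra_chars_def norm_mult[symmetric])
  also have "\<dots> \<le> (\<Sum>b\<in>(UNIV :: 'm set). B * norm (y $ j))"
    by (rule order_trans[OF norm_sum sum_mono])
       (use B j in \<open>auto simp: norm_mult intro!: mult_mono order_trans[OF norm_ge_zero B]\<close>)
  also have "\<dots> = CARD('m) * B * norm (y $ j)" by simp
  finally show ?thesis using pos by simp
qed

lemma hol_isCont: "f \<in> hol K \<Longrightarrow> p \<in> K \<Longrightarrow> isCont f p"
  unfolding hol_def by (auto dest!: eventually_nhds_x_imp_x intro: complex_differentiable_isCont)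

lemma hol_bounded_near:
  assumes "f \<in> hol K" "p \<in> K" "norm (f p) < B" shows "\<forall>\<^sub>F s in nhds p. norm (f s) < B"
proof -
  have "isCont (\<lambda>s. norm (f s)) p" using hol_isCont[OF assms(1,2)] by (intro continuous_intros)
  then show ?thesis
    by (rule eventually_nhds_compose[where P="\<lambda>x. x < B"])
       (use assms(3) in \<open>auto intro: eventually_nhds_in_open[of "{..<B}", simplified]\<close>)
qed

lemma hol_bounded: "f \<in> hol {0} \<Longrightarrow> \<exists>B. \<forall>\<^sub>F s in nhds 0. norm (f s) \<le> B"
  by (rule exI[of _ "norm (f 0) + 1"])
     (rule eventually_mono[OF hol_bounded_near[of f "{0}" 0 "norm (f 0) + 1"]], auto)

lemma hol_lipschitz_at_zero:
  assumes "f \<in> hol {0}" "f 0 = 0" shows "\<exists>C. \<forall>\<^sub>F s in nhds 0. norm (f s) \<le> C * norm s"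
proof -
  have "complex_differentiable_at f 0"
    using assms(1) by (auto simp: hol_def dest: eventually_nhds_x_imp_x)
  then obtain D where D: "(f has_derivative D) (at 0)" by (auto simp: complex_differentiable_at_def)
  then have "bounded_linear D" "\<exists>d>0. \<forall>s. norm (s - 0) < d \<longrightarrow> norm (f s - f 0 - D (s - 0)) \<le> 1 * norm (s - 0)"
    unfolding has_derivative_at_alt using zero_less_one by blast+
  then obtain k d where k: "\<And>s. norm (D s) \<le> norm s * k"
    and d: "d > 0" "\<And>s. norm s < d \<Longrightarrow> norm (f s - D s) \<le> norm s"
    using bounded_linear.bounded assms(2) by (metis diff_zero mult_1)
  have "norm (f s) \<le> (1 + k) * norm s" if "norm s < d" for s
  proof -
    have "norm (f s) \<le> norm (f s - D s) + norm (D s)" using norm_triangle_ineq[of "f s - D s" "D s"] by simp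
    also have "\<dots> \<le> norm s + norm s * k" using d(2)[OF that] k by (intro add_mono)
    finally show ?thesis by (simp add: algebra_simps)
  qed
  moreover have "\<forall>\<^sub>F s in nhds (0 :: complex^'a). norm s < d"
    using eventually_nhds_in_open[of "ball (0 :: complex^'a) d" 0] d(1) by simp
  ultimately show ?thesis by (intro exI[of _ "1 + k"]) (auto elim: eventually_mono)
qed

lemma common_bound:
  fixes F :: "'i::finite \<Rightarrow> real \<Rightarrow> 'a::topological_space \<Rightarrow> bool"
  assumes "\<And>i. \<exists>C. \<forall>\<^sub>F s in nhds p. F i C s" and mono: "\<And>i C D s. F i C s \<Longrightarrow> C \<le> D \<Longrightarrow> F i D s"
  shows "\<exists>C. \<forall>\<^sub>F s in nhds p. \<forall>i. F i C s"
proof -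
  obtain C where C: "\<And>i. \<forall>\<^sub>F s in nhds p. F i (C i) s" using assms(1) by metis
  have "C i \<le> Max (range C)" for i by auto
  then have "\<forall>\<^sub>F s in nhds p. \<forall>i. F i (Max (range C)) s"
    by (intro eventually_all_finite eventually_mono[OF C]) (auto intro: mono)
  then show ?thesis by blast
qed

lemma matrix_vector_nth: "(A *v x) $ i = (\<Sum>b\<in>UNIV. A $ i $ b * x $ b)"
  by (simp add: matrix_vector_mult_def)

lemma iterate_mult_eigen: "A *v y = c *s y \<Longrightarrow> ((*v) A ^^ n) y = c ^ n *s y" for A :: "complex^'m^'m"
  by (induction n) (simp_all add: matrix_vector_scale mult.commute)

lemma iterate_mult_add: "((*v) A ^^ n) (x + y) = ((*v) A ^^ n) x + ((*v) A ^^ n) y" for A :: "complex^'m^'m"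
  by (induction n) (simp_all add: matrix_vector_right_distrib)

lemma iterate_mult_scale: "((*v) A ^^ n) (c *s x) = c *s ((*v) A ^^ n) x" for A :: "complex^'m^'m"
  by (induction n) (simp_all add: matrix_vector_scale)

lemma iterate_mult_zero: "((*v) A ^^ n) 0 = 0" for A :: "complex^'m^'m"
  by (induction n) simp_all

lemma iterate_mult_sum:
  "((*v) A ^^ n) (\<Sum>b\<in>S. c b *s f b) = (\<Sum>b\<in>S. c b *s ((*v) A ^^ n) (f b))" for A :: "complex^'m^'m"
  by (induction S rule: infinite_finite_induct)
     (simp_all add: iterate_mult_add iterate_mult_scale iterate_mult_zero)

definition l1norm :: "complex^'n \<Rightarrow> real" where "l1norm x = (\<Sum>j\<in>UNIV. norm (x $ j))"

lemma norm_le_l1norm: "norm x \<le> l1norm x"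
  unfolding l1norm_def norm_vec_def by (rule L2_set_le_sum) auto

lemma l1norm_nonneg: "l1norm x \<ge> 0" by (simp add: l1norm_def sum_nonneg)

lemma power_sum_le:
  fixes t :: "'i \<Rightarrow> real"
  assumes "finite A" "\<And>a. a \<in> A \<Longrightarrow> t a \<ge> 0" "\<And>a. a \<in> A \<Longrightarrow> t a ^ n \<le> D" "n > 0" "D \<ge> 0"
  shows "(\<Sum>a\<in>A. t a) ^ n \<le> real (card A) ^ n * D"
proof (cases "A = {}")
  case True
  then show ?thesis using assms(4) by (simp add: zero_power)
next
  case False
  obtain a where a: "a \<in> A" "\<And>b. b \<in> A \<Longrightarrow> t b \<le> t a"
  proof -
    have "Max (t ` A) \<in> t ` A" using False assms(1) by (intro Max_in) auto
    then obtain a where "a \<in> A" "Max (t ` A) = t a" by auto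
    moreover have "t b \<le> Max (t ` A)" if "b \<in> A" for b using that assms(1) by auto
    ultimately show thesis using that by metis
  qed
  have "(\<Sum>a\<in>A. t a) \<le> real (card A) * t a" using sum_bounded_above[of A t "t a"] a by simp
  then have "(\<Sum>a\<in>A. t a) ^ n \<le> (real (card A) * t a) ^ n"
    by (intro power_mono) (auto intro: sum_nonneg assms)
  also have "\<dots> \<le> real (card A) ^ n * D"
    using assms(3)[OF a(1)] by (simp add: power_mult_distrib mult_left_mono)
  finally show ?thesis .
qed

context free_family
begin

text \<open>
The images of the coordinate functions under the character \<open>y\<close> of the algebra at \<open>s\<close>. This is the
only point at which \<open>y\<close> can be the evaluation.
\<close>

definition char_point :: "complex^'m \<Rightarrow> complex^'m \<Rightarrow> complex^'n" where
  "char_point s y = (\<chi> j. pairing (coeffs_of (\<lambda>z. xs_x z $ j) s) y)"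

lemma chars_bounded: "\<exists>B. \<forall>\<^sub>F s in nhds 0. \<forall>y\<in>Ch s. \<forall>l. norm (y $ l) \<le> B"
proof -
  have "\<exists>B. \<forall>\<^sub>F s in nhds 0. \<forall>q :: 'm \<times> 'm \<times> 'm. norm (case q of (i, j, l) \<Rightarrow> w i j l s) \<le> B"
  proof (rule common_bound)
    fix q :: "'m \<times> 'm \<times> 'm"
    show "\<exists>C. \<forall>\<^sub>F s in nhds 0. norm (case q of (i, j, l) \<Rightarrow> w i j l s) \<le> C"
      by (cases q) (auto intro: hol_bounded w_hol)
  qed auto
  then obtain B where "\<forall>\<^sub>F s in nhds 0. \<forall>q :: 'm \<times> 'm \<times> 'm. norm (case q of (i, j, l) \<Rightarrow> w i j l s) \<le> B" by blast
  then have "\<forall>\<^sub>F s in nhds 0. \<forall>y\<in>Ch s. \<forall>l. norm (y $ l) \<le> CARD('m) * B"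
  proof eventually_elim
    case (elim s)
    have "norm (w i j l s) \<le> B" for i j l using elim[rule_format, of "(i, j, l)"] by simp
    then show ?case using char_norm_bound[where w="w_at s" and B=B] by blast
  qed
  then show ?thesis by blast
qed

lemma represents_prod:
  assumes "finite A" "\<And>i. i \<in> A \<Longrightarrow> represents (g i) (c i)"
  shows "\<exists>d. represents (\<lambda>z. \<Prod>i\<in>A. g i z) d \<and> (\<forall>\<^sub>F s in nhds 0. \<forall>y\<in>Ch s. pairing (d s) y = (\<Prod>i\<in>A. pairing (c i s) y))"
  using assms
proof (induction A rule: finite_induct)
  case empty
  then show ?case using represents_un pairing_unit_coeffs by auto
next
  case (insert i A)
  then obtain d where d: "represents (\<lambda>z. \<Prod>i\<in>A. g i z) d"
    "\<forall>\<^sub>F s in nhds 0. \<forall>y\<in>Ch s. pairing (d s) y = (\<Prod>i\<in>A. pairing (c i s) y)" by auto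
  have "represents (\<lambda>z. \<Prod>i\<in>insert i A. g i z) (\<lambda>s. alg_mult (w_at s) (c i s) (d s))"
    using represents_mult[OF insert.prems[of i] d(1)] insert.hyps by simp
  moreover have "\<forall>\<^sub>F s in nhds 0. \<forall>y\<in>Ch s. pairing (alg_mult (w_at s) (c i s) (d s)) y = (\<Prod>i\<in>insert i A. pairing (c i s) y)"
    using d(2) by eventually_elim (use insert.hyps in \<open>auto simp: pairing_amul\<close>)
  ultimately show ?case by blast
qed

lemma represents_affine: "represents (\<lambda>z. xs_x z $ j - a) (\<lambda>s. coeffs_of (\<lambda>z. xs_x z $ j) s - a *s unit_coeffs s)"
  using represents_add[OF represents_cf[OF xs_x_coord_hol] represents_const_scale[OF represents_un, of "- a"]] by simp

text \<open>
For a point \<open>\<xi>\<close> outside the ball the function \<open>\<Sum>\<^sub>j cnj \<xi>\<^sub>j (x\<^sub>j - \<xi>\<^sub>j)\<close> has negative real part on the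
ball, so it is invertible as a germ. A character cannot send an invertible element to \<open>0\<close>, but it
sends this function to \<open>0\<close> if it sends \<open>x\<close> to \<open>\<xi>\<close>.
\<close>

lemma char_point_zero_in_X:
  assumes y: "y \<in> Ch 0" shows "char_point 0 y \<in> X"
proof (rule ccontr)
  let ?x = "char_point 0 y"
  assume "?x \<notin> X"
  then have nx: "norm ?x > \<delta>" by (simp add: X)
  define q where "q z = (\<Sum>j\<in>UNIV. cnj (?x $ j) * (xs_x z $ j - ?x $ j))" for z :: "complex^('n + 'm)"
  have cdq: "complex_differentiable_at q z" for z
    unfolding q_def[abs_def] xs_x_def
    by (intro complex_differentiable_sum complex_differentiable_mult complex_differentiable_diff
        complex_differentiable_const) (simp add: complex_differentiable_coord)
  have qh: "q \<in> hol K" by (rule hol_everywhere[OF cdq])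
  have q0: "q z \<noteq> 0" if "z \<in> K" for z
  proof -
    have "norm (xs_x z) \<le> \<delta>" using that by (simp add: slab_def X)
    have "Re (q z) = ?x \<bullet> xs_x z - ?x \<bullet> ?x"
      by (simp add: q_def inner_vec_def inner_complex_def sum_subtractf[symmetric] algebra_simps)
    also have "\<dots> \<le> norm ?x * norm (xs_x z) - norm ?x ^ 2"
      using norm_cauchy_schwarz[of ?x "xs_x z"] by (simp add: power2_norm_eq_inner)
    also have "\<dots> \<le> norm ?x * \<delta> - norm ?x ^ 2"
      using \<open>norm (xs_x z) \<le> \<delta>\<close> by (simp add: mult_left_mono)
    also have "\<dots> = norm ?x * (\<delta> - norm ?x)" by (simp add: algebra_simps power2_eq_square)
    also have "\<dots> < 0" using nx \<delta> by (intro mult_pos_neg) auto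
    finally show ?thesis by auto
  qed
  have q0': "\<forall>\<^sub>F z in nhds p. q z \<noteq> 0" if "p \<in> K" for p
    by (rule eventually_nhds_compose[OF complex_differentiable_isCont[OF cdq], where P="\<lambda>x. x \<noteq> 0"])
       (use q0[OF that] in \<open>auto intro: eventually_nhds_in_open[of "- {0}", simplified]\<close>)
  have ih: "(\<lambda>z. inverse (q z)) \<in> hol K"
    unfolding hol_def
    by (auto intro!: eventually_mono[OF q0'] complex_differentiable_inverse cdq)
  have "(\<lambda>z. q z * inverse (q z) - 1) \<in> J"
    by (rule J_near[OF J_zero]) (auto simp: eq_near_def intro!: eventually_mono[OF q0'])
  from represents_congruent[OF represents_mult[OF represents_cf[OF qh] represents_cf[OF ih]] represents_un this]
  have "alg_mult (w_at 0) (coeffs_of q 0) (coeffs_of (\<lambda>z. inverse (q z)) 0) = unit_coeffs 0"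
    by (rule eventually_nhds_x_imp_x)
  then have "pairing (coeffs_of q 0) y * pairing (coeffs_of (\<lambda>z. inverse (q z)) 0) y = pairing (unit_coeffs 0) y"
    by (metis pairing_amul[OF y])
  also have un1: "pairing (unit_coeffs 0) y = 1" using eventually_nhds_x_imp_x[OF pairing_unit_coeffs] y by blast
  finally have 1: "pairing (coeffs_of q 0) y \<noteq> 0" by auto
  have "represents q (\<lambda>s. \<Sum>j\<in>UNIV. cnj (?x $ j) *s (coeffs_of (\<lambda>z. xs_x z $ j) s - ?x $ j *s unit_coeffs s))"
    unfolding q_def[abs_def] by (intro represents_sum represents_const_scale represents_affine)
  from eventually_nhds_x_imp_x[OF pairing_coeffs_of[OF this]]
  have "pairing (coeffs_of q 0) y = (\<Sum>j\<in>UNIV. cnj (?x $ j) * (pairing (coeffs_of (\<lambda>z. xs_x z $ j) 0) y - ?x $ j))"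
    by (simp add: pairing_sum pairing_linear un1 right_diff_distrib mult.assoc)
  also have "\<dots> = 0" by (simp add: char_point_def)
  finally show False using 1 by simp
qed

text \<open>
If all characters at \<open>s = 0\<close> kill an element, its multiplication matrix at \<open>0\<close> is nilpotent. So the
entries of the \<open>\<mu>\<close>-th power of the matrix at \<open>s\<close> vanish at \<open>0\<close> and are \<open>O(|s|)\<close>; they bound the
\<open>\<mu>\<close>-th powers of the eigenvalues.
\<close>

lemma nilpotent_estimate:
  assumes c: "c \<in> holv {0}" and nil: "\<And>y. y \<in> Ch 0 \<Longrightarrow> pairing (c 0) y = 0"
  shows "\<exists>C. \<forall>\<^sub>F s in nhds 0. \<forall>y\<in>Ch s. norm (pairing (c s) y) ^ CARD('m) \<le> C * norm s"
proof -
  define A where "A s = mulmat (w_at s) (c s)" for s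
  have entries: "(\<lambda>s. A s $ i $ b) \<in> hol {0}" for i b
    using c unfolding A_def mulmat_def by (simp add: hol_sum hol_mult w_hol holv_simps)
  have iter: "(\<lambda>s. ((*v) (A s) ^^ n) v $ i) \<in> hol {0}" for n v i
  proof (induction n arbitrary: i)
    case 0
    then show ?case by (simp add: hol_const)
  next
    case (Suc n)
    have "(\<lambda>s. \<Sum>b\<in>UNIV. A s $ i $ b * ((*v) (A s) ^^ n) v $ b) \<in> hol {0}"
      by (intro hol_sum hol_mult entries Suc)
    then show ?case by (simp add: matrix_vector_nth)
  qed
  have "((*v) (A 0) ^^ CARD('m)) v = 0" for v
    unfolding A_def
    by (rule structure_constants.nilpotent_mulmat[OF eventually_nhds_x_imp_x[OF eventually_structure] nil])
  then have "\<exists>C. \<forall>\<^sub>F s in nhds 0. \<forall>q :: 'm \<times> 'm.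
      norm (((*v) (A s) ^^ CARD('m)) (axis (snd q) 1) $ fst q) \<le> C * norm s"
  proof (intro common_bound hol_lipschitz_at_zero iter)
    fix q :: "'m \<times> 'm" and C D and s :: "complex^'m"
    assume "norm (((*v) (A s) ^^ CARD('m)) (axis (snd q) 1) $ fst q) \<le> C * norm s" "C \<le> D"
    then show "norm (((*v) (A s) ^^ CARD('m)) (axis (snd q) 1) $ fst q) \<le> D * norm s"
      by (meson mult_right_mono norm_ge_zero order_trans)
  qed simp
  then obtain C where "\<forall>\<^sub>F s in nhds 0. \<forall>q :: 'm \<times> 'm.
      norm (((*v) (A s) ^^ CARD('m)) (axis (snd q) 1) $ fst q) \<le> C * norm s" by blast
  then have "\<forall>\<^sub>F s in nhds 0. \<forall>y\<in>Ch s. norm (pairing (c s) y) ^ CARD('m) \<le> (CARD('m) * C) * norm s"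
  proof eventually_elim
    case (elim s)
    have E: "norm (((*v) (A s) ^^ CARD('m)) (axis b 1) $ i) \<le> C * norm s" for i b
      using elim[rule_format, of "(i, b)"] by simp
    show ?case
    proof
      fix y assume y: "y \<in> Ch s"
      obtain i where i: "\<forall>b. norm (y $ b) \<le> norm (y $ i)" by (rule max_component)
      have "y \<noteq> 0" using y by (simp add: algebra_chars_def)
      then obtain b where "y $ b \<noteq> 0" by (metis vec_eq_iff zero_index)
      then have "0 < norm (y $ b)" by simp
      then have pos: "norm (y $ i) > 0" using i by (metis less_le_trans)
      have ys: "y = (\<Sum>b\<in>UNIV. y $ b *s axis b 1)"
        by (simp add: vec_eq_iff axis_def if_distrib[of "(*) _"] cong: if_cong)
      have "pairing (c s) y ^ CARD('m) *s y = ((*v) (A s) ^^ CARD('m)) y"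
        by (rule iterate_mult_eigen[symmetric]) (simp add: A_def mulmat_char[OF y])
      also have "\<dots> = (\<Sum>b\<in>UNIV. y $ b *s ((*v) (A s) ^^ CARD('m)) (axis b 1))"
        by (subst ys) (rule iterate_mult_sum)
      finally have "pairing (c s) y ^ CARD('m) * y $ i = (\<Sum>b\<in>UNIV. y $ b * ((*v) (A s) ^^ CARD('m)) (axis b 1) $ i)"
        by (simp add: vec_eq_iff)
      then have "norm (pairing (c s) y) ^ CARD('m) * norm (y $ i)
          = norm (\<Sum>b\<in>UNIV. y $ b * ((*v) (A s) ^^ CARD('m)) (axis b 1) $ i)"
        by (metis norm_mult norm_power)
      also have "\<dots> \<le> (\<Sum>b\<in>(UNIV::'m set). norm (y $ i) * (C * norm s))"
        by (rule order_trans[OF norm_sum sum_mono]) (use i E in \<open>auto simp: norm_mult intro!: mult_mono\<close>)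
      also have "\<dots> = (CARD('m) * C * norm s) * norm (y $ i)" by simp
      finally show "norm (pairing (c s) y) ^ CARD('m) \<le> CARD('m) * C * norm s" using pos by simp
    qed
  qed
  then show ?thesis by blast
qed

text \<open>
The points of the special fibre.
\<close>

definition Xi0 :: "(complex^'n) set" where "Xi0 = char_point 0 ` Ch 0"

lemma Xi0_finite: "finite Xi0"
  unfolding Xi0_def
  by (rule finite_imageI, rule structure_constants.finite_chars, rule eventually_nhds_x_imp_x[OF eventually_structure])

lemma Xi0_subset: "Xi0 \<subseteq> X"
  unfolding Xi0_def using char_point_zero_in_X by auto

text \<open>
Choose a coordinate \<open>\<sigma> p\<close> for each point \<open>p\<close> of the special fibre. The product of the functions
\<open>x\<^sub>\<sigma>\<^sub>p - p\<^sub>\<sigma>\<^sub>p\<close> over all \<open>p\<close> vanishes on the special fibre, and \<open>nilpotent_estimate\<close> applies. The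
product of the \<open>\<ell>\<^sup>1\<close>-distances expands into the sum of the moduli of these products over all
choices \<open>\<sigma>\<close>.
\<close>

lemma proximity:
  "\<exists>C\<ge>0. \<forall>\<^sub>F s in nhds 0. \<forall>y\<in>Ch s. (\<Prod>p\<in>Xi0. l1norm (char_point s y - p)) ^ CARD('m) \<le> C * norm s"
proof -
  define \<Sigma> where "\<Sigma> = PiE Xi0 (\<lambda>_. UNIV :: 'n set)"
  have fin: "finite \<Sigma>" unfolding \<Sigma>_def using Xi0_finite by (intro finite_PiE) auto
  define t where "t \<sigma> s y = (\<Prod>p\<in>Xi0. norm (char_point s y $ \<sigma> p - p $ \<sigma> p))" for \<sigma> s y
  have "\<exists>C. \<forall>\<^sub>F s in nhds 0. \<forall>y\<in>Ch s. t \<sigma> s y ^ CARD('m) \<le> C * norm s" for \<sigma>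
  proof -
    obtain d where d: "represents (\<lambda>z. \<Prod>p\<in>Xi0. xs_x z $ \<sigma> p - p $ \<sigma> p) d"
      "\<forall>\<^sub>F s in nhds 0. \<forall>y\<in>Ch s. pairing (d s) y = (\<Prod>p\<in>Xi0. pairing (coeffs_of (\<lambda>z. xs_x z $ \<sigma> p) s - p $ \<sigma> p *s unit_coeffs s) y)"
      using represents_prod[OF Xi0_finite, of "\<lambda>p z. xs_x z $ \<sigma> p - p $ \<sigma> p"
          "\<lambda>p s. coeffs_of (\<lambda>z. xs_x z $ \<sigma> p) s - p $ \<sigma> p *s unit_coeffs s"] represents_affine by auto
    have d': "\<forall>\<^sub>F s in nhds 0. \<forall>y\<in>Ch s. pairing (d s) y = (\<Prod>p\<in>Xi0. char_point s y $ \<sigma> p - p $ \<sigma> p)"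
      using d(2) pairing_unit_coeffs by eventually_elim (auto simp: pairing_linear char_point_def)
    have "pairing (d 0) y = 0" if "y \<in> Ch 0" for y
    proof -
      have "char_point 0 y \<in> Xi0" using that by (simp add: Xi0_def)
      then have "(\<Prod>p\<in>Xi0. char_point 0 y $ \<sigma> p - p $ \<sigma> p) = 0"
        using Xi0_finite by (intro prod_zero) auto
      then show ?thesis using eventually_nhds_x_imp_x[OF d'] that by simp
    qed
    then obtain C where "\<forall>\<^sub>F s in nhds 0. \<forall>y\<in>Ch s. norm (pairing (d s) y) ^ CARD('m) \<le> C * norm s"
      using nilpotent_estimate[of d] d(1) by (auto simp: represents_def)
    then have "\<forall>\<^sub>F s in nhds 0. \<forall>y\<in>Ch s. t \<sigma> s y ^ CARD('m) \<le> C * norm s"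
      using d' by eventually_elim (auto simp: t_def prod_norm)
    then show ?thesis by blast
  qed
  then have "\<forall>\<sigma>. \<exists>C. \<forall>\<^sub>F s in nhds 0. \<forall>y\<in>Ch s. t \<sigma> s y ^ CARD('m) \<le> C * norm s" by (rule allI)
  from choice[OF this] obtain C where
    C: "\<forall>\<sigma>. \<forall>\<^sub>F s in nhds 0. \<forall>y\<in>Ch s. t \<sigma> s y ^ CARD('m) \<le> C \<sigma> * norm s" by (rule exE)
  define D where "D = (\<Sum>\<sigma>\<in>\<Sigma>. \<bar>C \<sigma>\<bar>)"
  have D: "C \<sigma> \<le> D" if "\<sigma> \<in> \<Sigma>" for \<sigma>
    unfolding D_def by (rule order_trans[OF abs_ge_self member_le_sum[OF that]]) (auto simp: fin)
  have D0: "D \<ge> 0" by (simp add: D_def sum_nonneg)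
  have "\<forall>\<^sub>F s in nhds 0. \<forall>\<sigma>\<in>\<Sigma>. \<forall>y\<in>Ch s. t \<sigma> s y ^ CARD('m) \<le> C \<sigma> * norm s"
    using fin C by (intro eventually_ball_finite) auto
  then have "\<forall>\<^sub>F s in nhds 0. \<forall>y\<in>Ch s. (\<Prod>p\<in>Xi0. l1norm (char_point s y - p)) ^ CARD('m) \<le> (real (card \<Sigma>) ^ CARD('m) * D) * norm s"
  proof eventually_elim
    case (elim s)
    show ?case
    proof
      fix y assume y: "y \<in> Ch s"
      have "(\<Prod>p\<in>Xi0. l1norm (char_point s y - p)) = (\<Sum>\<sigma>\<in>\<Sigma>. t \<sigma> s y)"
        unfolding l1norm_def \<Sigma>_def t_def
        by (subst prod_sum_PiE) (auto simp: Xi0_finite)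
      also have "\<dots> ^ CARD('m) \<le> real (card \<Sigma>) ^ CARD('m) * (D * norm s)"
      proof (rule power_sum_le[OF fin])
        fix \<sigma> assume \<sigma>: "\<sigma> \<in> \<Sigma>"
        show "t \<sigma> s y \<ge> 0" by (simp add: t_def prod_nonneg)
        have "t \<sigma> s y ^ CARD('m) \<le> C \<sigma> * norm s" using elim y \<sigma> by blast
        also have "\<dots> \<le> D * norm s" by (intro mult_right_mono D \<sigma>) auto
        finally show "t \<sigma> s y ^ CARD('m) \<le> D * norm s" .
      qed (use D0 in auto)
      finally show "(\<Prod>p\<in>Xi0. l1norm (char_point s y - p)) ^ CARD('m) \<le> (real (card \<Sigma>) ^ CARD('m) * D) * norm s"
        by (simp add: mult.assoc)
    qed
  qed
  then show ?thesis using D0 by (intro exI[of _ "real (card \<Sigma>) ^ CARD('m) * D"]) auto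
qed

end

section \<open>Expansion in homogeneous polynomials\<close>

lemma norm_vec_sq: "(norm (x :: complex^'n))\<^sup>2 = (\<Sum>i\<in>UNIV. (norm (x $ i))\<^sup>2)"
  unfolding norm_vec_def L2_set_def by (rule real_sqrt_pow2) (simp add: sum_nonneg)

lemma norm_join_le: "norm (join x s) \<le> norm x + norm s"
proof -
  have "(norm (join x s))\<^sup>2 = (norm x)\<^sup>2 + (norm s)\<^sup>2"
    by (simp only: norm_vec_sq sum_UNIV_sum_type join_simps)
  also have "\<dots> \<le> (norm x + norm s)\<^sup>2" by (simp add: power2_sum)
  finally show ?thesis by (rule power2_le_imp_le) simp
qed

lemma norm_cscale: "norm (c *s x :: complex^'n) = norm c * norm x"
proof -
  have "(norm (c *s x))\<^sup>2 = (norm c * norm x)\<^sup>2"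
    by (simp only: norm_vec_sq vector_smult_component norm_mult power_mult_distrib sum_distrib_left)
  then show ?thesis by (simp add: power2_eq_iff_nonneg)
qed

lemma join_diff: "join x s - join y t = join (x - y) (s - t)"
proof -
  have "(join x s - join y t) $ q = join (x - y) (s - t) $ q" for q by (cases q) auto
  then show ?thesis by (simp add: vec_eq_iff)
qed

text \<open>
Compactness of the ball turns local validity along \<open>X \<times> {0}\<close> into validity on a product
neighbourhood.
\<close>

lemma slab_ball_polybox:
  fixes Q :: "complex^('n::finite + 'm::finite) \<Rightarrow> bool"
  assumes Q: "\<And>p. p \<in> slab (cball 0 \<delta>) \<Longrightarrow> \<forall>\<^sub>F z in nhds p. Q z" and "\<delta> > 0"
  obtains R r where "R > \<delta>" "r > 0" "\<forall>z\<in>polybox R r. Q z"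
proof -
  define U where "U = {z. \<forall>\<^sub>F w in nhds z. Q w}"
  have "open U"
    unfolding U_def by (subst open_subopen) (auto simp: eventually_nhds)
  have slab: "slab (cball 0 \<delta>) = (\<lambda>x. join x (0 :: complex^'m)) ` cball (0 :: complex^'n) \<delta>"
  proof -
    have "z \<in> (\<lambda>x. join x 0) ` cball (0 :: complex^'n) \<delta>" if "z \<in> slab (cball 0 \<delta>)" for z :: "complex^('n + 'm)"
      using that join_simps(3)[of z] by (auto simp: slab_def intro!: image_eqI[of _ _ "xs_x z"])
    then show ?thesis by (auto simp: slab_def)
  qed
  have "compact (slab (cball (0 :: complex^'n) \<delta>) :: (complex^('n + 'm)) set)"
    unfolding slab
    by (rule compact_continuous_image) (auto intro!: continuous_on_join continuous_intros)
  moreover have "slab (cball 0 \<delta>) \<subseteq> U" using Q by (auto simp: U_def)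
  ultimately obtain \<epsilon> where \<epsilon>: "\<epsilon> > 0" "(\<Union>x\<in>slab (cball 0 \<delta>). ball x \<epsilon>) \<subseteq> U"
    using compact_subset_open_imp_ball_epsilon_subset[OF _ \<open>open U\<close>] by blast
  show thesis
  proof
    show "\<delta> + \<epsilon> / 3 > \<delta>" "\<epsilon> / 3 > 0" using \<epsilon> by auto
    show "\<forall>z\<in>polybox (\<delta> + \<epsilon> / 3) (\<epsilon> / 3). Q z"
    proof
      fix z :: "complex^('n + 'm)" assume z: "z \<in> polybox (\<delta> + \<epsilon> / 3) (\<epsilon> / 3)"
      have "\<exists>p. norm p \<le> \<delta> \<and> norm (xs_x z - p) < \<epsilon> / 3"
      proof (cases "norm (xs_x z) \<le> \<delta>")
        case True
        then show ?thesis using \<epsilon> by (intro exI[of _ "xs_x z"]) auto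
      next
        case False
        define n where "n = norm (xs_x z)"
        have n: "n > \<delta>" "n > 0" using False \<open>\<delta> > 0\<close> by (auto simp: n_def)
        have "xs_x z - (\<delta> / n) *\<^sub>R xs_x z = (1 - \<delta> / n) *\<^sub>R xs_x z" by (simp add: scaleR_left_diff_distrib)
        then have "norm (xs_x z - (\<delta> / n) *\<^sub>R xs_x z) = \<bar>1 - \<delta> / n\<bar> * n" by (simp add: n_def)
        also have "\<dots> = n - \<delta>" using n \<open>\<delta> > 0\<close> by (simp add: abs_if field_simps)
        also have "\<dots> < \<epsilon> / 3" using z by (simp add: polybox_def n_def)
        finally have "norm (xs_x z - (\<delta> / n) *\<^sub>R xs_x z) < \<epsilon> / 3" .
        moreover have "norm ((\<delta> / n) *\<^sub>R xs_x z) \<le> \<delta>" using n \<open>\<delta> > 0\<close> by (simp add: n_def)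
        ultimately show ?thesis by blast
      qed
      then obtain p where p: "norm p \<le> \<delta>" "norm (xs_x z - p) < \<epsilon> / 3" by blast
      have "dist (join p 0) z = norm (join (xs_x z - p) (xs_s z - 0))"
        by (metis dist_commute dist_norm join_diff join_simps(3))
      also have "\<dots> \<le> norm (xs_x z - p) + norm (xs_s z - 0)" by (rule norm_join_le)
      also have "\<dots> < \<epsilon>" using p(2) z \<epsilon> by (simp add: polybox_def)
      finally have "z \<in> ball (join p 0) \<epsilon>" by simp
      moreover have "join p 0 \<in> slab (cball 0 \<delta>)" using p(1) by (simp add: slab_def)
      ultimately have "z \<in> U" using \<epsilon>(2) by blast
      then show "Q z" by (auto simp: U_def dest: eventually_nhds_x_imp_x)
    qed
  qed
qed


text \<open>
The part of degree \<open>k\<close> in the expansion of \<open>g\<close> into homogeneous polynomials in \<open>x\<close>, for fixed \<open>s\<close>.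
\<close>

definition ray_coeff :: "nat \<Rightarrow> (complex^('n::finite + 'm::finite) \<Rightarrow> complex) \<Rightarrow> complex^('n + 'm) \<Rightarrow> complex" where
  "ray_coeff k g z = (deriv ^^ k) (\<lambda>\<tau>. g (join (\<tau> *s xs_x z) (xs_s z))) 0 / fact k"

lemma ray_field_differentiable:
  assumes "\<And>z. z \<in> polybox R r \<Longrightarrow> complex_differentiable_at g z"
    and "norm s < r" "norm \<tau> * norm x < R"
  shows "(\<lambda>\<tau>. g (join (\<tau> *s x) s)) field_differentiable (at \<tau>)"
proof (rule complex_differentiable_along_curve)
  fix q show "(\<lambda>\<tau>. join (\<tau> *s x) s $ q) field_differentiable (at \<tau>)"
    by (cases q) (auto intro!: field_differentiable_mult)
next
  show "complex_differentiable_at g (join (\<tau> *s x) s)"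
    by (rule assms(1)) (use assms(2,3) in \<open>simp add: polybox_def norm_cscale\<close>)
qed

lemma ray_holomorphic:
  assumes "\<And>z. z \<in> polybox R r \<Longrightarrow> complex_differentiable_at g z"
    and "norm s < r" "\<And>\<tau>. \<tau> \<in> S \<Longrightarrow> norm \<tau> * norm x < R"
  shows "(\<lambda>\<tau>. g (join (\<tau> *s x) s)) holomorphic_on S"
  unfolding holomorphic_on_def
  using ray_field_differentiable[OF assms(1,2,3)] by (blast intro: field_differentiable_at_within)

lemma ray_coeff_0: "ray_coeff 0 g z = g (join 0 (xs_s z))"
  by (simp add: ray_coeff_def)

text \<open>
Dividing by the coordinates lowers the degree by one. By this recursion \<open>ray_coeff k g\<close> is a polynomial
in \<open>x\<close> of degree \<open>k\<close> with coefficients depending on \<open>s\<close>, and no multi-indices appear.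
\<close>

lemma ray_coeff_Suc:
  assumes g: "\<And>z. z \<in> polybox R r \<Longrightarrow> complex_differentiable_at g z"
    and h: "\<And>j z. z \<in> polybox R r \<Longrightarrow> complex_differentiable_at (h j) z"
    and gh: "\<And>z. z \<in> polybox R r \<Longrightarrow> g z = g (join 0 (xs_s z)) + (\<Sum>j\<in>UNIV. xs_x z $ j * h j z)"
    and z: "z \<in> polybox R r" and "R > 0"
  shows "ray_coeff (Suc k) g z = (\<Sum>j\<in>UNIV. xs_x z $ j * ray_coeff k (h j) z)"
proof -
  define x where "x = xs_x z"
  define s where "s = xs_s z"
  have zz: "norm x < R" "norm s < r" using z by (auto simp: polybox_def x_def s_def)
  define S where "S = ball (0 :: complex) 1"
  have inS: "norm \<tau> * norm x < R" if "\<tau> \<in> S" for \<tau>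
  proof -
    have "norm \<tau> * norm x \<le> 1 * norm x" using that by (intro mult_right_mono) (auto simp: S_def)
    then show ?thesis using zz by simp
  qed
  have holh: "(\<lambda>\<tau>. h j (join (\<tau> *s x) s)) holomorphic_on S" for j
    by (rule ray_holomorphic[OF h zz(2) inS])
  have holi: "(\<lambda>\<tau>. \<Sum>j\<in>UNIV. x $ j * h j (join (\<tau> *s x) s)) holomorphic_on S"
    by (intro holomorphic_intros holh)
  have S: "open S" "0 \<in> S" by (auto simp: S_def)
  have "(deriv ^^ Suc k) (\<lambda>\<tau>. g (join (\<tau> *s x) s)) 0
      = (deriv ^^ Suc k) (\<lambda>\<tau>. g (join 0 s) + \<tau> * (\<Sum>j\<in>UNIV. x $ j * h j (join (\<tau> *s x) s))) 0"
  proof (rule higher_deriv_transform_within_open[OF _ _ S])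
    show "(\<lambda>\<tau>. g (join (\<tau> *s x) s)) holomorphic_on S"
      by (rule ray_holomorphic[OF g zz(2) inS])
    show "(\<lambda>\<tau>. g (join 0 s) + \<tau> * (\<Sum>j\<in>UNIV. x $ j * h j (join (\<tau> *s x) s))) holomorphic_on S"
      by (intro holomorphic_intros holh)
    fix \<tau> assume "\<tau> \<in> S"
    then have "join (\<tau> *s x) s \<in> polybox R r"
      using inS zz by (simp add: polybox_def norm_cscale)
    from gh[OF this]
    show "g (join (\<tau> *s x) s) = g (join 0 s) + \<tau> * (\<Sum>j\<in>UNIV. x $ j * h j (join (\<tau> *s x) s))"
      by (simp add: sum_distrib_left mult.assoc)
  qed
  also have "\<dots> = (deriv ^^ Suc k) (\<lambda>\<tau>. g (join 0 s)) 0
      + (deriv ^^ Suc k) (\<lambda>\<tau>. \<tau> * (\<Sum>j\<in>UNIV. x $ j * h j (join (\<tau> *s x) s))) 0"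
    by (rule higher_deriv_add[OF _ _ S]) (intro holomorphic_intros holh)+
  also have "(deriv ^^ Suc k) (\<lambda>\<tau>. g (join 0 s)) 0 = 0" by simp
  also have "(deriv ^^ Suc k) (\<lambda>\<tau>. \<tau> * (\<Sum>j\<in>UNIV. x $ j * h j (join (\<tau> *s x) s))) 0
     = (\<Sum>i = 0..Suc k. of_nat (Suc k choose i) * (deriv ^^ i) (\<lambda>\<tau>. \<tau>) 0
          * (deriv ^^ (Suc k - i)) (\<lambda>\<tau>. \<Sum>j\<in>UNIV. x $ j * h j (join (\<tau> *s x) s)) 0)"
    by (rule higher_deriv_mult[OF _ holi S]) (intro holomorphic_intros)
  also have "\<dots> = (\<Sum>i \<in> {1}. of_nat (Suc k choose i) * (deriv ^^ i) (\<lambda>\<tau>. \<tau>) 0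
          * (deriv ^^ (Suc k - i)) (\<lambda>\<tau>. \<Sum>j\<in>UNIV. x $ j * h j (join (\<tau> *s x) s)) 0)"
    by (rule sum.mono_neutral_right) auto
  also have "\<dots> = of_nat (Suc k) * (deriv ^^ k) (\<lambda>\<tau>. \<Sum>j\<in>UNIV. x $ j * h j (join (\<tau> *s x) s)) 0"
    by simp
  also have "(deriv ^^ k) (\<lambda>\<tau>. \<Sum>j\<in>UNIV. x $ j * h j (join (\<tau> *s x) s)) 0
      = (\<Sum>j\<in>UNIV. x $ j * (deriv ^^ k) (\<lambda>\<tau>. h j (join (\<tau> *s x) s)) 0)"
  proof -
    have "(deriv ^^ k) (\<lambda>\<tau>. \<Sum>j\<in>A. x $ j * h j (join (\<tau> *s x) s)) 0
      = (\<Sum>j\<in>A. x $ j * (deriv ^^ k) (\<lambda>\<tau>. h j (join (\<tau> *s x) s)) 0)" for A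
    proof (induction A rule: infinite_finite_induct)
      case (insert j A)
      have "(deriv ^^ k) (\<lambda>\<tau>. x $ j * h j (join (\<tau> *s x) s) + (\<Sum>j\<in>A. x $ j * h j (join (\<tau> *s x) s))) 0
          = (deriv ^^ k) (\<lambda>\<tau>. x $ j * h j (join (\<tau> *s x) s)) 0
            + (deriv ^^ k) (\<lambda>\<tau>. \<Sum>j\<in>A. x $ j * h j (join (\<tau> *s x) s)) 0"
        by (rule higher_deriv_add[OF _ _ S]) (intro holomorphic_intros holh)+
      moreover have "(deriv ^^ k) (\<lambda>\<tau>. x $ j * h j (join (\<tau> *s x) s)) 0 = x $ j * (deriv ^^ k) (\<lambda>\<tau>. h j (join (\<tau> *s x) s)) 0"
        by (rule higher_deriv_cmult[OF holh S(2,1)])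
      ultimately show ?case using insert by simp
    qed simp_all
    then show ?thesis .
  qed
  finally have "(deriv ^^ Suc k) (\<lambda>\<tau>. g (join (\<tau> *s x) s)) 0 = of_nat (Suc k) * (\<Sum>j\<in>UNIV. x $ j * (deriv ^^ k) (\<lambda>\<tau>. h j (join (\<tau> *s x) s)) 0)"
    by (simp only: add_0_left)
  then have "ray_coeff (Suc k) g z = of_nat (Suc k) * (\<Sum>j\<in>UNIV. x $ j * (deriv ^^ k) (\<lambda>\<tau>. h j (join (\<tau> *s x) s)) 0) / (of_nat (Suc k) * fact k)"
    unfolding ray_coeff_def x_def s_def by (simp only: fact_Suc)
  also have "\<dots> = (\<Sum>j\<in>UNIV. x $ j * (deriv ^^ k) (\<lambda>\<tau>. h j (join (\<tau> *s x) s)) 0) / fact k"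
    by (rule nonzero_mult_divide_mult_cancel_left) (rule of_nat_neq_0)
  finally show ?thesis
    by (simp add: ray_coeff_def x_def s_def sum_divide_distrib)
qed

lemma ray_coeff_bound:
  assumes g: "\<And>z. z \<in> polybox R r \<Longrightarrow> complex_differentiable_at g z"
    and B: "\<And>z. z \<in> polybox R r \<Longrightarrow> norm (g z) \<le> B"
    and z: "norm (xs_s z) < r" "\<rho> * norm (xs_x z) < R" and "\<rho> > 0"
  shows "norm (ray_coeff k g z) \<le> B / \<rho> ^ k"
proof -
  have in\<rho>: "norm \<tau> * norm (xs_x z) < R" if "norm \<tau> \<le> \<rho>" for \<tau> :: complex
    using mult_right_mono[OF that, of "norm (xs_x z)"] z by simp
  have "norm ((deriv ^^ k) (\<lambda>\<tau>. g (join (\<tau> *s xs_x z) (xs_s z))) 0) \<le> fact k * B / \<rho> ^ k"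
  proof (rule Cauchy_inequality)
    have "(\<lambda>\<tau>. g (join (\<tau> *s xs_x z) (xs_s z))) holomorphic_on cball 0 \<rho>"
      by (rule ray_holomorphic[OF g z(1)]) (auto intro: in\<rho>)
    then show "continuous_on (cball 0 \<rho>) (\<lambda>\<tau>. g (join (\<tau> *s xs_x z) (xs_s z)))"
       "(\<lambda>\<tau>. g (join (\<tau> *s xs_x z) (xs_s z))) holomorphic_on ball 0 \<rho>"
      by (auto intro: holomorphic_on_imp_continuous_on holomorphic_on_subset)
    fix \<tau> :: complex assume "norm (0 - \<tau>) = \<rho>"
    then show "norm (g (join (\<tau> *s xs_x z) (xs_s z))) \<le> B"
      by (intro B) (use in\<rho>[of \<tau>] z in \<open>simp add: polybox_def norm_cscale\<close>)
  qed fact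
  then show ?thesis by (simp add: ray_coeff_def norm_divide field_simps)
qed

lemma ray_coeff_sums:
  assumes g: "\<And>z. z \<in> polybox R r \<Longrightarrow> complex_differentiable_at g z"
    and z: "norm (xs_s z) < r" "\<rho> * norm (xs_x z) < R" and "\<rho> > 1"
  shows "(\<lambda>k. ray_coeff k g z) sums g z"
proof -
  have in\<rho>: "norm \<tau> * norm (xs_x z) < R" if "norm \<tau> \<le> \<rho>" for \<tau> :: complex
    using mult_right_mono[OF that, of "norm (xs_x z)"] z by simp
  have "(\<lambda>\<tau>. g (join (\<tau> *s xs_x z) (xs_s z))) holomorphic_on ball 0 \<rho>"
    by (rule ray_holomorphic[OF g z(1)]) (auto intro: in\<rho>)
  from holomorphic_power_series[OF this, of 1] \<open>\<rho> > 1\<close>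
  show ?thesis by (simp add: ray_coeff_def)
qed

text \<open>
Cauchy's inequality on circles of radius \<open>\<epsilon>\<close> bounds the \<open>n\<close>-th derivative at \<open>0\<close> by
\<open>O(\<epsilon>\<^sup>n\<^sup>+\<^sup>1 / \<epsilon>\<^sup>n)\<close>.
\<close>

lemma flat_holomorphic_zero:
  assumes hol: "D holomorphic_on S" and S: "open S" "connected S" "0 \<in> S"
    and flat: "\<And>N. \<exists>C. \<forall>\<^sub>F l in nhds 0. norm (D l) \<le> C * norm l ^ N"
    and "a \<in> S"
  shows "D a = 0"
proof (rule holomorphic_fun_eq_0_on_connected[OF hol S(1,2) _ S(3) \<open>a \<in> S\<close>])
  fix n
  obtain C where C: "\<forall>\<^sub>F l in nhds 0. norm (D l) \<le> C * norm l ^ Suc n" using flat by blast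
  obtain d where d: "d > 0" "\<And>l. norm l < d \<Longrightarrow> norm (D l) \<le> C * norm l ^ Suc n"
    using C unfolding eventually_nhds_metric by (auto simp: dist_norm)
  obtain e where e: "e > 0" "cball 0 e \<subseteq> S" using S open_contains_cball by blast
  have bound: "norm ((deriv ^^ n) D 0) \<le> fact n * C * \<epsilon>" if \<epsilon>: "\<epsilon> > 0" "\<epsilon> < min d e" for \<epsilon>
  proof -
    have sub: "cball 0 \<epsilon> \<subseteq> S" using \<epsilon> e by (auto simp: subset_eq)
    have "norm ((deriv ^^ n) D 0) \<le> fact n * (C * \<epsilon> ^ Suc n) / \<epsilon> ^ n"
    proof (rule Cauchy_inequality)
      show "D holomorphic_on ball 0 \<epsilon>" "continuous_on (cball 0 \<epsilon>) D"
        using hol sub by (auto intro: holomorphic_on_subset holomorphic_on_imp_continuous_on simp: subset_eq)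
      show "norm (D l) \<le> C * \<epsilon> ^ Suc n" if "norm (0 - l) = \<epsilon>" for l
        using d(2)[of l] that \<epsilon> by simp
    qed fact
    also have "\<dots> = fact n * C * \<epsilon>" using \<epsilon> by (simp add: field_simps)
    finally show ?thesis .
  qed
  have "((\<lambda>\<epsilon>. fact n * C * \<epsilon>) \<longlongrightarrow> fact n * C * 0) (at_right 0)"
    by (intro tendsto_intros)
  moreover have "\<forall>\<^sub>F \<epsilon> in at_right 0. norm ((deriv ^^ n) D 0) \<le> fact n * C * \<epsilon>"
    unfolding eventually_at_right_field
    by (intro exI[of _ "min d e"]) (use d e bound in auto)
  ultimately have "norm ((deriv ^^ n) D 0) \<le> fact n * C * 0"
    by (rule tendsto_lowerbound) simp
  then show "(deriv ^^ n) D 0 = 0" by simp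
qed

section \<open>The deviation of a character from evaluation is flat\<close>

lemma polybox_hol:
  fixes g :: "complex^('n::finite + 'm::finite) \<Rightarrow> complex"
  assumes "\<And>z. z \<in> polybox R r \<Longrightarrow> complex_differentiable_at g z" "R > \<delta>" "r > 0"
  shows "g \<in> hol (slab (cball 0 \<delta>))"
  unfolding hol_def
proof safe
  fix p :: "complex^('n + 'm)" assume "p \<in> slab (cball 0 \<delta>)"
  then have "p \<in> polybox R r" using assms by (auto simp: slab_def polybox_def)
  then have "\<forall>\<^sub>F z in nhds p. z \<in> polybox R r"
    by (intro eventually_nhds_in_open open_polybox)
  then show "\<forall>\<^sub>F z in nhds p. complex_differentiable_at g z"
    by eventually_elim (rule assms(1))
qed

lemma prod_list_concat_replicate:
  "prod_list (map f (concat (replicate k xs))) = (prod_list (map f xs) :: real) ^ k"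
  by (induction k) simp_all

context free_family
begin

text \<open>
The product of the distances to the points of the special fibre tends to \<open>0\<close>, so one of the factors
is small.
\<close>

lemma char_point_near_X:
  assumes "\<eta> > 0" shows "\<forall>\<^sub>F s in nhds 0. \<forall>y\<in>Ch s. norm (char_point s y) < \<delta> + \<eta>"
proof -
  obtain C where C: "C \<ge> 0" "\<forall>\<^sub>F s in nhds 0. \<forall>y\<in>Ch s. (\<Prod>p\<in>Xi0. l1norm (char_point s y - p)) ^ CARD('m) \<le> C * norm s"
    using proximity by blast
  define E where "E = (\<eta> ^ card Xi0) ^ CARD('m)"
  have E: "E > 0" using assms by (simp add: E_def)
  have "isCont (\<lambda>s. C * norm (s :: complex^'m)) 0" by (intro continuous_intros)
  then have "\<forall>\<^sub>F s in nhds (0 :: complex^'m). C * norm s < E"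
    by (rule eventually_nhds_compose[where P="\<lambda>x. x < E"])
       (use E in \<open>auto intro: eventually_nhds_in_open[of "{..<E}", simplified]\<close>)
  with C(2) show ?thesis
  proof eventually_elim
    case (elim s)
    show ?case
    proof
      fix y assume y: "y \<in> Ch s"
      have "\<exists>p\<in>Xi0. l1norm (char_point s y - p) < \<eta>"
      proof (rule ccontr)
        assume "\<not> ?thesis"
        then have "(\<Prod>p\<in>Xi0. \<eta>) \<le> (\<Prod>p\<in>Xi0. l1norm (char_point s y - p))"
          using assms by (intro prod_mono) auto
        then have "E \<le> (\<Prod>p\<in>Xi0. l1norm (char_point s y - p)) ^ CARD('m)"
          unfolding E_def using assms by (intro power_mono) auto
        with elim y show False by fastforce
      qed
      then obtain p where p: "p \<in> Xi0" "l1norm (char_point s y - p) < \<eta>" by blast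
      have "norm p \<le> \<delta>" using p(1) Xi0_subset by (auto simp: X)
      moreover have "norm (char_point s y) \<le> norm (char_point s y - p) + norm p"
        using norm_triangle_ineq[of "char_point s y - p" p] by simp
      moreover have "norm (char_point s y - p) < \<eta>" using p(2) norm_le_l1norm[of "char_point s y - p"] by simp
      ultimately show "norm (char_point s y) < \<delta> + \<eta>" by simp
    qed
  qed
qed

lemma eventually_norm_less: "e > 0 \<Longrightarrow> \<forall>\<^sub>F s in nhds (0 :: complex^'a). norm s < e"
  using eventually_nhds_in_open[of "ball (0 :: complex^'a) e" 0] by simp

text \<open>
What holds near the slab holds, for \<open>s\<close> near \<open>0\<close>, at the points of all characters simultaneously.
\<close>

lemma eventually_at_char_points:
  assumes "\<And>p. p \<in> K \<Longrightarrow> \<forall>\<^sub>F z in nhds p. Q z"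
  shows "\<forall>\<^sub>F s in nhds 0. \<forall>y\<in>Ch s. Q (join (char_point s y) s)"
proof -
  obtain R r where R: "R > \<delta>" "r > 0" "\<forall>z\<in>polybox R r. Q z"
    using slab_ball_polybox[of \<delta> Q] assms \<delta> unfolding X by blast
  have "\<forall>\<^sub>F s in nhds 0. \<forall>y\<in>Ch s. norm (char_point s y) < \<delta> + (R - \<delta>)"
    using R by (intro char_point_near_X) simp
  then show ?thesis using eventually_norm_less[OF R(2)]
    by eventually_elim (use R in \<open>auto simp: polybox_def\<close>)
qed

lemma eventually_at_points:
  assumes "\<And>p. p \<in> K \<Longrightarrow> \<forall>\<^sub>F z in nhds p. Q z"
  shows "\<forall>\<^sub>F s in nhds 0. \<forall>x\<in>X. Q (join x s)"
proof -
  obtain R r where R: "R > \<delta>" "r > 0" "\<forall>z\<in>polybox R r. Q z"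
    using slab_ball_polybox[of \<delta> Q] assms \<delta> unfolding X by blast
  show ?thesis using eventually_norm_less[OF R(2)]
    by eventually_elim (use R in \<open>auto simp: polybox_def X\<close>)
qed

lemma hol_near_polybox:
  assumes "g \<in> hol K"
  obtains R r B where "R > \<delta>" "r > 0" "\<forall>z\<in>polybox R r. complex_differentiable_at g z" "\<forall>z\<in>polybox R r. norm (g z) < B"
proof -
  have "K = (\<lambda>x. join x 0) ` X"
  proof -
    have "z \<in> (\<lambda>x. join x 0) ` X" if "z \<in> K" for z
      using that join_simps(3)[of z] by (auto simp: slab_def intro!: image_eqI[of _ _ "xs_x z"])
    then show ?thesis by (auto simp: slab_def)
  qed
  moreover have "compact ((\<lambda>x. join x (0 :: complex^'m)) ` X)"
    unfolding X by (rule compact_continuous_image) (auto intro!: continuous_on_join continuous_intros)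
  ultimately have "compact K" by simp
  moreover have "continuous_on K g"
    using hol_isCont[OF assms] by (intro continuous_at_imp_continuous_on) auto
  ultimately have "bounded (g ` K)" by (intro compact_imp_bounded compact_continuous_image)
  then obtain B where B: "\<And>z. z \<in> K \<Longrightarrow> norm (g z) \<le> B" by (auto simp: bounded_iff)
  have "\<forall>\<^sub>F z in nhds p. complex_differentiable_at g z \<and> norm (g z) < B + 1" if "p \<in> K" for p
    using assms that B[OF that]
    by (intro eventually_conj hol_bounded_near) (auto simp: hol_def)
  then obtain R r where "R > \<delta>" "r > 0" "\<forall>z\<in>polybox R r. complex_differentiable_at g z \<and> norm (g z) < B + 1"
    using slab_ball_polybox[of \<delta> "\<lambda>z. complex_differentiable_at g z \<and> norm (g z) < B + 1"] \<delta> unfolding X by blast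
  then show thesis using that[of R r "B + 1"] by blast
qed

lemma hadamard_near:
  assumes g: "g \<in> hol K" and p: "p \<in> X"
  obtains h where "\<forall>j. h j \<in> hol K"
    "\<forall>q\<in>K. \<forall>\<^sub>F z in nhds q. g z = g (join p (xs_s z)) + (\<Sum>j\<in>UNIV. (xs_x z $ j - p $ j) * h j z)"
proof -
  obtain R r B where R: "R > \<delta>" "r > 0" "\<forall>z\<in>polybox R r. complex_differentiable_at g z"
    using hol_near_polybox[OF g] by metis
  have "norm p < R" using p R by (auto simp: X)
  then obtain h where h: "\<And>j z. z \<in> polybox R r \<Longrightarrow> complex_differentiable_at (h j) z"
    "\<And>z. z \<in> polybox R r \<Longrightarrow> g z = g (join p (xs_s z)) + (\<Sum>j\<in>UNIV. (xs_x z $ j - p $ j) * h j z)"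
    using hadamard_division[of R r g p] R(3) by blast
  show thesis
  proof (rule that)
    show "\<forall>j. h j \<in> hol K" using polybox_hol[OF h(1) R(1,2)] by (simp add: X)
    have "\<forall>\<^sub>F z in nhds q. z \<in> polybox R r" if "q \<in> K" for q
      using that R by (intro eventually_nhds_in_open open_polybox) (auto simp: slab_def polybox_def X)
    then show "\<forall>q\<in>K. \<forall>\<^sub>F z in nhds q. g z = g (join p (xs_s z)) + (\<Sum>j\<in>UNIV. (xs_x z $ j - p $ j) * h j z)"
      by (intro ballI, rule eventually_mono) (assumption, rule h(2))
  qed
qed

text \<open>
Apply the character and the evaluation to \<open>g = g(p, s) + \<Sum>\<^sub>j (x\<^sub>j - p\<^sub>j) h\<^sub>j\<close>. They agree on the first
term and on the factors \<open>x\<^sub>j - p\<^sub>j\<close>, so the deviation of \<open>g\<close> is a combination of the deviations of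
the \<open>h\<^sub>j\<close>. The centre \<open>p\<close> is independent of \<open>s\<close>, so finitely many relations between germs are involved.
\<close>

lemma deviation_step:
  assumes g: "g \<in> hol K" and p: "p \<in> X"
  obtains h where "\<forall>j. h j \<in> hol K"
    "\<forall>\<^sub>F s in nhds 0. \<forall>y\<in>Ch s. pairing (coeffs_of g s) y - g (join (char_point s y) s)
       = (\<Sum>j\<in>UNIV. (char_point s y $ j - p $ j) * (pairing (coeffs_of (h j) s) y - h j (join (char_point s y) s)))"
proof -
  obtain h where h: "\<forall>j. h j \<in> hol K"
    "\<forall>q\<in>K. \<forall>\<^sub>F z in nhds q. g z = g (join p (xs_s z)) + (\<Sum>j\<in>UNIV. (xs_x z $ j - p $ j) * h j z)"
    by (rule hadamard_near[OF g p])
  have r1: "represents (\<lambda>z. g (join p (xs_s z)) * 1) (\<lambda>s. g (join p s) *s unit_coeffs s)"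
    by (rule represents_scale[OF hol_at_point[OF g p] represents_un])
  have r2: "represents (\<lambda>z. \<Sum>j\<in>UNIV. (xs_x z $ j - p $ j) * h j z)
     (\<lambda>s. \<Sum>j\<in>UNIV. alg_mult (w_at s) (coeffs_of (\<lambda>z. xs_x z $ j) s - p $ j *s unit_coeffs s) (coeffs_of (h j) s))"
    using h(1) by (intro represents_sum represents_mult represents_affine represents_cf) auto
  have "(\<lambda>z. g z - (g (join p (xs_s z)) * 1 + (\<Sum>j\<in>UNIV. (xs_x z $ j - p $ j) * h j z))) \<in> J"
    by (rule J_near[OF J_zero]) (use h(2) in \<open>auto simp: eq_near_def elim!: eventually_mono\<close>)
  from represents_congruent[OF represents_cf[OF g] represents_add[OF r1 r2] this]
  have "\<forall>\<^sub>F s in nhds 0. coeffs_of g s = g (join p s) *s unit_coeffs s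
     + (\<Sum>j\<in>UNIV. alg_mult (w_at s) (coeffs_of (\<lambda>z. xs_x z $ j) s - p $ j *s unit_coeffs s) (coeffs_of (h j) s))" .
  moreover have "\<forall>\<^sub>F s in nhds 0. \<forall>y\<in>Ch s. g (join (char_point s y) s) = g (join p (xs_s (join (char_point s y) s)))
      + (\<Sum>j\<in>UNIV. (xs_x (join (char_point s y) s) $ j - p $ j) * h j (join (char_point s y) s))"
    by (rule eventually_at_char_points[where Q="\<lambda>z. g z = g (join p (xs_s z)) + (\<Sum>j\<in>UNIV. (xs_x z $ j - p $ j) * h j z)"])
       (use h(2) in blast)
  ultimately have "\<forall>\<^sub>F s in nhds 0. \<forall>y\<in>Ch s. pairing (coeffs_of g s) y - g (join (char_point s y) s)
       = (\<Sum>j\<in>UNIV. (char_point s y $ j - p $ j) * (pairing (coeffs_of (h j) s) y - h j (join (char_point s y) s)))"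
    using pairing_unit_coeffs
  proof eventually_elim
    case (elim s)
    show ?case
    proof
      fix y assume y: "y \<in> Ch s"
      have "pairing (coeffs_of g s) y = g (join p s) + (\<Sum>j\<in>UNIV. (char_point s y $ j - p $ j) * pairing (coeffs_of (h j) s) y)"
        using elim y by (simp add: pairing_linear pairing_sum pairing_amul char_point_def)
      moreover have "g (join (char_point s y) s) = g (join p s) + (\<Sum>j\<in>UNIV. (char_point s y $ j - p $ j) * h j (join (char_point s y) s))"
        using elim(2)[rule_format, OF y] unfolding join_simps .
      ultimately show "pairing (coeffs_of g s) y - g (join (char_point s y) s)
       = (\<Sum>j\<in>UNIV. (char_point s y $ j - p $ j) * (pairing (coeffs_of (h j) s) y - h j (join (char_point s y) s)))"
        by (simp add: right_diff_distrib sum_subtractf)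
    qed
  qed
  with h(1) show thesis by (rule that)
qed

text \<open>
One application of \<open>deviation_step\<close> for each entry of the list. The germs \<open>h\<^sub>j\<close>, and with them the
neighbourhood of \<open>0\<close> and the constant, depend on the list.
\<close>

lemma deviation_bound:
  assumes "g \<in> hol K" "set ps \<subseteq> X"
  shows "\<exists>C\<ge>0. \<forall>\<^sub>F s in nhds 0. \<forall>y\<in>Ch s. norm (pairing (coeffs_of g s) y - g (join (char_point s y) s))
     \<le> C * prod_list (map (\<lambda>p. l1norm (char_point s y - p)) ps)"
  using assms
proof (induction ps arbitrary: g)
  case Nil
  obtain B where B: "\<forall>\<^sub>F s in nhds 0. \<forall>y\<in>Ch s. \<forall>l. norm (y $ l) \<le> B" using chars_bounded by blast
  have "\<exists>C. \<forall>\<^sub>F s in nhds 0. \<forall>l. norm (coeffs_of g s $ l) \<le> C"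
    by (intro common_bound hol_bounded coeffs_of_hol Nil) auto
  then obtain C where C: "\<forall>\<^sub>F s in nhds 0. \<forall>l. norm (coeffs_of g s $ l) \<le> C" by blast
  obtain R r D where R: "R > \<delta>" "r > 0" "\<forall>z\<in>polybox R r. norm (g z) < D"
    using hol_near_polybox[OF Nil(1)] by metis
  have "\<forall>\<^sub>F z in nhds q. norm (g z) < D" if "q \<in> K" for q
  proof -
    have "\<forall>\<^sub>F z in nhds q. z \<in> polybox R r"
      using that R by (intro eventually_nhds_in_open open_polybox) (auto simp: slab_def polybox_def X)
    then show ?thesis by eventually_elim (use R in auto)
  qed
  then have "\<forall>\<^sub>F s in nhds 0. \<forall>y\<in>Ch s. norm (g (join (char_point s y) s)) < D" by (rule eventually_at_char_points)
  with B C have "\<forall>\<^sub>F s in nhds 0. \<forall>y\<in>Ch s. norm (pairing (coeffs_of g s) y - g (join (char_point s y) s)) \<le> \<bar>CARD('m) * (C * B) + D\<bar> * 1"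
  proof eventually_elim
    case (elim s)
    show ?case
    proof
      fix y assume y: "y \<in> Ch s"
      have C0: "0 \<le> C" using elim(2) norm_ge_zero order_trans by blast
      have "norm (pairing (coeffs_of g s) y) \<le> (\<Sum>l\<in>(UNIV :: 'm set). C * B)"
        unfolding pairing_def
        by (rule order_trans[OF norm_sum sum_mono]) (use elim y C0 in \<open>auto simp: norm_mult intro!: mult_mono\<close>)
      then have "norm (pairing (coeffs_of g s) y) \<le> CARD('m) * (C * B)" by simp
      moreover have "norm (g (join (char_point s y) s)) < D" using elim y by blast
      ultimately show "norm (pairing (coeffs_of g s) y - g (join (char_point s y) s)) \<le> \<bar>CARD('m) * (C * B) + D\<bar> * 1"
        using norm_triangle_ineq4[of "pairing (coeffs_of g s) y" "g (join (char_point s y) s)"]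
          abs_ge_self[of "CARD('m) * (C * B) + D"] unfolding mult_1_right by linarith
    qed
  qed
  then show ?case by (intro exI[of _ "\<bar>CARD('m) * (C * B) + D\<bar>"]) simp
next
  case (Cons p ps)
  then have p: "p \<in> X" "set ps \<subseteq> X" by auto
  obtain h where h: "\<forall>j. h j \<in> hol K"
    "\<forall>\<^sub>F s in nhds 0. \<forall>y\<in>Ch s. pairing (coeffs_of g s) y - g (join (char_point s y) s)
       = (\<Sum>j\<in>UNIV. (char_point s y $ j - p $ j) * (pairing (coeffs_of (h j) s) y - h j (join (char_point s y) s)))"
    by (rule deviation_step[OF Cons.prems(1) p(1)])
  have "\<forall>j. \<exists>C\<ge>0. \<forall>\<^sub>F s in nhds 0. \<forall>y\<in>Ch s. norm (pairing (coeffs_of (h j) s) y - h j (join (char_point s y) s))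
     \<le> C * prod_list (map (\<lambda>p. l1norm (char_point s y - p)) ps)"
    using Cons.IH h(1) p(2) by blast
  from choice[OF this] obtain C where C: "\<forall>j. C j \<ge> 0 \<and> (\<forall>\<^sub>F s in nhds 0. \<forall>y\<in>Ch s. norm (pairing (coeffs_of (h j) s) y - h j (join (char_point s y) s))
     \<le> C j * prod_list (map (\<lambda>p. l1norm (char_point s y - p)) ps))" by (rule exE)
  define D where "D = (\<Sum>j\<in>UNIV. C j)"
  have D: "C j \<le> D" for j unfolding D_def using C by (intro member_le_sum) auto
  have "\<forall>\<^sub>F s in nhds 0. \<forall>j. \<forall>y\<in>Ch s. norm (pairing (coeffs_of (h j) s) y - h j (join (char_point s y) s))
     \<le> C j * prod_list (map (\<lambda>p. l1norm (char_point s y - p)) ps)"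
    using C by (intro eventually_all_finite) auto
  with h(2) have "\<forall>\<^sub>F s in nhds 0. \<forall>y\<in>Ch s. norm (pairing (coeffs_of g s) y - g (join (char_point s y) s))
     \<le> D * prod_list (map (\<lambda>p. l1norm (char_point s y - p)) (p # ps))"
  proof eventually_elim
    case (elim s)
    show ?case
    proof
      fix y assume y: "y \<in> Ch s"
      define P where "P = prod_list (map (\<lambda>p. l1norm (char_point s y - p)) ps)"
      have P0: "P \<ge> 0" unfolding P_def by (intro prod_list_nonneg) (auto simp: l1norm_nonneg)
      have "norm (pairing (coeffs_of g s) y - g (join (char_point s y) s))
         = norm (\<Sum>j\<in>UNIV. (char_point s y $ j - p $ j) * (pairing (coeffs_of (h j) s) y - h j (join (char_point s y) s)))"
        using elim(1) y by simp
      also have "\<dots> \<le> (\<Sum>j\<in>UNIV. norm ((char_point s y - p) $ j) * (D * P))"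
      proof (rule order_trans[OF norm_sum sum_mono])
        fix j
        have "norm (pairing (coeffs_of (h j) s) y - h j (join (char_point s y) s)) \<le> C j * P"
          using elim(2) y by (simp add: P_def)
        also have "\<dots> \<le> D * P" by (intro mult_right_mono D P0)
        finally show "norm ((char_point s y $ j - p $ j) * (pairing (coeffs_of (h j) s) y - h j (join (char_point s y) s)))
           \<le> norm ((char_point s y - p) $ j) * (D * P)"
          by (simp add: norm_mult mult_left_mono)
      qed
      also have "\<dots> = D * (l1norm (char_point s y - p) * P)"
        by (simp add: l1norm_def sum_distrib_left sum_distrib_right mult_ac)
      finally show "norm (pairing (coeffs_of g s) y - g (join (char_point s y) s))
         \<le> D * prod_list (map (\<lambda>p. l1norm (char_point s y - p)) (p # ps))" by (simp add: P_def)
    qed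
  qed
  moreover have "D \<ge> 0" unfolding D_def using C by (intro sum_nonneg) auto
  ultimately show ?case by blast
qed

text \<open>
Pass \<open>\<mu> N\<close> times through the special fibre and use \<open>proximity\<close>.
\<close>

lemma deviation_flat:
  assumes "g \<in> hol K"
  shows "\<exists>C\<ge>0. \<forall>\<^sub>F s in nhds 0. \<forall>y\<in>Ch s. norm (pairing (coeffs_of g s) y - g (join (char_point s y) s)) \<le> C * norm s ^ N"
proof -
  obtain ps where ps: "set ps = Xi0" "distinct ps" using Xi0_finite finite_distinct_list by blast
  \<comment> \<open>The \<open>\<mu>\<close>-th power of the product of distances is \<open>O(|s|)\<close>, hence \<open>\<mu> N\<close> rounds for \<open>O(|s|\<^sup>N)\<close>.\<close>
  define qs where "qs = concat (replicate (CARD('m) * N) ps)"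
  have "set qs \<subseteq> X" using Xi0_subset ps by (auto simp: qs_def)
  then obtain C where C: "C \<ge> 0" "\<forall>\<^sub>F s in nhds 0. \<forall>y\<in>Ch s. norm (pairing (coeffs_of g s) y - g (join (char_point s y) s))
     \<le> C * prod_list (map (\<lambda>p. l1norm (char_point s y - p)) qs)" using deviation_bound[OF assms] by blast
  obtain D where D: "D \<ge> 0" "\<forall>\<^sub>F s in nhds 0. \<forall>y\<in>Ch s. (\<Prod>p\<in>Xi0. l1norm (char_point s y - p)) ^ CARD('m) \<le> D * norm s"
    using proximity by blast
  from C(2) D(2) have "\<forall>\<^sub>F s in nhds 0. \<forall>y\<in>Ch s. norm (pairing (coeffs_of g s) y - g (join (char_point s y) s)) \<le> (C * D ^ N) * norm s ^ N"
  proof eventually_elim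
    case (elim s)
    show ?case
    proof
      fix y assume y: "y \<in> Ch s"
      have "prod_list (map (\<lambda>p. l1norm (char_point s y - p)) qs) = ((\<Prod>p\<in>Xi0. l1norm (char_point s y - p)) ^ CARD('m)) ^ N"
        unfolding qs_def prod_list_concat_replicate ps(1)[symmetric] prod.distinct_set_conv_list[OF ps(2)]
        by (rule power_mult)
      also have "\<dots> \<le> (D * norm s) ^ N"
        using elim(2) y by (intro power_mono) (auto intro!: zero_le_power prod_nonneg l1norm_nonneg)
      finally have "C * prod_list (map (\<lambda>p. l1norm (char_point s y - p)) qs) \<le> C * (D * norm s) ^ N"
        using C(1) by (rule mult_left_mono)
      with elim(1) y show "norm (pairing (coeffs_of g s) y - g (join (char_point s y) s)) \<le> (C * D ^ N) * norm s ^ N"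
        by (simp add: power_mult_distrib mult.assoc) (meson order_trans)
    qed
  qed
  then show ?thesis using C(1) D(1) by (intro exI[of _ "C * D ^ N"]) auto
qed

end

section \<open>Characters are evaluations\<close>

context free_family
begin

lemma eventually_cd: "f \<in> hol {0} \<Longrightarrow> \<forall>\<^sub>F s in nhds 0. complex_differentiable_at f s"
  by (simp add: hol_def)

text \<open>
The term of degree \<open>k\<close> is a polynomial in \<open>x\<close>, and \<open>x\<^sub>j\<close> at the point of a character is the value of
that character at \<open>x\<^sub>j\<close>. So in the recursion \<open>ray_coeff_Suc\<close> the factor \<open>x\<^sub>j\<close> can be absorbed into the
algebra element \<open>a\<close>, until for \<open>k = 0\<close> the sum is the trace of a matrix with holomorphic entries.
\<close>

lemma weighted_sum_expansion_term:
  fixes m :: "complex^'m \<Rightarrow> complex^'m \<Rightarrow> nat" and a :: "complex^'m \<Rightarrow> complex^'m"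
  assumes R: "R > \<delta>"
    and m: "\<And>s a. s \<in> ball 0 r \<Longrightarrow> trace (mulmat (w_at s) a) = (\<Sum>y\<in>Ch s. of_nat (m s y) * pairing a y)"
    and xiR: "\<And>s y. s \<in> ball 0 r \<Longrightarrow> y \<in> Ch s \<Longrightarrow> norm (char_point s y) < R"
    and wcd: "\<And>s i j l. s \<in> ball 0 r \<Longrightarrow> complex_differentiable_at (w i j l) s"
    and xcd: "\<And>s j l. s \<in> ball 0 r \<Longrightarrow> complex_differentiable_at (\<lambda>s. coeffs_of (\<lambda>z. xs_x z $ j) s $ l) s"
    and g: "\<And>z. z \<in> polybox R r \<Longrightarrow> complex_differentiable_at g z"
    and a: "\<And>s l. s \<in> ball 0 r \<Longrightarrow> complex_differentiable_at (\<lambda>s. a s $ l) s"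
    and s: "s \<in> ball 0 r"
  shows "complex_differentiable_at (\<lambda>s. \<Sum>y\<in>Ch s. of_nat (m s y) * (pairing (a s) y * ray_coeff k g (join (char_point s y) s))) s"
  using g a s
proof (induction k arbitrary: g a s)
  case (0 g a s)
  have R0: "R > 0" using R \<delta> by simp
  have "complex_differentiable_at (\<lambda>s. g (join 0 s) * (\<Sum>i\<in>UNIV. \<Sum>l\<in>UNIV. a s $ l * w l i i s)) s"
  proof (intro complex_differentiable_mult complex_differentiable_sum)
    show "complex_differentiable_at (\<lambda>s. g (join 0 s)) s"
      by (rule complex_differentiable_compose[OF complex_differentiable_join])
         (use 0 R0 in \<open>auto simp: polybox_def\<close>)
  qed (use 0 wcd in auto)
  then show ?case
  proof (rule complex_differentiable_transform)
    have "\<forall>\<^sub>F s in nhds s. s \<in> ball 0 r" using 0(3) by (intro eventually_nhds_in_open) auto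
    then show "\<forall>\<^sub>F s in nhds s. g (join 0 s) * (\<Sum>i\<in>UNIV. \<Sum>l\<in>UNIV. a s $ l * w l i i s)
        = (\<Sum>y\<in>Ch s. of_nat (m s y) * (pairing (a s) y * ray_coeff 0 g (join (char_point s y) s)))"
    proof eventually_elim
      case (elim s)
      have "(\<Sum>i\<in>UNIV. \<Sum>l\<in>UNIV. a s $ l * w l i i s) = (\<Sum>y\<in>Ch s. of_nat (m s y) * pairing (a s) y)"
        using m[OF elim, of "a s"] by (simp add: trace_def mulmat_def)
      then show ?case by (simp add: ray_coeff_0 sum_distrib_left mult_ac)
    qed
  qed
next
  case (Suc k g a s)
  have R0: "norm (0 :: complex^'n) < R" "R > 0" using R \<delta> by auto
  obtain h where h: "\<And>j z. z \<in> polybox R r \<Longrightarrow> complex_differentiable_at (h j) z"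
    "\<And>z. z \<in> polybox R r \<Longrightarrow> g z = g (join 0 (xs_s z)) + (\<Sum>j\<in>UNIV. (xs_x z $ j - 0 $ j) * h j z)"
    using hadamard_division[of R r g 0, OF Suc.prems(1) R0(1)] by blast
  define a' where "a' j s = alg_mult (w_at s) (a s) (coeffs_of (\<lambda>z. xs_x z $ j) s)" for j s
  have a'cd: "complex_differentiable_at (\<lambda>s. a' j s $ l) s" if "s \<in> ball 0 r" for j l s
    unfolding a'_def alg_mult_def vec_lambda_beta
    by (intro complex_differentiable_sum complex_differentiable_mult wcd xcd Suc.prems(2) that)
  have "complex_differentiable_at (\<lambda>s. \<Sum>j\<in>UNIV. \<Sum>y\<in>Ch s. of_nat (m s y) * (pairing (a' j s) y * ray_coeff k (h j) (join (char_point s y) s))) s"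
    by (intro complex_differentiable_sum Suc.IH h(1) a'cd Suc.prems(3))
  then show ?case
  proof (rule complex_differentiable_transform)
    have "\<forall>\<^sub>F s in nhds s. s \<in> ball 0 r" using Suc.prems(3) by (intro eventually_nhds_in_open) auto
    then show "\<forall>\<^sub>F s in nhds s. (\<Sum>j\<in>UNIV. \<Sum>y\<in>Ch s. of_nat (m s y) * (pairing (a' j s) y * ray_coeff k (h j) (join (char_point s y) s)))
        = (\<Sum>y\<in>Ch s. of_nat (m s y) * (pairing (a s) y * ray_coeff (Suc k) g (join (char_point s y) s)))"
    proof eventually_elim
      case (elim s)
      have "of_nat (m s y) * (pairing (a s) y * ray_coeff (Suc k) g (join (char_point s y) s))
          = (\<Sum>j\<in>UNIV. of_nat (m s y) * (pairing (a' j s) y * ray_coeff k (h j) (join (char_point s y) s)))" if y: "y \<in> Ch s" for y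
      proof -
        have "join (char_point s y) s \<in> polybox R r" using xiR[OF elim y] elim by (simp add: polybox_def)
        then have "ray_coeff (Suc k) g (join (char_point s y) s) = (\<Sum>j\<in>UNIV. xs_x (join (char_point s y) s) $ j * ray_coeff k (h j) (join (char_point s y) s))"
          by (intro ray_coeff_Suc[OF Suc.prems(1) h(1) _ _ R0(2)]) (use h(2) in auto)
        then show ?thesis
          by (simp add: a'_def pairing_amul[OF y] char_point_def sum_distrib_left mult_ac)
      qed
      then have "(\<Sum>y\<in>Ch s. of_nat (m s y) * (pairing (a s) y * ray_coeff (Suc k) g (join (char_point s y) s)))
         = (\<Sum>y\<in>Ch s. \<Sum>j\<in>UNIV. of_nat (m s y) * (pairing (a' j s) y * ray_coeff k (h j) (join (char_point s y) s)))"
        by (rule sum.cong[OF refl])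
      also have "\<dots> = (\<Sum>j\<in>UNIV. \<Sum>y\<in>Ch s. of_nat (m s y) * (pairing (a' j s) y * ray_coeff k (h j) (join (char_point s y) s)))"
        by (rule sum.swap)
      finally show ?case by simp
    qed
  qed
qed

text \<open>
On a ball of parameters fixed for \<open>g\<close> the sums \<open>D b\<close> of the deviations, weighted by multiplicity and
by the value at \<open>\<phi>\<^sub>b\<close>, are holomorphic on every complex line through \<open>0\<close> and flat at \<open>0\<close>, hence
zero. A dual element of the algebra isolates the deviation of a single character.
\<close>

theorem chars_are_evaluations:
  assumes g: "g \<in> hol K"
  shows "\<forall>\<^sub>F s in nhds 0. \<forall>y\<in>Ch s. pairing (coeffs_of g s) y = g (join (char_point s y) s)"
proof -
  obtain R r0 B where R: "R > \<delta>" "r0 > 0" and gR: "\<forall>z\<in>polybox R r0. complex_differentiable_at g z"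
    "\<forall>z\<in>polybox R r0. norm (g z) < B" by (rule hol_near_polybox[OF g])
  \<comment> \<open>A radius strictly between that of the ball and that of the domain of \<open>g\<close>, to leave room for a geometric series.\<close>
  define R2 where "R2 = (\<delta> + R) / 2"
  have R2: "\<delta> < R2" "R2 < R" "0 < R2" using R \<delta> by (auto simp: R2_def)
  obtain Yb where Yb: "\<forall>\<^sub>F s in nhds 0. \<forall>y\<in>Ch s. \<forall>l. norm (y $ l) \<le> Yb" using chars_bounded by blast
  have xiR2: "\<forall>\<^sub>F s in nhds 0. \<forall>y\<in>Ch s. norm (char_point s y) < R2"
    using char_point_near_X[of "R2 - \<delta>"] R2 by simp
  have unit_coeffs_hol: "(\<lambda>s. unit_coeffs s $ l) \<in> hol {0}" for l unfolding unit_coeffs_def by (rule coeffs_of_hol[OF hol_const])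
  define G where "G s \<longleftrightarrow> structure_constants (w_at s) (unit_coeffs s) \<and> (\<forall>y\<in>Ch s. norm (char_point s y) < R2)
      \<and> (\<forall>y\<in>Ch s. \<forall>l. norm (y $ l) \<le> Yb) \<and> (\<forall>i j l. complex_differentiable_at (w i j l) s)
      \<and> (\<forall>j l. complex_differentiable_at (\<lambda>s. coeffs_of (\<lambda>z. xs_x z $ j) s $ l) s)
      \<and> (\<forall>l. complex_differentiable_at (\<lambda>s. coeffs_of g s $ l) s) \<and> norm s < r0" for s
  have "eventually G (nhds 0)"
    unfolding G_def
    by (intro eventually_conj eventually_structure xiR2 Yb eventually_all_finite eventually_cd
        w_hol coeffs_of_hol xs_x_coord_hol g eventually_norm_less R)
  then obtain r where r: "r > 0" and Gr: "\<forall>s. dist s 0 < r \<longrightarrow> G s"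
    unfolding eventually_nhds_metric by (elim exE conjE)
  have good: "structure_constants (w_at s) (unit_coeffs s) \<and> (\<forall>y\<in>Ch s. norm (char_point s y) < R2)
      \<and> (\<forall>y\<in>Ch s. \<forall>l. norm (y $ l) \<le> Yb) \<and> (\<forall>i j l. complex_differentiable_at (w i j l) s)
      \<and> (\<forall>j l. complex_differentiable_at (\<lambda>s. coeffs_of (\<lambda>z. xs_x z $ j) s $ l) s)
      \<and> (\<forall>l. complex_differentiable_at (\<lambda>s. coeffs_of g s $ l) s) \<and> norm s < r0" if "norm s < r" for s
  proof -
    have "G s" using Gr that by simp
    then show ?thesis unfolding G_def .
  qed
  have good_sc: "structure_constants (w_at s) (unit_coeffs s)" if "norm s < r" for s using good[OF that] by (elim conjE)
  have good_xi: "norm (char_point s y) < R2" if "norm s < r" "y \<in> Ch s" for s y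
    using good[OF that(1)] that(2) by (elim conjE) (drule (1) bspec)
  have good_Y: "norm (y $ l) \<le> Yb" if "norm s < r" "y \<in> Ch s" for s l and y :: "complex^'m"
    using good[OF that(1)] that(2) by blast
  have good_w: "complex_differentiable_at (w i j l) s" if "norm s < r" for s i j l
    using good[OF that] by blast
  have good_x: "complex_differentiable_at (\<lambda>s. coeffs_of (\<lambda>z. xs_x z $ j) s $ l) s" if "norm s < r" for s j l
    using good[OF that] by (elim conjE allE)
  have good_g: "complex_differentiable_at (\<lambda>s. coeffs_of g s $ l) s" if "norm s < r" for s l
    using good[OF that] by (elim conjE allE)
  have good_r: "norm s < r0" if "norm s < r" for s :: "complex^'m" using good[OF that] by (elim conjE)
  have gr: "complex_differentiable_at g z" "norm (g z) \<le> B" if "z \<in> polybox R r" for z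
  proof -
    have "z \<in> polybox R r0" using that good_r by (auto simp: polybox_def)
    then show "complex_differentiable_at g z" "norm (g z) \<le> B" using gR by (auto intro: less_imp_le)
  qed
  have "\<forall>s. \<exists>m. norm s < r \<longrightarrow> (\<forall>y\<in>Ch s. m y > (0 :: nat)) \<and>
      (\<forall>a. trace (mulmat (w_at s) a) = (\<Sum>y\<in>Ch s. of_nat (m y) * pairing a y))"
  proof
    fix s
    show "\<exists>m. norm s < r \<longrightarrow> (\<forall>y\<in>Ch s. m y > (0 :: nat)) \<and>
      (\<forall>a. trace (mulmat (w_at s) a) = (\<Sum>y\<in>Ch s. of_nat (m y) * pairing a y))"
    proof (cases "norm s < r")
      case True
      then have alg: "structure_constants (w_at s) (unit_coeffs s)" by (rule good_sc)
      obtain m where "\<forall>y\<in>Ch s. m y > (0 :: nat)"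
        "\<forall>a. trace (mulmat (w_at s) a) = (\<Sum>y\<in>Ch s. of_nat (m y) * pairing a y)"
        by (rule structure_constants.trace_eq_sum_chars[OF alg])
      then show ?thesis by (intro exI[of _ m] impI conjI)
    qed simp
  qed
  from choice[OF this] obtain m where m: "\<forall>s. norm s < r \<longrightarrow> (\<forall>y\<in>Ch s. m s y > (0 :: nat)) \<and>
      (\<forall>a. trace (mulmat (w_at s) a) = (\<Sum>y\<in>Ch s. of_nat (m s y) * pairing a y))" by (rule exE)
  have mtr: "trace (mulmat (w_at s) a) = (\<Sum>y\<in>Ch s. of_nat (m s y) * pairing a y)" if "s \<in> ball 0 r" for s a
    using m that by simp
  have msum: "(\<Sum>y\<in>Ch s. real (m s y)) = CARD('m)" if s: "norm s < r" for s
  proof -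
    have "complex_of_real (\<Sum>y\<in>Ch s. real (m s y)) = (\<Sum>y\<in>Ch s. of_nat (m s y) * pairing (unit_coeffs s) y)"
      unfolding of_real_sum
      by (rule sum.cong) (use structure_constants.pairing_un[OF good_sc[OF s]] in auto)
    also have "\<dots> = trace (mulmat (w_at s) (unit_coeffs s))" using m s by simp
    also have "\<dots> = trace (mat 1 :: complex^'m^'m)"
      by (simp only: structure_constants.mulmat_un[OF good_sc[OF s]])
    also have "\<dots> = of_real (real CARD('m))" by (simp add: trace_def mat_def)
    finally show ?thesis by (simp only: of_real_eq_iff)
  qed
  define D where "D b s = (\<Sum>y\<in>Ch s. of_nat (m s y) * (y $ b * (pairing (coeffs_of g s) y - g (join (char_point s y) s))))" for b s
  have weighted_bound: "norm (\<Sum>y\<in>Ch s. of_nat (m s y) * (y $ b * f y)) \<le> CARD('m) * (\<bar>Yb\<bar> * M)"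
    if s: "norm s < r" and f: "\<And>y. y \<in> Ch s \<Longrightarrow> norm (f y) \<le> M" for s b M and f :: "complex^'m \<Rightarrow> complex"
  proof -
    have "norm (\<Sum>y\<in>Ch s. of_nat (m s y) * (y $ b * f y)) \<le> (\<Sum>y\<in>Ch s. real (m s y) * (\<bar>Yb\<bar> * M))"
    proof (rule order_trans[OF norm_sum sum_mono])
      fix y assume y: "y \<in> Ch s"
      have "norm (y $ b) \<le> \<bar>Yb\<bar>" using good_Y[OF s y, of b] by linarith
      then have "norm (y $ b) * norm (f y) \<le> \<bar>Yb\<bar> * M" using f[OF y] by (intro mult_mono) auto
      then show "norm (of_nat (m s y) * (y $ b * f y)) \<le> real (m s y) * (\<bar>Yb\<bar> * M)"
        by (simp add: norm_mult mult_left_mono)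
    qed
    also have "\<dots> = CARD('m) * (\<bar>Yb\<bar> * M)" unfolding sum_distrib_right[symmetric] msum[OF s] ..
    finally show ?thesis .
  qed
  \<comment> \<open>A factor \<open>\<rho> > 1\<close> by which the points of norm at most \<open>R2\<close> can be stretched inside the domain of \<open>g\<close>.\<close>
  define \<rho> where "\<rho> = (1 + R / R2) / 2"
  have \<rho>: "\<rho> > 1" "\<rho> * R2 < R" "\<rho> > 0" using R2 by (auto simp: \<rho>_def field_simps)
  have D_zero: "D b s0 = 0" if s0: "norm s0 < r" for b s0
  proof -
    \<comment> \<open>Holomorphy in several parameters is used only along the line through \<open>s0\<close>; this also covers \<open>s0 = 0\<close>.\<close>
    define S where "S = {l :: complex. norm l * norm s0 < r}"
    have Sr: "norm (l *s s0) < r" if "l \<in> S" for l using that by (simp add: S_def norm_cscale)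
    have openS: "open S" unfolding S_def by (intro open_Collect_less continuous_intros)
    have convS: "convex S"
    proof (rule convexI)
      fix x y :: complex and u v :: real assume xy: "x \<in> S" "y \<in> S" and uv: "0 \<le> u" "0 \<le> v" "u + v = 1"
      have "norm (u *\<^sub>R x + v *\<^sub>R y) * norm s0 \<le> (u * norm x + v * norm y) * norm s0"
        using uv by (intro mult_right_mono order_trans[OF norm_triangle_ineq]) auto
      also have "\<dots> = u * (norm x * norm s0) + v * (norm y * norm s0)" by (simp add: algebra_simps)
      also have "\<dots> < r" using xy uv by (intro convex_bound_lt) (auto simp: S_def)
      finally show "u *\<^sub>R x + v *\<^sub>R y \<in> S" by (simp add: S_def)
    qed
    have S01: "0 \<in> S" "1 \<in> S" using r s0 by (auto simp: S_def)
    have line: "(\<lambda>l. f (l *s s0)) holomorphic_on S" if "\<And>s. s \<in> ball 0 r \<Longrightarrow> complex_differentiable_at f s"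
      for f :: "complex^'m \<Rightarrow> complex"
      unfolding holomorphic_on_def
    proof
      fix l assume l: "l \<in> S"
      have "(\<lambda>l. f (l *s s0)) field_differentiable at l"
      proof (rule complex_differentiable_along_curve)
        show "(\<lambda>l. (l *s s0) $ i) field_differentiable at l" for i
          by (auto intro!: field_differentiable_mult)
        show "complex_differentiable_at f (l *s s0)" using that Sr[OF l] by simp
      qed
      then show "(\<lambda>l. f (l *s s0)) field_differentiable at l within S"
        by (rule field_differentiable_at_within)
    qed
    define T1 where "T1 s = (\<Sum>y\<in>Ch s. of_nat (m s y) * (y $ b * pairing (coeffs_of g s) y))" for s
    define T2 where "T2 s = (\<Sum>y\<in>Ch s. of_nat (m s y) * (y $ b * g (join (char_point s y) s)))" for s
    define U where "U k s = (\<Sum>y\<in>Ch s. of_nat (m s y) * (y $ b * ray_coeff k g (join (char_point s y) s)))" for k s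
    have DT: "D b s = T1 s - T2 s" for s
      by (simp add: D_def T1_def T2_def sum_subtractf[symmetric] algebra_simps)
    have T1hol: "(\<lambda>l. T1 (l *s s0)) holomorphic_on S"
    proof (rule holomorphic_transform)
      define c where "c s = alg_mult (w_at s) (axis b 1) (coeffs_of g s)" for s
      show "(\<lambda>l. (\<lambda>s. \<Sum>i\<in>UNIV. \<Sum>l\<in>UNIV. c s $ l * w l i i s) (l *s s0)) holomorphic_on S"
      proof (rule line)
        fix s :: "complex^'m" assume "s \<in> ball 0 r"
        then have s: "norm s < r" by simp
        show "complex_differentiable_at (\<lambda>s. \<Sum>i\<in>UNIV. \<Sum>l\<in>UNIV. c s $ l * w l i i s) s"
          unfolding c_def alg_mult_def vec_lambda_beta
          by (intro complex_differentiable_sum complex_differentiable_mult complex_differentiable_const)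
             (rule good_g[OF s] good_w[OF s])+
      qed
      fix l assume "l \<in> S"
      have "(\<Sum>i\<in>UNIV. \<Sum>l\<in>UNIV. c s $ l * w l i i s) = trace (mulmat (w_at s) (c s))" for s
        by (simp add: trace_def mulmat_def)
      also have "trace (mulmat (w_at s) (c s)) = T1 s" if "norm s < r" for s
        using m that by (simp add: T1_def c_def pairing_amul pairing_linear)
      finally show "(\<lambda>s. \<Sum>i\<in>UNIV. \<Sum>l\<in>UNIV. c s $ l * w l i i s) (l *s s0) = T1 (l *s s0)"
        using Sr[OF \<open>l \<in> S\<close>] by simp
    qed
    have Uhol: "(\<lambda>l. U k (l *s s0)) holomorphic_on S" for k
    proof (rule line)
      fix s :: "complex^'m" assume s: "s \<in> ball 0 r"
      have "complex_differentiable_at (\<lambda>s. \<Sum>y\<in>Ch s. of_nat (m s y) * (pairing (axis b 1) y * ray_coeff k g (join (char_point s y) s))) s"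
      proof (rule weighted_sum_expansion_term[OF R(1) mtr])
        show "norm (char_point s y) < R" if "s \<in> ball 0 r" "y \<in> Ch s" for s y
        proof -
          have "norm (char_point s y) < R2" using good_xi[of s y] that by simp
          then show ?thesis using R2 by simp
        qed
        show "complex_differentiable_at (w i j l) s" if "s \<in> ball 0 r" for s i j l
          using good_w[of s] that by simp
        show "complex_differentiable_at (\<lambda>s. coeffs_of (\<lambda>z. xs_x z $ j) s $ l) s" if "s \<in> ball 0 r" for s j l
          using good_x[of s] that by simp
      qed (use gr s complex_differentiable_const in auto)
      then show "complex_differentiable_at (U k) s" by (simp add: U_def[abs_def] pairing_linear)
    qed
    have ray: "\<rho> * norm (char_point s y) < R" if "norm s < r" "y \<in> Ch s" for s y
    proof -
      have "norm (char_point s y) \<le> R2" using good_xi[OF that] by simp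
      then have "\<rho> * norm (char_point s y) \<le> \<rho> * R2" using \<rho>(3) by (intro mult_left_mono) auto
      then show ?thesis using \<rho>(2) by (rule le_less_trans)
    qed
    have Usums: "(\<lambda>k. U k s) sums T2 s" if s: "norm s < r" for s
      unfolding U_def T2_def
    proof (intro sums_sum sums_mult)
      fix y assume y: "y \<in> Ch s"
      show "(\<lambda>k. ray_coeff k g (join (char_point s y) s)) sums g (join (char_point s y) s)"
        by (rule ray_coeff_sums[where R=R and r=r and \<rho>=\<rho>]) (use gr s ray[OF s y] \<rho> in auto)
    qed
    have Ubound: "norm (U k s) \<le> CARD('m) * (\<bar>Yb\<bar> * (B / \<rho> ^ k))" if s: "norm s < r" for k s
      unfolding U_def
    proof (rule weighted_bound[OF s])
      fix y assume y: "y \<in> Ch s"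
      show "norm (ray_coeff k g (join (char_point s y) s)) \<le> B / \<rho> ^ k"
        by (rule ray_coeff_bound[where R=R and r=r]) (use gr s ray[OF s y] \<rho> in auto)
    qed
    have "summable (\<lambda>k. CARD('m) * (\<bar>Yb\<bar> * (B / \<rho> ^ k)))"
    proof -
      have "summable (\<lambda>k. (1 / \<rho>) ^ k)" using \<rho> by (intro summable_geometric) auto
      then have "summable (\<lambda>k. CARD('m) * (\<bar>Yb\<bar> * (B * (1 / \<rho>) ^ k)))" by (intro summable_mult)
      then show ?thesis by (simp add: power_divide)
    qed
    then have ul: "uniform_limit S (\<lambda>n l. \<Sum>k<n. U k (l *s s0)) (\<lambda>l. \<Sum>k. U k (l *s s0)) sequentially"
      by (rule Weierstrass_m_test[rotated]) (use Ubound Sr in auto)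
    have "(\<lambda>l. \<Sum>k. U k (l *s s0)) holomorphic_on S"
    proof (rule holomorphic_uniform_sequence[OF openS])
      show "(\<lambda>l. \<Sum>k<n. U k (l *s s0)) holomorphic_on S" for n by (intro holomorphic_intros Uhol)
      fix x assume "x \<in> S"
      then obtain d where "d > 0" "cball x d \<subseteq> S" using openS open_contains_cball by blast
      then show "\<exists>d>0. cball x d \<subseteq> S \<and> uniform_limit (cball x d) (\<lambda>n l. \<Sum>k<n. U k (l *s s0)) (\<lambda>l. \<Sum>k. U k (l *s s0)) sequentially"
        using uniform_limit_on_subset[OF ul] by blast
    qed
    then have T2hol: "(\<lambda>l. T2 (l *s s0)) holomorphic_on S"
      by (rule holomorphic_transform) (use Usums Sr sums_unique in force)
    have Dhol: "(\<lambda>l. D b (l *s s0)) holomorphic_on S"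
      unfolding DT by (intro holomorphic_intros T1hol T2hol)
    have "D b (1 *s s0) = 0"
    proof (rule flat_holomorphic_zero[OF Dhol openS convex_connected[OF convS] S01(1) _ S01(2)])
      fix N
      obtain C where C: "C \<ge> 0" "\<forall>\<^sub>F s in nhds 0. \<forall>y\<in>Ch s. norm (pairing (coeffs_of g s) y - g (join (char_point s y) s)) \<le> C * norm s ^ N"
        using deviation_flat[OF g] by blast
      from C(2) eventually_norm_less[OF r]
      have ev: "\<forall>\<^sub>F s in nhds 0. norm (D b s) \<le> CARD('m) * (\<bar>Yb\<bar> * (C * norm s ^ N))"
        unfolding D_def by eventually_elim (rule weighted_bound, auto)
      have "isCont (\<lambda>l. l *s s0) (0 :: complex)"
      proof -
        have "continuous_on UNIV (\<lambda>l :: complex. l *s s0)"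
          by (rule continuous_on_vecI) (auto intro!: continuous_intros)
        then show ?thesis by (simp add: continuous_on_eq_continuous_at)
      qed
      then have "\<forall>\<^sub>F l in nhds 0. norm (D b (l *s s0)) \<le> CARD('m) * (\<bar>Yb\<bar> * (C * norm (l *s s0) ^ N))"
        by (rule eventually_nhds_compose) (use ev in simp)
      then have "\<forall>\<^sub>F l in nhds 0. norm (D b (l *s s0)) \<le> (CARD('m) * (\<bar>Yb\<bar> * (C * norm s0 ^ N))) * norm l ^ N"
        by eventually_elim (simp add: norm_cscale power_mult_distrib mult_ac)
      then show "\<exists>C. \<forall>\<^sub>F l in nhds 0. norm (D b (l *s s0)) \<le> C * norm l ^ N" by blast
    qed
    then show ?thesis by simp
  qed
  have "pairing (coeffs_of g s) y0 = g (join (char_point s y0) s)" if s: "norm s < r" and y0: "y0 \<in> Ch s" for s y0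
  proof -
    let ?d = "\<lambda>y. pairing (coeffs_of g s) y - g (join (char_point s y) s)"
    have alg: "structure_constants (w_at s) (unit_coeffs s)" by (rule good_sc[OF s])
    obtain z where z: "pairing z y0 = 1" "\<forall>y'\<in>Ch s - {y0}. pairing z y' = 0"
      using structure_constants.dual_char[OF alg y0] by blast
    have fin: "finite (Ch s)" by (rule structure_constants.finite_chars[OF alg])
    have "0 = (\<Sum>b\<in>UNIV. z $ b * D b s)" by (simp add: D_zero[OF s])
    also have "\<dots> = (\<Sum>b\<in>UNIV. \<Sum>y\<in>Ch s. of_nat (m s y) * (z $ b * y $ b * ?d y))"
      by (simp add: D_def sum_distrib_left mult_ac)
    also have "\<dots> = (\<Sum>y\<in>Ch s. \<Sum>b\<in>UNIV. of_nat (m s y) * (z $ b * y $ b * ?d y))" by (rule sum.swap)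
    also have "\<dots> = (\<Sum>y\<in>Ch s. of_nat (m s y) * (pairing z y * ?d y))"
      by (simp add: pairing_def sum_distrib_left sum_distrib_right)
    also have "\<dots> = (\<Sum>y\<in>{y0}. of_nat (m s y) * (pairing z y * ?d y))"
      by (rule sum.mono_neutral_right) (use fin y0 z in auto)
    also have "\<dots> = of_nat (m s y0) * ?d y0" using z by simp
    finally have "of_nat (m s y0) * ?d y0 = 0" by simp
    moreover have "m s y0 > 0" using m s y0 by blast
    ultimately show ?thesis by simp
  qed
  then have "\<forall>s. norm s < r \<longrightarrow> (\<forall>y\<in>Ch s. pairing (coeffs_of g s) y = g (join (char_point s y) s))" by blast
  with eventually_norm_less[OF r] show ?thesis
    by (auto elim: eventually_mono)
qed

lemma ideal_vanishes_at_char_points: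
  assumes "g \<in> J" shows "\<forall>\<^sub>F s in nhds 0. \<forall>y\<in>Ch s. g (join (char_point s y) s) = 0"
proof -
  have gh: "g \<in> hol K" using J_hol assms by blast
  have "\<forall>\<^sub>F s in nhds 0. coeffs_of g s = 0"
    by (rule represents_congruent[OF represents_cf[OF gh] represents_zero]) (use assms in simp)
  with chars_are_evaluations[OF gh] show ?thesis
    by eventually_elim (auto simp: pairing_linear)
qed

lemma char_eq_phi_at_char_point: "\<forall>\<^sub>F s in nhds 0. \<forall>y\<in>Ch s. \<forall>l. \<phi> l (char_point s y) = y $ l"
proof -
  have "\<forall>\<^sub>F s in nhds 0. \<forall>y\<in>Ch s. \<phi> l (char_point s y) = y $ l" for l
    using chars_are_evaluations[OF phi_hol'[of l]] pairing_coeffs_of[OF represents_phi[of l]]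
    by eventually_elim (auto simp: pairing_linear)
  then have "\<forall>\<^sub>F s in nhds 0. \<forall>l. \<forall>y\<in>Ch s. \<phi> l (char_point s y) = y $ l" by (rule eventually_all_finite)
  then show ?thesis by (rule eventually_mono) blast
qed

end

section \<open>Spectral theorem and inertia of real quadratic forms\<close>

lemma symmetric_matrix_dot:
  fixes A :: "real^'m^'m"
  assumes "transpose A = A" shows "x \<bullet> (A *v y) = (A *v x) \<bullet> y"
  by (metis assms dot_lmul_matrix transpose_matrix_vector)

text \<open>
The choice \<open>t = c / (|d| + 1)\<close> makes the linear term dominate.
\<close>

lemma nonpositive_quadratic_no_linear_term:
  fixes c d :: real
  assumes "\<And>t. 2 * t * c + t\<^sup>2 * d \<le> 0" shows "c = 0"
proof (rule ccontr)
  assume "c \<noteq> 0"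
  \<comment> \<open>With \<open>t = c / e\<close> the sum is a positive multiple of \<open>2 e + d\<close>.\<close>
  define e where "e = \<bar>d\<bar> + 1"
  have e: "e > 0" "d \<ge> - e" by (auto simp: e_def)
  have "2 * (c / e) * c + (c / e)\<^sup>2 * d = (c / e)\<^sup>2 * (2 * e + d)"
    using e by (simp add: power2_eq_square field_simps)
  moreover have "(c / e)\<^sup>2 * (2 * e + d) > 0"
    using e \<open>c \<noteq> 0\<close> by (intro mult_pos_pos) auto
  ultimately show False using assms[of "c / e"] by linarith
qed

text \<open>
The quadratic form attains a maximum on the unit sphere of \<open>V\<close> at some \<open>b\<close>. Its first variation shows
that \<open>A b\<close> is orthogonal to every vector of \<open>V\<close> orthogonal to \<open>b\<close>, in particular to \<open>A b - l b\<close>.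
\<close>

lemma symmetric_eigenvector_in_subspace:
  fixes A :: "real^'m^'m"
  assumes sym: "transpose A = A" and V: "subspace V" "\<And>x. x \<in> V \<Longrightarrow> A *v x \<in> V" "v \<in> V" "v \<noteq> 0"
  obtains b l where "b \<in> V" "norm b = 1" "A *v b = l *\<^sub>R b"
proof -
  define S where "S = V \<inter> sphere 0 1"
  have "compact S" unfolding S_def by (intro closed_Int_compact closed_subspace V) simp
  moreover have "(1 / norm v) *\<^sub>R v \<in> S" using V by (auto simp: S_def intro: subspace_scale)
  moreover have "continuous_on S (\<lambda>x. x \<bullet> (A *v x))"
    by (intro continuous_intros linear_continuous_on matrix_vector_mul_bounded_linear)
  ultimately obtain b where b: "b \<in> S" "\<And>x. x \<in> S \<Longrightarrow> x \<bullet> (A *v x) \<le> b \<bullet> (A *v b)"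
    using continuous_attains_sup[of S "\<lambda>x. x \<bullet> (A *v x)"] by blast
  define l where "l = b \<bullet> (A *v b)"
  have bV: "b \<in> V" "norm b = 1" using b by (auto simp: S_def)
  have bb: "b \<bullet> b = 1" using bV by (simp add: dot_square_norm)
  have max: "x \<bullet> (A *v x) \<le> l * (x \<bullet> x)" if "x \<in> V" for x
  proof (cases "x = 0")
    case False
    then have "(1 / norm x) *\<^sub>R x \<in> S" using that V by (auto simp: S_def intro: subspace_scale)
    from b(2)[OF this] have "(x \<bullet> (A *v x)) / (norm x)\<^sup>2 \<le> l"
      by (simp add: l_def matrix_vector_mult_scaleR power2_eq_square)
    then show ?thesis using False by (simp add: dot_square_norm divide_le_eq)
  qed simp
  have orth: "y \<bullet> (A *v b) = 0" if y: "y \<in> V" "y \<bullet> b = 0" for y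
  proof (rule nonpositive_quadratic_no_linear_term[where d="y \<bullet> (A *v y) - l * (y \<bullet> y)"])
    fix t :: real
    have "b + t *\<^sub>R y \<in> V" using y bV V by (auto intro: subspace_add subspace_scale)
    from max[OF this]
    show "2 * t * (y \<bullet> (A *v b)) + t\<^sup>2 * (y \<bullet> (A *v y) - l * (y \<bullet> y)) \<le> 0"
      using symmetric_matrix_dot[OF sym, of b y] y(2) bb
      by (simp add: matrix_vector_right_distrib matrix_vector_mult_scaleR inner_add_left inner_add_right
          inner_commute power2_eq_square algebra_simps l_def[symmetric])
  qed
  define y where "y = A *v b - l *\<^sub>R b"
  have "y \<in> V" unfolding y_def using bV V by (auto intro!: subspace_diff subspace_scale)
  moreover have yb: "y \<bullet> b = 0" unfolding y_def inner_diff_left inner_scaleR_left bb l_def by (simp add: inner_commute)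
  ultimately have "y \<bullet> (A *v b) = 0" by (rule orth)
  then have "y \<bullet> y = 0" using yb by (simp add: y_def inner_diff_right)
  then have "A *v b = l *\<^sub>R b" by (simp add: y_def)
  with bV that show thesis by blast
qed

theorem spectral_theorem:
  fixes A :: "real^'m^'m"
  assumes sym: "transpose A = A"
  obtains b :: "'m \<Rightarrow> real^'m" and l :: "'m \<Rightarrow> real"
  where "\<forall>i j. b i \<bullet> b j = (if i = j then 1 else 0)" "\<forall>i. A *v b i = l i *\<^sub>R b i"
proof -
  have "n \<le> CARD('m) \<Longrightarrow> \<exists>b l. (\<forall>i<n. \<forall>j<n. b i \<bullet> b j = (if i = j then 1 else 0 :: real)) \<and>
      (\<forall>i<n. A *v b i = l i *\<^sub>R b i)" for n :: nat
  proof (induction n)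
    case (Suc n)
    then obtain b :: "nat \<Rightarrow> real^'m" and l where b: "\<forall>i<n. \<forall>j<n. b i \<bullet> b j = (if i = j then 1 else 0 :: real)"
      "\<forall>i<n. A *v b i = l i *\<^sub>R b i" by auto
    define V where "V = {x. \<forall>i<n. b i \<bullet> x = 0}"
    have "subspace V" unfolding V_def subspace_def by (auto simp: inner_add_right)
    moreover have "A *v x \<in> V" if "x \<in> V" for x
      using that b by (auto simp: V_def symmetric_matrix_dot[OF sym])
    moreover obtain v where "v \<in> V" "v \<noteq> 0"
    proof -
      have "\<exists>\<alpha>. (\<exists>i\<in>(UNIV :: 'm set). \<alpha> i \<noteq> 0) \<and> (\<forall>k\<in>{..<n}. (\<Sum>i\<in>UNIV. \<alpha> i * b k $ i) = 0)"
        by (rule homogeneous_system_nontrivial_solution) (use Suc.prems in auto)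
      then obtain \<alpha> where \<alpha>: "\<exists>i :: 'm. \<alpha> i \<noteq> 0" "\<forall>k<n. (\<Sum>i\<in>UNIV. \<alpha> i * b k $ i) = 0" by auto
      have "(\<chi> i. \<alpha> i) \<in> V" using \<alpha>(2) by (simp add: V_def inner_vec_def mult.commute)
      moreover have "(\<chi> i. \<alpha> i) \<noteq> 0" using \<alpha>(1) by (auto simp: vec_eq_iff)
      ultimately show thesis using that by blast
    qed
    ultimately obtain c k where c: "c \<in> V" "norm c = 1" "A *v c = k *\<^sub>R c"
      using symmetric_eigenvector_in_subspace[OF sym, of V v] by blast
    have cb: "b i \<bullet> c = 0" "c \<bullet> b i = 0" if "i < n" for i
      using c(1) that by (auto simp: V_def inner_commute)
    have cc: "c \<bullet> c = 1" using c(2) by (simp add: dot_square_norm)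
    have "(\<forall>i<Suc n. \<forall>j<Suc n. (b(n := c)) i \<bullet> (b(n := c)) j = (if i = j then 1 else 0 :: real)) \<and>
      (\<forall>i<Suc n. A *v (b(n := c)) i = (l(n := k)) i *\<^sub>R (b(n := c)) i)"
      using b c cb cc by (auto simp: less_Suc_eq)
    then show ?case by blast
  qed auto
  then obtain b :: "nat \<Rightarrow> real^'m" and l where b: "\<forall>i<CARD('m). \<forall>j<CARD('m). b i \<bullet> b j = (if i = j then 1 else 0 :: real)"
      "\<forall>i<CARD('m). A *v b i = l i *\<^sub>R b i" by blast
  obtain h :: "'m \<Rightarrow> nat" where h: "bij_betw h UNIV {..<CARD('m)}"
    using ex_bij_betw_finite_nat[of "UNIV :: 'm set"] by (auto simp: atLeast0LessThan)
  have hl: "h i < CARD('m)" "h i = h j \<longleftrightarrow> i = j" for i j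
    using h by (auto simp: bij_betw_def inj_on_def)
  show thesis
    by (rule that[of "\<lambda>i. b (h i)" "\<lambda>i. l (h i)"]) (use b hl in auto)
qed

lemma characteristic_poly_eigenbasis:
  fixes A :: "real^'m^'m" and b :: "'m \<Rightarrow> real^'m" and l :: "'m \<Rightarrow> real"
  assumes b: "\<forall>i j. b i \<bullet> b j = (if i = j then 1 else 0)" and l: "\<forall>i. A *v b i = l i *\<^sub>R b i"
  shows "characteristic_poly A = (\<Prod>i\<in>UNIV. [:- l i, 1:])"
proof -
  define Q :: "real^'m^'m" where "Q = (\<chi> i j. b j $ i)"
  define c where "c M = (\<chi> i j. [:M $ i $ j:])" for M :: "real^'m^'m"
  have const_sum: "(\<Sum>k\<in>S. [:f k:]) = [:\<Sum>k\<in>S. f k:]" for S :: "'m set" and f :: "'m \<Rightarrow> real"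
    by (induction S rule: infinite_finite_induct) auto
  have c_mult: "c M ** c N = c (M ** N)" for M N
    by (simp add: c_def matrix_matrix_mult_def vec_eq_iff const_sum mult.commute)
  have c_one: "c (mat 1) = mat 1"
    by (simp add: c_def mat_def vec_eq_iff one_pCons if_distrib cong: if_cong)
  have orth: "transpose Q ** Q = mat 1"
    using b by (simp add: Q_def transpose_def matrix_matrix_mult_def vec_eq_iff mat_def inner_vec_def)
  then have orth': "Q ** transpose Q = mat 1" by (simp add: matrix_left_right_inverse)
  define D where "D = (\<chi> i j. if i = j then l j else 0)"
  have AQ: "A ** Q = Q ** D"
  proof -
    have "(A *v b j) $ i = l j * b j $ i" for i j using l by simp
    then show ?thesis
      by (simp add: Q_def D_def matrix_matrix_mult_def matrix_vector_mult_def vec_eq_iff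
          if_distrib[of "(*) _"] mult.commute cong: if_cong)
  qed
  define X :: "real poly^'m^'m" where "X = (\<chi> i j. if i = j then [:0, 1:] else 0)"
  \<comment> \<open>\<open>X\<close> is a scalar matrix.\<close>
  have Xc: "N ** X = X ** N" for N :: "real poly^'m^'m"
    by (simp add: X_def matrix_matrix_mult_def vec_eq_iff if_distrib[of "(*) _"] if_distrib[of "\<lambda>x. x * _"]
        mult.commute cong: if_cong)
  have "c (transpose Q) ** (X - c A) ** c Q = X - c D"
  proof -
    have "c (transpose Q) ** (X - c A) ** c Q = c (transpose Q) ** X ** c Q - c (transpose Q) ** c A ** c Q"
      by (simp add: matrix_matrix_mult_def vec_eq_iff left_diff_distrib right_diff_distrib sum_subtractf)
    also have "c (transpose Q) ** X ** c Q = X"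
    proof -
      have "c (transpose Q) ** X ** c Q = X ** (c (transpose Q) ** c Q)"
        by (metis Xc matrix_mul_assoc)
      then show ?thesis by (simp only: c_mult orth c_one matrix_mul_rid)
    qed
    also have "c (transpose Q) ** c A ** c Q = c D"
    proof -
      have "transpose Q ** A ** Q = D" by (metis AQ matrix_mul_assoc matrix_mul_lid orth)
      then show ?thesis by (simp only: c_mult)
    qed
    finally show ?thesis .
  qed
  then have 1: "det (c (transpose Q)) * det (X - c A) * det (c Q) = det (X - c D)"
    by (simp only: det_mul[symmetric])
  have 2: "det (c (transpose Q)) * det (c Q) = 1"
    by (simp only: det_mul[symmetric] c_mult orth c_one det_I)
  have "det (X - c A) = (det (c (transpose Q)) * det (c Q)) * det (X - c A)" by (simp only: 2 mult_1)
  also have "\<dots> = det (X - c D)" unfolding 1[symmetric] by (simp only: mult_ac)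
  finally have "det (X - c A) = det (X - c D)" .
  moreover have "characteristic_poly A = det (X - c A)"
    unfolding characteristic_poly_def X_def c_def by (rule arg_cong[of _ _ det]) (simp add: vec_eq_iff)
  moreover have "det (X - c D) = (\<Prod>i\<in>UNIV. [:- l i, 1:])"
    by (subst det_diagonal) (auto simp: X_def c_def D_def)
  ultimately show ?thesis by simp
qed

lemma signature_eigenbasis:
  fixes A :: "real^'m^'m" and b :: "'m \<Rightarrow> real^'m" and l :: "'m \<Rightarrow> real"
  assumes "\<forall>i j. b i \<bullet> b j = (if i = j then 1 else 0)" "\<forall>i. A *v b i = l i *\<^sub>R b i"
  shows "signature A = int (card {i. l i > 0}) - int (card {i. l i < 0})"
proof -
  have "proots (characteristic_poly A) = (\<Sum>i\<in>UNIV. {#l i#})"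
    unfolding characteristic_poly_eigenbasis[OF assms] by (subst proots_prod) auto
  also have "\<dots> = image_mset l (mset_set UNIV)"
    by (simp add: sum_unfold_sum_mset)
  finally have p: "proots (characteristic_poly A) = image_mset l (mset_set UNIV)" .
  have "size {#x \<in># image_mset l (mset_set UNIV). P x#} = card {i. P (l i)}" for P
    by (simp add: filter_mset_image_mset filter_mset_mset_set)
  then show ?thesis by (simp add: signature_def p)
qed

lemma quadratic_form_eigenbasis:
  fixes A :: "real^'m^'m" and b :: "'m \<Rightarrow> real^'m" and l :: "'m \<Rightarrow> real"
  assumes b: "\<forall>i j. b i \<bullet> b j = (if i = j then 1 else 0)" and l: "\<forall>i. A *v b i = l i *\<^sub>R b i"
  shows "x \<bullet> (A *v x) = (\<Sum>i\<in>UNIV. l i * (b i \<bullet> x)\<^sup>2)"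
proof -
  define Q :: "real^'m^'m" where "Q = (\<chi> i j. b j $ i)"
  have "transpose Q ** Q = mat 1"
    using b by (simp add: Q_def transpose_def matrix_matrix_mult_def vec_eq_iff mat_def inner_vec_def)
  then have orth': "Q ** transpose Q = mat 1" by (simp add: matrix_left_right_inverse)
  have exp: "x = (\<Sum>i\<in>UNIV. (b i \<bullet> x) *\<^sub>R b i)"
  proof -
    have "x = Q *v (transpose Q *v x)" by (simp only: matrix_vector_mul_assoc orth' matrix_vector_mul_lid)
    also have "\<dots> = (\<Sum>i\<in>UNIV. (b i \<bullet> x) *\<^sub>R b i)"
      by (simp add: vec_eq_iff Q_def transpose_def matrix_vector_mult_def inner_vec_def mult.commute)
    finally show ?thesis .
  qed
  have "A *v x = (\<Sum>i\<in>UNIV. (b i \<bullet> x) *\<^sub>R (l i *\<^sub>R b i))"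
    by (subst exp) (simp add: vec.sum matrix_vector_mult_scaleR l)
  then have "x \<bullet> (A *v x) = (\<Sum>i\<in>UNIV. (b i \<bullet> x) * (l i * (x \<bullet> b i)))"
    by (simp add: inner_sum_right mult.assoc)
  then show ?thesis by (simp add: power2_eq_square inner_commute mult_ac)
qed

text \<open>
If there were more positive eigenvalues than elements of \<open>P\<close>, a nonzero combination of their
eigenvectors would be orthogonal to all \<open>u i\<close>, so that the form would be both positive and nonpositive
on it. The other inequality is obtained in the same way from a combination of dual vectors
orthogonal to the positive eigenvectors.
\<close>

lemma card_positive_eigenvalues:
  fixes A :: "real^'m^'m" and b :: "'m \<Rightarrow> real^'m" and l :: "'m \<Rightarrow> real"
    and u v :: "'i \<Rightarrow> real^'m"
  assumes b: "\<forall>i j. b i \<bullet> b j = (if i = j then 1 else 0)" and l: "\<forall>i. A *v b i = l i *\<^sub>R b i"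
    and fin: "finite P" "finite N"
    and form: "\<And>x. x \<bullet> (A *v x) = (\<Sum>i\<in>P. (u i \<bullet> x)\<^sup>2) - (\<Sum>i\<in>N. (v i \<bullet> x)\<^sup>2)"
    and dual: "\<And>i. i \<in> P \<Longrightarrow> \<exists>x. (\<forall>j\<in>P. u j \<bullet> x = (if j = i then 1 else 0)) \<and> (\<forall>j\<in>N. v j \<bullet> x = 0)"
  shows "card {i. l i > 0} = card P"
proof (rule antisym; rule ccontr)
  assume "\<not> card {i. l i > 0} \<le> card P"
  then obtain \<alpha> where \<alpha>: "\<exists>i\<in>{i. l i > 0}. \<alpha> i \<noteq> 0" "\<forall>k\<in>P. (\<Sum>i | l i > 0. \<alpha> i * (u k \<bullet> b i)) = 0"
    using homogeneous_system_nontrivial_solution[of P "{i. l i > 0}" "\<lambda>k i. u k \<bullet> b i"] fin by (auto simp: not_le)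
  \<comment> \<open>The form is positive on the span of these eigenvectors.\<close>
  define x where "x = (\<Sum>i | l i > 0. \<alpha> i *\<^sub>R b i)"
  have bx: "b j \<bullet> x = (if l j > 0 then \<alpha> j else 0)" for j
    using b by (simp add: x_def inner_sum_right if_distrib[of "(*) _"] cong: if_cong)
  have "(\<Sum>i\<in>P. (u i \<bullet> x)\<^sup>2) = 0"
    using \<alpha>(2) by (intro sum.neutral) (simp add: x_def inner_sum_right)
  then have "x \<bullet> (A *v x) \<le> 0" by (simp add: form sum_nonneg)
  moreover have "x \<bullet> (A *v x) > 0"
  proof -
    obtain i where i: "l i > 0" "\<alpha> i \<noteq> 0" using \<alpha>(1) by auto
    show ?thesis
      unfolding quadratic_form_eigenbasis[OF b l] bx
      by (rule sum_pos2[of _ i]) (use i in auto)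
  qed
  ultimately show False by simp
next
  assume "\<not> card P \<le> card {i. l i > 0}"
  have "\<forall>i. \<exists>x. i \<in> P \<longrightarrow> (\<forall>j\<in>P. u j \<bullet> x = (if j = i then 1 else 0)) \<and> (\<forall>j\<in>N. v j \<bullet> x = 0)"
    using dual by blast
  from choice[OF this] obtain d where d: "\<And>i j. i \<in> P \<Longrightarrow> j \<in> P \<Longrightarrow> u j \<bullet> d i = (if j = i then 1 else 0)"
    "\<And>i j. i \<in> P \<Longrightarrow> j \<in> N \<Longrightarrow> v j \<bullet> d i = 0" by blast
  obtain \<alpha> where \<alpha>: "\<exists>i\<in>P. \<alpha> i \<noteq> 0" "\<forall>k\<in>{i. l i > 0}. (\<Sum>i\<in>P. \<alpha> i * (b k \<bullet> d i)) = 0"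
    using homogeneous_system_nontrivial_solution[of "{i. l i > 0}" P "\<lambda>k i. b k \<bullet> d i"] fin
      \<open>\<not> card P \<le> card {i. l i > 0}\<close> by (auto simp: not_le)
  define x where "x = (\<Sum>i\<in>P. \<alpha> i *\<^sub>R d i)"
  have ux: "u j \<bullet> x = \<alpha> j" if "j \<in> P" for j
    using that fin d(1) by (simp add: x_def inner_sum_right if_distrib[of "(*) _"] cong: if_cong)
  have vx: "v j \<bullet> x = 0" if "j \<in> N" for j
    using that d(2) by (simp add: x_def inner_sum_right)
  have "b k \<bullet> x = 0" if "l k > 0" for k
    using \<alpha>(2) that by (simp add: x_def inner_sum_right)
  then have "l k * (b k \<bullet> x)\<^sup>2 \<le> 0" for k
    by (cases "l k > 0") (auto simp: mult_nonpos_nonneg)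
  then have "x \<bullet> (A *v x) \<le> 0" unfolding quadratic_form_eigenbasis[OF b l] by (simp add: sum_nonpos)
  moreover have "x \<bullet> (A *v x) > 0"
  proof -
    obtain i where i: "i \<in> P" "\<alpha> i \<noteq> 0" using \<alpha>(1) by auto
    have "x \<bullet> (A *v x) = (\<Sum>i\<in>P. (\<alpha> i)\<^sup>2)" by (simp add: form ux vx)
    also have "\<dots> > 0" by (rule sum_pos2[of _ i]) (use i fin in auto)
    finally show ?thesis .
  qed
  ultimately show False by simp
qed

text \<open>
Sylvester's law of inertia for a form written as a difference of sums of squares of linear forms.
The dual vectors express that the linear forms are linearly independent.
\<close>

theorem sylvester_signature:
  fixes A :: "real^'m^'m" and u v :: "'i \<Rightarrow> real^'m"
  assumes sym: "transpose A = A" and fin: "finite P" "finite N"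
    and form: "\<And>x. x \<bullet> (A *v x) = (\<Sum>i\<in>P. (u i \<bullet> x)\<^sup>2) - (\<Sum>i\<in>N. (v i \<bullet> x)\<^sup>2)"
    and dualP: "\<And>i. i \<in> P \<Longrightarrow> \<exists>x. (\<forall>j\<in>P. u j \<bullet> x = (if j = i then 1 else 0)) \<and> (\<forall>j\<in>N. v j \<bullet> x = 0)"
    and dualN: "\<And>i. i \<in> N \<Longrightarrow> \<exists>x. (\<forall>j\<in>N. v j \<bullet> x = (if j = i then 1 else 0)) \<and> (\<forall>j\<in>P. u j \<bullet> x = 0)"
  shows "signature A = int (card P) - int (card N)"
proof -
  obtain b :: "'m \<Rightarrow> real^'m" and l :: "'m \<Rightarrow> real"
    where b: "\<forall>i j. b i \<bullet> b j = (if i = j then 1 else 0)" and l: "\<forall>i. A *v b i = l i *\<^sub>R b i"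
    by (rule spectral_theorem[OF sym])
  have minus: "(- A) *v x = - (A *v x)" for x
    by (simp add: matrix_vector_mult_def vec_eq_iff sum_negf)
  have "card {i. l i > 0} = card P"
    by (rule card_positive_eigenvalues[OF b l fin form dualP])
  moreover have "card {i. - l i > 0} = card N"
  proof (rule card_positive_eigenvalues[OF b, where A="- A" and P=N and N=P and u=v and v=u])
    show "\<forall>i. - A *v b i = - l i *\<^sub>R b i" using l by (simp add: minus)
    show "x \<bullet> (- A *v x) = (\<Sum>i\<in>N. (v i \<bullet> x)\<^sup>2) - (\<Sum>i\<in>P. (u i \<bullet> x)\<^sup>2)" for x
      by (simp add: minus form)
  qed (use fin dualN in auto)
  ultimately show ?thesis by (simp add: signature_eigenbasis[OF b l])
qed

section \<open>Rank, minors and trace forms\<close>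

lemma rank_less_iff_left_kernel:
  fixes A :: "complex^'n^'k"
  shows "rank A < CARD('k) \<longleftrightarrow> (\<exists>y. y \<noteq> 0 \<and> transpose A *v y = 0)"
proof -
  note transpose_matrix_vector [simp del]
  let ?f = "(*v) (transpose A)"
  have lc: "?f y = (\<Sum>i\<in>UNIV. y $ i *s row i A)" for y
    by (simp add: vec_eq_iff matrix_vector_mult_def transpose_def row_def mult.commute)
  have row: "?f (axis i 1) = row i A" for i
    by (simp add: vec_eq_iff row_def transpose_def matrix_vector_mult_def axis_def if_distrib[of "(*) _"]
        del: transpose_matrix_vector cong: if_cong)
  have span: "vec.span (rows A) = range ?f"
  proof
    have "rows A \<subseteq> range ?f" by (auto simp: rows_def row[symmetric])
    moreover have "vec.subspace (range ?f)"
    proof (rule vec.subspaceI)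
      show "0 \<in> range ?f" by (rule range_eqI[of _ _ 0]) (simp only: matrix_vector_mult_0_right)
      show "x + y \<in> range ?f" if "x \<in> range ?f" "y \<in> range ?f" for x y
        using that by (metis (no_types) matrix_vector_right_distrib rangeE rangeI)
      show "c *s x \<in> range ?f" if "x \<in> range ?f" for c x
        using that by (metis (no_types) matrix_vector_scale rangeE rangeI)
    qed
    ultimately show "vec.span (rows A) \<subseteq> range ?f" by (rule vec.span_minimal)
    show "range ?f \<subseteq> vec.span (rows A)"
    proof (rule image_subsetI)
      fix y show "?f y \<in> vec.span (rows A)"
        unfolding lc by (intro vec.span_sum vec.span_scale vec.span_base) (auto simp: rows_def)
    qed
  qed
  have rank: "rank A = vec.dim (range ?f)"
    unfolding row_rank_def_gen by (metis span vec.dim_span)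
  show ?thesis
  proof (cases "inj ?f")
    case True
    then have "vec.dim (range ?f) = vec.dim (UNIV :: (complex^'k) set)"
      by (intro vec.dim_image_eq) (auto simp: inj_on_def)
    then have "rank A = CARD('k)" by (simp only: rank vec_dim_card)
    moreover have "\<not> (\<exists>y. y \<noteq> 0 \<and> ?f y = 0)"
      using True by (metis injD matrix_vector_mult_0_right)
    ultimately show ?thesis by simp
  next
    case False
    then obtain y where y: "y \<noteq> 0" "?f y = 0" using vec.inj_iff_eq_0 by blast
    then obtain i0 where i0: "y $ i0 \<noteq> 0" by (metis vec_eq_iff zero_index)
    define R where "R = (\<lambda>i. row i A) ` (UNIV - {i0})"
    have "row i0 A \<in> vec.span R"
    proof -
      have "0 = y $ i0 *s row i0 A + (\<Sum>i\<in>UNIV - {i0}. y $ i *s row i A)"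
        using y(2) by (simp add: lc sum.remove[of UNIV i0])
      then have "y $ i0 *s row i0 A = - (\<Sum>i\<in>UNIV - {i0}. y $ i *s row i A)"
        by (simp add: eq_neg_iff_add_eq_0)
      moreover have "- (\<Sum>i\<in>UNIV - {i0}. y $ i *s row i A) \<in> vec.span R"
        by (intro vec.span_neg vec.span_sum vec.span_scale vec.span_base) (auto simp: R_def)
      ultimately have "inverse (y $ i0) *s (y $ i0 *s row i0 A) \<in> vec.span R"
        by (metis vec.span_scale)
      then show ?thesis using i0 by (simp add: vector_smult_assoc)
    qed
    then have "rows A \<subseteq> vec.span R"
      unfolding rows_def by (auto simp: R_def intro: vec.span_base)
    then have "rank A \<le> card R"
      unfolding row_rank_def_gen by (rule vec.dim_le_card) (simp add: R_def)
    also have "card R \<le> card (UNIV - {i0})" unfolding R_def by (rule card_image_le) simp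
    also have "\<dots> < CARD('k)" by (rule psubset_card_mono) auto
    finally show ?thesis using y by blast
  qed
qed

text \<open>
If the rows are independent the columns span, and a basis chosen among them gives a nonzero minor. A
dependency between the rows is inherited by all submatrices made of full columns.
\<close>

theorem rank_less_iff_minors_zero:
  fixes A :: "complex^'n^'k"
  shows "rank A < CARD('k) \<longleftrightarrow> (\<forall>\<sigma> :: 'k \<Rightarrow> 'n. inj \<sigma> \<longrightarrow> det (\<chi> i c. A $ i $ \<sigma> c) = 0)"
proof
  assume "rank A < CARD('k)"
  then obtain y where y: "y \<noteq> 0" "transpose A *v y = 0" using rank_less_iff_left_kernel by blast
  show "\<forall>\<sigma> :: 'k \<Rightarrow> 'n. inj \<sigma> \<longrightarrow> det (\<chi> i c. A $ i $ \<sigma> c) = 0"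
  proof (intro allI impI)
    fix \<sigma> :: "'k \<Rightarrow> 'n"
    note transpose_matrix_vector [simp del]
    define M where "M = (\<chi> i c. A $ i $ \<sigma> c)"
    have "(transpose M *v y) $ c = (transpose A *v y) $ \<sigma> c" for c
      by (simp add: M_def transpose_def matrix_vector_mult_def)
    then have "transpose M *v y = 0" using y(2) by (simp add: vec_eq_iff)
    then have "\<not> inj ((*v) (transpose M))" using y(1) by (metis injD matrix_vector_mult_0_right)
    then have "\<not> invertible (transpose M)"
      by (simp add: invertible_left_inverse matrix_left_invertible_injective)
    then show "det (\<chi> i c. A $ i $ \<sigma> c) = 0"
      by (metis M_def det_transpose invertible_det_nz)
  qed
next
  assume minors: "\<forall>\<sigma> :: 'k \<Rightarrow> 'n. inj \<sigma> \<longrightarrow> det (\<chi> i c. A $ i $ \<sigma> c) = 0"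
  show "rank A < CARD('k)"
  proof (rule ccontr)
    assume "\<not> rank A < CARD('k)"
    then have "inj ((*v) (transpose A))"
      using rank_less_iff_left_kernel[of A] vec.inj_iff_eq_0 by blast
    then obtain B where "B ** transpose A = mat 1"
      using matrix_left_invertible_injective by blast
    then have "A ** transpose B = mat 1"
      by (metis matrix_transpose_mul transpose_mat transpose_transpose)
    then have span: "vec.span (columns A) = UNIV" using matrix_right_invertible_span_columns by blast
    obtain C where C: "C \<subseteq> columns A" "vec.independent C" "columns A \<subseteq> vec.span C"
      using vec.maximal_independent_subset[of "columns A"] by blast
    have spanC: "vec.span C = UNIV"
      using C span by (metis top.extremum_uniqueI vec.span_mono vec.span_span)
    have "card C = vec.dim C" using C(2) by (simp add: vec.dim_eq_card_independent)
    also have "\<dots> = vec.dim (UNIV :: (complex^'k) set)" by (metis spanC vec.dim_span)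
    finally have cardC: "card C = CARD('k)" by (simp only: vec_dim_card)
    moreover have finC: "finite C" using C(2) by (rule vec.finiteI_independent)
    ultimately obtain h where h: "bij_betw h (UNIV :: 'k set) C"
      using finite_same_card_bij[of "UNIV :: 'k set" C] by auto
    have "\<forall>c. \<exists>j. h c = column j A"
    proof
      fix c
      have "h c \<in> columns A" using h C(1) by (auto simp: bij_betw_def)
      then show "\<exists>j. h c = column j A" by (auto simp: columns_def)
    qed
    from choice[OF this] obtain \<sigma> where \<sigma>: "\<forall>c. h c = column (\<sigma> c) A" by blast
    have "inj \<sigma>" using h \<sigma> by (metis bij_betw_def injD injI)
    define M where "M = (\<chi> i c. A $ i $ \<sigma> c)"
    have "column c M = h c" for c using \<sigma> by (simp add: M_def column_def)
    then have "columns M = range h" by (auto simp: columns_def)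
    also have "\<dots> = C" using h by (simp add: bij_betw_def)
    finally have "vec.span (columns M) = UNIV" using spanC by simp
    then obtain N where "M ** N = mat 1" using matrix_right_invertible_span_columns by blast
    then have "det M \<noteq> 0" by (metis invertible_right_inverse invertible_det_nz)
    then show False using minors \<open>inj \<sigma>\<close> by (simp add: M_def)
  qed
qed


definition conj_vec :: "complex^'a \<Rightarrow> complex^'a" where "conj_vec x = (\<chi> i. cnj (x $ i))"

lemma conj_vec_simps [simp]: "conj_vec (conj_vec x) = x" "conj_vec x $ i = cnj (x $ i)"
  by (simp_all add: conj_vec_def vec_eq_iff)

lemma conj_vec_fixed: "conj_vec x = x \<longleftrightarrow> real_vec x"
  by (simp add: conj_vec_def vec_eq_iff real_vec_def Reals_cnj_iff)

definition real_pairing :: "real^'m \<Rightarrow> complex^'m \<Rightarrow> complex" where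
  "real_pairing x y = (\<Sum>l\<in>UNIV. of_real (x $ l) * y $ l)"

lemma real_pairing_conj_vec: "real_pairing x (conj_vec y) = cnj (real_pairing x y)"
  by (simp add: real_pairing_def)

lemma real_pairing_Re: "real_pairing (\<chi> l. Re (z $ l)) y = (pairing z y + cnj (pairing z (conj_vec y))) / 2"
proof -
  have "of_real (Re c) = (c + cnj c) / 2" for c by (simp add: complex_add_cnj)
  then show ?thesis
    by (simp add: real_pairing_def pairing_def sum.distrib[symmetric] sum_divide_distrib algebra_simps add_divide_distrib)
qed

lemma real_pairing_scaleR: "real_pairing (r *\<^sub>R x) y = of_real r * real_pairing x y"
  by (simp add: real_pairing_def sum_distrib_left mult.assoc)

text \<open>
Hermite's method. For real \<open>x\<close> the form is \<open>\<Sum>\<^sub>y m\<^sub>y g(y) (y \<bullet> x)\<^sup>2\<close>. The terms of \<open>y\<close> and of its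
conjugate are combined into twice a real part, and with a square root \<open>d\<close> of the coefficient,
\<open>Re (d\<^sup>2 (y \<bullet> x)\<^sup>2) = (Re (d y) \<bullet> x)\<^sup>2 - (Im (d y) \<bullet> x)\<^sup>2\<close>. For real \<open>y\<close> one of the two squares is
zero, according to the sign of \<open>g(y)\<close>; a conjugate pair contributes both, and these cancel in the
signature.
\<close>

lemma trace_form_signature:
  fixes Y :: "(complex^'m) set" and A :: "real^'m^'m" and m :: "complex^'m \<Rightarrow> nat"
  assumes fin: "finite Y" and conj: "\<And>y. y \<in> Y \<Longrightarrow> conj_vec y \<in> Y"
    and dual: "\<And>y. y \<in> Y \<Longrightarrow> \<exists>z. pairing z y = 1 \<and> (\<forall>y'\<in>Y - {y}. pairing z y' = 0)"
    and m: "\<And>y. y \<in> Y \<Longrightarrow> m y > 0" and g: "\<And>y. y \<in> Y \<Longrightarrow> g (conj_vec y) = cnj (g y)"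
    and A: "\<And>i b. complex_of_real (A $ i $ b) = (\<Sum>y\<in>Y. of_nat (m y) * g y * y $ i * y $ b)"
  shows "transpose A = A"
    "signature A = int (card {y \<in> Y. real_vec y \<and> Re (g y) > 0}) - int (card {y \<in> Y. real_vec y \<and> Re (g y) < 0})"
proof -
  have "complex_of_real (A $ i $ b) = complex_of_real (A $ b $ i)" for i b
    by (simp only: A mult_ac)
  then show sym: "transpose A = A" by (simp add: transpose_def vec_eq_iff)
  obtain f :: "complex^'m \<Rightarrow> nat" where f: "inj_on f Y"
    using finite_imp_inj_to_nat_seg[OF fin] by blast
  define R where "R = {y \<in> Y. real_vec y \<and> g y \<noteq> 0}"
  define N where "N = {y \<in> Y. \<not> real_vec y \<and> g y \<noteq> 0}"
  \<comment> \<open>An injective numbering of \<open>Y\<close> selects one member of each pair of conjugates.\<close>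
  define H where "H = {y \<in> N. f y < f (conj_vec y)}"
  define \<kappa> where "\<kappa> y = (if real_vec y then of_nat (m y) * g y else of_nat (m y + m (conj_vec y)) * g y)" for y
  define d where "d y = csqrt (\<kappa> y)" for y
  have RY: "R \<subseteq> Y" "N \<subseteq> Y" "H \<subseteq> N" by (auto simp: R_def N_def H_def)
  have finR: "finite R" "finite N" "finite H" using RY fin by (meson finite_subset)+
  have disj: "R \<inter> H = {}" "R \<inter> N = {}" by (auto simp: R_def H_def N_def)
  have cvne: "conj_vec y \<noteq> y" if "y \<in> N" for y using that conj_vec_fixed by (auto simp: N_def)
  have cvN: "conj_vec y \<in> N" if "y \<in> N" for y
    using that conj g by (auto simp: N_def conj_vec_fixed[symmetric])
  have NH: "N = H \<union> conj_vec ` H" "H \<inter> conj_vec ` H = {}"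
  proof -
    show "N = H \<union> conj_vec ` H"
    proof (intro equalityI subsetI)
      fix y assume y: "y \<in> N"
      then have "f y \<noteq> f (conj_vec y)" using cvne[OF y] cvN[OF y] RY f by (metis inj_onD subsetD)
      then consider "f y < f (conj_vec y)" | "f (conj_vec y) < f y" by linarith
      then show "y \<in> H \<union> conj_vec ` H"
      proof cases
        case 2
        then have "conj_vec y \<in> H" using cvN[OF y] by (simp add: H_def)
        then show ?thesis by (metis UnI2 conj_vec_simps(1) image_eqI)
      qed (use y in \<open>simp add: H_def\<close>)
    qed (use RY cvN in auto)
    show "H \<inter> conj_vec ` H = {}" by (auto simp: H_def)
  qed
  have greal: "g y = of_real (Re (g y))" if "y \<in> R" for y
  proof -
    have "conj_vec y = y" "y \<in> Y" using that by (auto simp: R_def conj_vec_fixed)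
    then have "cnj (g y) = g y" using g by metis
    then show ?thesis by (simp add: complex_eq_iff)
  qed
  have d2: "(d y)\<^sup>2 = \<kappa> y" for y by (simp add: d_def)
  have dne: "d y \<noteq> 0" if "y \<in> R \<union> H" for y
  proof -
    have "y \<in> Y" "g y \<noteq> 0" using that RY by (auto simp: R_def N_def H_def)
    moreover have "of_nat (m y + k) \<noteq> (0 :: complex)" for k
      using m[OF \<open>y \<in> Y\<close>] by (metis add_is_0 less_irrefl of_nat_eq_0_iff)
    ultimately have "\<kappa> y \<noteq> 0" using m[OF \<open>y \<in> Y\<close>] unfolding \<kappa>_def by (simp del: of_nat_add)
    then show ?thesis by (simp add: d_def)
  qed
  have dpos: "d y = of_real (Re (d y))" if "y \<in> R" "Re (g y) > 0" for y
  proof -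
    have "\<kappa> y = of_real (real (m y) * Re (g y))"
      using greal[OF that(1)] that(1) by (simp add: \<kappa>_def R_def)
    then have "d y = of_real (sqrt (real (m y) * Re (g y)))"
      unfolding d_def using that(2) by (simp add: csqrt_of_real_nonneg del: of_real_mult)
    then show ?thesis by simp
  qed
  have dneg: "d y = \<i> * of_real (Im (d y))" if "y \<in> R" "Re (g y) < 0" for y
  proof -
    have "\<kappa> y = of_real (real (m y) * Re (g y))"
      using greal[OF that(1)] that(1) by (simp add: \<kappa>_def R_def)
    moreover have "real (m y) * Re (g y) \<le> 0" using that(2) by (simp add: mult_nonneg_nonpos)
    ultimately have "d y = \<i> * of_real (sqrt \<bar>real (m y) * Re (g y)\<bar>)"
      unfolding d_def by (simp add: csqrt_of_real_nonpos del: of_real_mult)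
    then show ?thesis by simp
  qed
  define u where "u y = (\<chi> l. Re (d y * y $ l))" for y
  define v where "v y = (\<chi> l. Im (d y * y $ l))" for y
  have uv: "u y \<bullet> x = Re (d y * real_pairing x y)" "v y \<bullet> x = Im (d y * real_pairing x y)" for y x
    by (simp_all add: u_def v_def real_pairing_def inner_vec_def sum_distrib_left mult_ac Re_sum Im_sum
        flip: of_real_mult) (simp_all add: algebra_simps)
  define P where "P = {y \<in> R. Re (g y) > 0} \<union> H"
  define Q where "Q = {y \<in> R. Re (g y) < 0} \<union> H"
  have RPQ: "Re (g y) \<noteq> 0" if "y \<in> R" for y
  proof -
    have "g y \<noteq> 0" using that by (simp add: R_def)
    then show ?thesis using greal[OF that] by (metis of_real_0)
  qed
  have realdual: "\<exists>x. real_pairing x y0 = t \<and> (\<forall>y\<in>R \<union> H - {y0}. real_pairing x y = 0)"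
    if y0: "y0 \<in> R \<union> H" and t: "real_vec y0 \<Longrightarrow> t = of_real (Re t)" for y0 t
  proof -
    have "y0 \<in> Y" using y0 RY by auto
    then obtain z where z: "pairing z y0 = 1" "\<forall>y'\<in>Y - {y0}. pairing z y' = 0" using dual by blast
    have zt: "pairing (t *s z) y0 = t" "\<And>y'. y' \<in> Y \<Longrightarrow> y' \<noteq> y0 \<Longrightarrow> pairing (t *s z) y' = 0"
      using z by (simp_all add: pairing_linear)
    define x where "x = (\<chi> l. Re ((t *s z) $ l))"
    have rx: "real_pairing x y = (pairing (t *s z) y + cnj (pairing (t *s z) (conj_vec y))) / 2" for y
      unfolding x_def by (rule real_pairing_Re)
    have other: "real_pairing x y = 0" if y: "y \<in> R \<union> H" "y \<noteq> y0" for y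
    proof -
      have "y \<in> Y" using y RY by auto
      moreover have "conj_vec y \<noteq> y0"
      proof
        assume e: "conj_vec y = y0"
        show False
        proof (cases "y \<in> R")
          case True
          then have "conj_vec y = y" by (simp add: R_def conj_vec_fixed)
          with e y show False by simp
        next
          case False
          then have yH: "y \<in> H" using y by simp
          then have "y0 \<in> N" using e cvN RY by blast
          then have "y0 \<in> H" using y0 disj by auto
          then show False using yH e NH(2) by blast
        qed
      qed
      ultimately show ?thesis using zt y conj by (simp add: rx)
    qed
    show ?thesis
    proof (cases "real_vec y0")
      case True
      then have "conj_vec y0 = y0" by (simp add: conj_vec_fixed)
      then have "real_pairing x y0 = (t + cnj t) / 2" by (simp add: rx zt)
      also have "\<dots> = of_real (Re t)" by (simp add: complex_add_cnj)
      also have "\<dots> = t" using t True by simp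
      finally show ?thesis using other by blast
    next
      case False
      then have "conj_vec y0 \<noteq> y0" by (simp add: conj_vec_fixed)
      then have "real_pairing x y0 = t / 2" using conj[OF \<open>y0 \<in> Y\<close>] by (simp add: rx zt)
      \<comment> \<open>The real part of the dual element halves the value at a point that is not real.\<close>
      then have "real_pairing (2 *\<^sub>R x) y0 = t" by (simp add: real_pairing_scaleR mult.commute)
      moreover have "\<forall>y\<in>R \<union> H - {y0}. real_pairing (2 *\<^sub>R x) y = 0"
        using other by (auto simp: real_pairing_scaleR)
      ultimately show ?thesis by blast
    qed
  qed
  have form: "x \<bullet> (A *v x) = (\<Sum>y\<in>P. (u y \<bullet> x)\<^sup>2) - (\<Sum>y\<in>Q. (v y \<bullet> x)\<^sup>2)" for x
  proof -
    have "complex_of_real (x \<bullet> (A *v x)) = (\<Sum>i\<in>UNIV. \<Sum>b\<in>UNIV. of_real (x $ i) * (of_real (A $ i $ b) * of_real (x $ b)))"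
      by (simp add: inner_vec_def matrix_vector_mult_def sum_distrib_left)
    also have "\<dots> = (\<Sum>i\<in>UNIV. \<Sum>b\<in>UNIV. \<Sum>y\<in>Y. of_nat (m y) * g y * ((of_real (x $ i) * y $ i) * (of_real (x $ b) * y $ b)))"
      by (simp add: A sum_distrib_left sum_distrib_right mult_ac)
    also have "\<dots> = (\<Sum>i\<in>UNIV. \<Sum>y\<in>Y. \<Sum>b\<in>UNIV. of_nat (m y) * g y * ((of_real (x $ i) * y $ i) * (of_real (x $ b) * y $ b)))"
      by (rule sum.cong[OF refl], rule sum.swap)
    also have "\<dots> = (\<Sum>y\<in>Y. \<Sum>i\<in>UNIV. \<Sum>b\<in>UNIV. of_nat (m y) * g y * ((of_real (x $ i) * y $ i) * (of_real (x $ b) * y $ b)))"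
      by (rule sum.swap)
    also have "\<dots> = (\<Sum>y\<in>Y. of_nat (m y) * g y * (real_pairing x y)\<^sup>2)"
      by (simp add: real_pairing_def power2_eq_square sum_product sum_distrib_left mult_ac)
    finally have "complex_of_real (x \<bullet> (A *v x)) = (\<Sum>y\<in>Y. of_nat (m y) * g y * (real_pairing x y)\<^sup>2)" .
    then have "x \<bullet> (A *v x) = Re (\<Sum>y\<in>Y. of_nat (m y) * g y * (real_pairing x y)\<^sup>2)" by (metis Re_complex_of_real)
    also have "\<dots> = (\<Sum>y\<in>Y. Re (of_nat (m y) * g y * (real_pairing x y)\<^sup>2))" by (rule Re_sum)
    also have "\<dots> = (\<Sum>y\<in>R \<union> N. Re (of_nat (m y) * g y * (real_pairing x y)\<^sup>2))"
      by (rule sum.mono_neutral_right[OF fin]) (use RY in \<open>auto simp: R_def N_def\<close>)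
    also have "\<dots> = (\<Sum>y\<in>R. Re (of_nat (m y) * g y * (real_pairing x y)\<^sup>2)) + (\<Sum>y\<in>N. Re (of_nat (m y) * g y * (real_pairing x y)\<^sup>2))"
      by (rule sum.union_disjoint) (use finR disj in auto)
    also have "(\<Sum>y\<in>N. Re (of_nat (m y) * g y * (real_pairing x y)\<^sup>2)) = (\<Sum>y\<in>H. Re (\<kappa> y * (real_pairing x y)\<^sup>2))"
    proof -
      have inj: "inj_on conj_vec H" by (metis conj_vec_simps(1) inj_onI)
      have "(\<Sum>y\<in>N. Re (of_nat (m y) * g y * (real_pairing x y)\<^sup>2))
         = (\<Sum>y\<in>H. Re (of_nat (m y) * g y * (real_pairing x y)\<^sup>2)) + (\<Sum>y\<in>conj_vec ` H. Re (of_nat (m y) * g y * (real_pairing x y)\<^sup>2))"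
        by (subst NH(1), rule sum.union_disjoint) (use finR NH in auto)
      also have "(\<Sum>y\<in>conj_vec ` H. Re (of_nat (m y) * g y * (real_pairing x y)\<^sup>2))
          = (\<Sum>y\<in>H. Re (of_nat (m (conj_vec y)) * g (conj_vec y) * (real_pairing x (conj_vec y))\<^sup>2))"
        by (simp add: sum.reindex[OF inj])
      also have "\<dots> = (\<Sum>y\<in>H. Re (of_nat (m (conj_vec y)) * g y * (real_pairing x y)\<^sup>2))"
      proof (rule sum.cong[OF refl])
        fix y assume "y \<in> H"
        then have "y \<in> Y" using RY by auto
        have "of_nat (m (conj_vec y)) * g (conj_vec y) * (real_pairing x (conj_vec y))\<^sup>2 = cnj (of_nat (m (conj_vec y)) * g y * (real_pairing x y)\<^sup>2)"
          by (simp add: g[OF \<open>y \<in> Y\<close>] real_pairing_conj_vec)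
        then show "Re (of_nat (m (conj_vec y)) * g (conj_vec y) * (real_pairing x (conj_vec y))\<^sup>2) = Re (of_nat (m (conj_vec y)) * g y * (real_pairing x y)\<^sup>2)"
          by (simp only: cnj.simps)
      qed
      also have "(\<Sum>y\<in>H. Re (of_nat (m y) * g y * (real_pairing x y)\<^sup>2)) + \<dots> = (\<Sum>y\<in>H. Re (\<kappa> y * (real_pairing x y)\<^sup>2))"
        unfolding sum.distrib[symmetric]
      proof (rule sum.cong[OF refl])
        fix y assume "y \<in> H"
        then have "\<not> real_vec y" by (simp add: H_def N_def)
        then have "\<kappa> y * (real_pairing x y)\<^sup>2 = of_nat (m y) * g y * (real_pairing x y)\<^sup>2 + of_nat (m (conj_vec y)) * g y * (real_pairing x y)\<^sup>2"
          by (simp add: \<kappa>_def algebra_simps)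
        then show "Re (of_nat (m y) * g y * (real_pairing x y)\<^sup>2) + Re (of_nat (m (conj_vec y)) * g y * (real_pairing x y)\<^sup>2) = Re (\<kappa> y * (real_pairing x y)\<^sup>2)"
          by (metis plus_complex.sel(1))
      qed
      finally show ?thesis .
    qed
    also have "(\<Sum>y\<in>R. Re (of_nat (m y) * g y * (real_pairing x y)\<^sup>2)) = (\<Sum>y\<in>R. Re (\<kappa> y * (real_pairing x y)\<^sup>2))"
      by (rule sum.cong) (auto simp: \<kappa>_def R_def)
    also have "(\<Sum>y\<in>R. Re (\<kappa> y * (real_pairing x y)\<^sup>2)) + (\<Sum>y\<in>H. Re (\<kappa> y * (real_pairing x y)\<^sup>2)) = (\<Sum>y\<in>R \<union> H. Re (\<kappa> y * (real_pairing x y)\<^sup>2))"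
      by (rule sum.union_disjoint[symmetric]) (use finR disj in auto)
    also have "\<dots> = (\<Sum>y\<in>R \<union> H. (u y \<bullet> x)\<^sup>2 - (v y \<bullet> x)\<^sup>2)"
    proof (rule sum.cong[OF refl])
      fix y
      have "\<kappa> y * (real_pairing x y)\<^sup>2 = (d y * real_pairing x y)\<^sup>2" by (simp add: power_mult_distrib d2)
      then show "Re (\<kappa> y * (real_pairing x y)\<^sup>2) = (u y \<bullet> x)\<^sup>2 - (v y \<bullet> x)\<^sup>2"
        by (simp only: uv Re_power2)
    qed
    also have "\<dots> = (\<Sum>y\<in>R \<union> H. (u y \<bullet> x)\<^sup>2) - (\<Sum>y\<in>R \<union> H. (v y \<bullet> x)\<^sup>2)" by (rule sum_subtractf)
    also have "(\<Sum>y\<in>R \<union> H. (u y \<bullet> x)\<^sup>2) = (\<Sum>y\<in>P. (u y \<bullet> x)\<^sup>2)"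
    proof (rule sum.mono_neutral_right)
      show "\<forall>y\<in>R \<union> H - P. (u y \<bullet> x)\<^sup>2 = 0"
      proof
        fix y assume "y \<in> R \<union> H - P"
        then have y: "y \<in> R" "Re (g y) < 0" using RPQ by (auto simp: P_def) (meson linorder_neqE_linordered_idom)
        have "Re (d y) = 0" by (subst dneg[OF y]) simp
        moreover have "real_pairing x y \<in> \<real>" using y(1) by (simp add: R_def real_pairing_def real_vec_def)
        ultimately show "(u y \<bullet> x)\<^sup>2 = 0" by (simp add: uv complex_is_Real_iff)
      qed
    qed (use finR in \<open>auto simp: P_def\<close>)
    also have "(\<Sum>y\<in>R \<union> H. (v y \<bullet> x)\<^sup>2) = (\<Sum>y\<in>Q. (v y \<bullet> x)\<^sup>2)"
    proof (rule sum.mono_neutral_right)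
      show "\<forall>y\<in>R \<union> H - Q. (v y \<bullet> x)\<^sup>2 = 0"
      proof
        fix y assume "y \<in> R \<union> H - Q"
        then have y: "y \<in> R" "Re (g y) > 0" using RPQ by (auto simp: Q_def) (meson linorder_neqE_linordered_idom)
        have "Im (d y) = 0" by (subst dpos[OF y]) simp
        moreover have "real_pairing x y \<in> \<real>" using y(1) by (simp add: R_def real_pairing_def real_vec_def)
        ultimately show "(v y \<bullet> x)\<^sup>2 = 0" by (simp add: uv complex_is_Real_iff)
      qed
    qed (use finR in \<open>auto simp: Q_def\<close>)
    finally show ?thesis .
  qed
  have "signature A = int (card P) - int (card Q)"
  proof (rule sylvester_signature[OF sym _ _ form])
    show "finite P" "finite Q" using finR by (auto simp: P_def Q_def)
    fix y0 assume y0: "y0 \<in> P"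
    then have y0': "y0 \<in> R \<union> H" by (auto simp: P_def)
    have "inverse (d y0) = of_real (Re (inverse (d y0)))" if "real_vec y0"
    proof -
      have "y0 \<in> R" "Re (g y0) > 0" using that y0 by (auto simp: P_def H_def N_def)
      then show ?thesis by (metis Re_complex_of_real dpos of_real_inverse)
    qed
    then obtain x where x: "real_pairing x y0 = inverse (d y0)" "\<forall>y\<in>R \<union> H - {y0}. real_pairing x y = 0"
      using realdual[OF y0'] by blast
    have "d y0 * real_pairing x y0 = 1" using dne[OF y0'] x(1) by simp
    then have "d y * real_pairing x y = (if y = y0 then 1 else 0)" if "y \<in> R \<union> H" for y
      using x(2) that by auto
    then have "(\<forall>j\<in>P. u j \<bullet> x = (if j = y0 then 1 else 0)) \<and> (\<forall>j\<in>Q. v j \<bullet> x = 0)"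
      by (auto simp: uv P_def Q_def simp del: times_complex.sel)
    then show "\<exists>x. (\<forall>j\<in>P. u j \<bullet> x = (if j = y0 then 1 else 0)) \<and> (\<forall>j\<in>Q. v j \<bullet> x = 0)" by blast
  next
    fix y0 assume y0: "y0 \<in> Q"
    then have y0': "y0 \<in> R \<union> H" by (auto simp: Q_def)
    have "\<i> * inverse (d y0) = of_real (Re (\<i> * inverse (d y0)))" if "real_vec y0"
    proof -
      have y: "y0 \<in> R" "Re (g y0) < 0" using that y0 by (auto simp: Q_def H_def N_def)
      have "\<i> * inverse (\<i> * of_real (Im (d y0))) = of_real (inverse (Im (d y0)))" by simp
      then have "\<i> * inverse (d y0) = of_real (inverse (Im (d y0)))" using dneg[OF y] by metis
      then show ?thesis by (metis Re_complex_of_real)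
    qed
    then obtain x where x: "real_pairing x y0 = \<i> * inverse (d y0)" "\<forall>y\<in>R \<union> H - {y0}. real_pairing x y = 0"
      using realdual[OF y0'] by blast
    have "d y0 * real_pairing x y0 = \<i>" using dne[OF y0'] x(1) by simp
    then have "d y * real_pairing x y = (if y = y0 then \<i> else 0)" if "y \<in> R \<union> H" for y
      using x(2) that by auto
    then have "(\<forall>j\<in>Q. v j \<bullet> x = (if j = y0 then 1 else 0)) \<and> (\<forall>j\<in>P. u j \<bullet> x = 0)"
      by (auto simp: uv P_def Q_def simp del: times_complex.sel)
    then show "\<exists>x. (\<forall>j\<in>Q. v j \<bullet> x = (if j = y0 then 1 else 0)) \<and> (\<forall>j\<in>P. u j \<bullet> x = 0)" by blast
  qed
  also have "int (card P) = int (card {y \<in> R. Re (g y) > 0}) + int (card H)"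
    unfolding P_def using finR disj by (subst card_Un_disjoint) auto
  also have "int (card Q) = int (card {y \<in> R. Re (g y) < 0}) + int (card H)"
    unfolding Q_def using finR disj by (subst card_Un_disjoint) auto
  also have "{y \<in> R. Re (g y) > 0} = {y \<in> Y. real_vec y \<and> Re (g y) > 0}" by (auto simp: R_def)
  also have "{y \<in> R. Re (g y) < 0} = {y \<in> Y. real_vec y \<and> Re (g y) < 0}" by (auto simp: R_def)
  finally show "signature A = int (card {y \<in> Y. real_vec y \<and> Re (g y) > 0}) - int (card {y \<in> Y. real_vec y \<and> Re (g y) < 0})"
    by simp
qed

section \<open>Critical points of the deformation\<close>

lemma hol_mono: "f \<in> hol K \<Longrightarrow> K' \<subseteq> K \<Longrightarrow> f \<in> hol K'"
  by (auto simp: hol_def)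

lemma hol_cpartial: "g \<in> hol K \<Longrightarrow> cpartial j g \<in> hol K"
  unfolding hol_def
proof safe
  fix p assume "\<forall>p\<in>K. \<forall>\<^sub>F z in nhds p. complex_differentiable_at g z" "p \<in> K"
  then obtain U where U: "open U" "p \<in> U" "\<forall>z\<in>U. complex_differentiable_at g z"
    by (auto simp: eventually_nhds)
  then have "\<forall>\<^sub>F z in nhds p. z \<in> U" by (intro eventually_nhds_in_open)
  then show "\<forall>\<^sub>F z in nhds p. complex_differentiable_at (cpartial j g) z"
    by eventually_elim (use U complex_differentiable_cpartial[of U g] in blast)
qed

lemma hol_det:
  fixes M :: "complex^'a \<Rightarrow> complex^'k^'k"
  assumes "\<And>i j. (\<lambda>z. M z $ i $ j) \<in> hol K" shows "(\<lambda>z. det (M z)) \<in> hol K"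
  unfolding det_def by (intro hol_sum hol_mult hol_prod hol_const assms)

lemma ideal_near_zero: "(\<lambda>_. 0) \<in> ideal_near K G"
  unfolding ideal_near_def by (auto simp: hol_const eq_near_def intro!: exI[of _ "{}"])

lemma ideal_near_generator: "g \<in> G \<Longrightarrow> g \<in> hol K \<Longrightarrow> g \<in> ideal_near K G"
  unfolding ideal_near_def
  by (auto simp: hol_const eq_near_def intro!: exI[of _ "{g}"] exI[of _ "\<lambda>_ _. 1"])

lemma ideal_near_eq_near:
  assumes "g \<in> ideal_near K G" "eq_near K g h" shows "h \<in> ideal_near K G"
proof -
  obtain A a where A: "finite A" "A \<subseteq> G" "\<forall>g\<in>A. a g \<in> hol K" "eq_near K g (\<lambda>z. \<Sum>g\<in>A. a g z * g z)"
    and g: "g \<in> hol K" using assms(1) by (auto simp: ideal_near_def)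
  have "eq_near K h (\<lambda>z. \<Sum>g\<in>A. a g z * g z)"
    unfolding eq_near_def
  proof
    fix p assume p: "p \<in> K"
    have "\<forall>\<^sub>F z in nhds p. g z = h z" "\<forall>\<^sub>F z in nhds p. g z = (\<Sum>g\<in>A. a g z * g z)"
      using p assms(2) A(4) by (auto simp: eq_near_def)
    then show "\<forall>\<^sub>F z in nhds p. h z = (\<Sum>g\<in>A. a g z * g z)" by eventually_elim simp
  qed
  moreover have "h \<in> hol K" using eq_near_hol[OF g assms(2)] .
  ultimately show ?thesis using A unfolding ideal_near_def by blast
qed

lemma ideal_near_mult:
  assumes "b \<in> hol K" "g \<in> ideal_near K G" shows "(\<lambda>z. b z * g z) \<in> ideal_near K G"
proof -
  obtain A a where A: "finite A" "A \<subseteq> G" "\<forall>g\<in>A. a g \<in> hol K" "eq_near K g (\<lambda>z. \<Sum>g\<in>A. a g z * g z)"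
    and g: "g \<in> hol K" using assms(2) by (auto simp: ideal_near_def)
  have "eq_near K (\<lambda>z. b z * g z) (\<lambda>z. \<Sum>g\<in>A. (b z * a g z) * g z)"
    using A(4) unfolding eq_near_def
    by (auto elim!: eventually_mono simp: sum_distrib_left mult.assoc)
  moreover have "\<forall>g\<in>A. (\<lambda>z. b z * a g z) \<in> hol K" using A(3) assms(1) by (auto intro: hol_mult)
  moreover have "(\<lambda>z. b z * g z) \<in> hol K" by (intro hol_mult assms g)
  ultimately show ?thesis using A(1,2) unfolding ideal_near_def by (auto intro!: exI[of _ A] exI[of _ "\<lambda>g z. b z * a g z"])
qed

lemma ideal_near_add:
  assumes "g \<in> ideal_near K G" "h \<in> ideal_near K G" shows "(\<lambda>z. g z + h z) \<in> ideal_near K G"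
proof -
  obtain A a where A: "finite A" "A \<subseteq> G" "\<forall>g\<in>A. a g \<in> hol K" "eq_near K g (\<lambda>z. \<Sum>g\<in>A. a g z * g z)"
    and g: "g \<in> hol K" using assms(1) by (auto simp: ideal_near_def)
  obtain B b where B: "finite B" "B \<subseteq> G" "\<forall>g\<in>B. b g \<in> hol K" "eq_near K h (\<lambda>z. \<Sum>g\<in>B. b g z * g z)"
    and h: "h \<in> hol K" using assms(2) by (auto simp: ideal_near_def)
  define c where "c k z = (if k \<in> A then a k z else 0) + (if k \<in> B then b k z else 0)" for k z
  have chol: "c k \<in> hol K" for k
    unfolding c_def[abs_def] using A(3) B(3) by (cases "k \<in> A"; cases "k \<in> B") (auto intro: hol_add hol_const)
  have csum: "(\<Sum>k\<in>A \<union> B. c k z * k z) = (\<Sum>k\<in>A. a k z * k z) + (\<Sum>k\<in>B. b k z * k z)" for z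
  proof -
    have "(\<Sum>k\<in>A \<union> B. (if k \<in> A then a k z else 0) * k z) = (\<Sum>k\<in>A. a k z * k z)"
      by (rule sum.mono_neutral_cong_right) (use A B in auto)
    moreover have "(\<Sum>k\<in>A \<union> B. (if k \<in> B then b k z else 0) * k z) = (\<Sum>k\<in>B. b k z * k z)"
      by (rule sum.mono_neutral_cong_right) (use A B in auto)
    ultimately show ?thesis unfolding c_def distrib_right sum.distrib by simp
  qed
  have "eq_near K (\<lambda>z. g z + h z) (\<lambda>z. \<Sum>k\<in>A \<union> B. c k z * k z)"
    unfolding eq_near_def csum
  proof
    fix p assume p: "p \<in> K"
    have "\<forall>\<^sub>F z in nhds p. g z = (\<Sum>g\<in>A. a g z * g z)" "\<forall>\<^sub>F z in nhds p. h z = (\<Sum>g\<in>B. b g z * g z)"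
      using p A(4) B(4) by (auto simp: eq_near_def)
    then show "\<forall>\<^sub>F z in nhds p. g z + h z = (\<Sum>k\<in>A. a k z * k z) + (\<Sum>k\<in>B. b k z * k z)"
      by eventually_elim simp
  qed
  moreover have "(\<lambda>z. g z + h z) \<in> hol K" by (intro hol_add g h)
  ultimately show ?thesis using A(1,2) B(1,2) chol
    unfolding ideal_near_def by (auto intro!: exI[of _ "A \<union> B"] exI[of _ c])
qed

lemma ideal_near_vanish:
  assumes "g \<in> ideal_near K G" "p \<in> K"
  shows "\<forall>\<^sub>F z in nhds p. (\<forall>h\<in>G. h z = 0) \<longrightarrow> g z = 0"
proof -
  obtain A a where A: "A \<subseteq> G" "eq_near K g (\<lambda>z. \<Sum>g\<in>A. a g z * g z)"
    using assms(1) by (auto simp: ideal_near_def)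
  have "\<forall>\<^sub>F z in nhds p. g z = (\<Sum>g\<in>A. a g z * g z)" using A(2) assms(2) by (auto simp: eq_near_def)
  then show ?thesis
  proof eventually_elim
    case (elim z)
    show ?case
    proof
      assume "\<forall>h\<in>G. h z = 0"
      then have "(\<Sum>g\<in>A. a g z * g z) = 0" using A(1) by (intro sum.neutral) auto
      then show "g z = 0" using elim by simp
    qed
  qed
qed

lemma deriv_add_const: "deriv (\<lambda>w. f w + c) z = deriv f z" for f :: "complex \<Rightarrow> complex"
proof -
  have "((\<lambda>w. f w + c) has_field_derivative D) (at z) \<longleftrightarrow> (f has_field_derivative D) (at z)" for D
  proof
    assume "((\<lambda>w. f w + c) has_field_derivative D) (at z)"
    from DERIV_add[OF this DERIV_const[of "- c"]] show "(f has_field_derivative D) (at z)" by simp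
  next
    assume "(f has_field_derivative D) (at z)"
    from DERIV_add[OF this DERIV_const[of c]] show "((\<lambda>w. f w + c) has_field_derivative D) (at z)" by simp
  qed
  then show ?thesis by (simp add: deriv_def)
qed

lemma join_axis: "join x s + axis (Inl j) w = join (x + axis j w) s"
proof -
  have "(join x s + axis (Inl j) w) $ q = join (x + axis j w) s $ q" for q
    by (cases q) (auto simp: axis_def)
  then show ?thesis by (simp add: vec_eq_iff)
qed

lemma max_minors_finite: "finite (max_minors (M :: 'p \<Rightarrow> complex^'n^'k))"
proof -
  have "max_minors M \<subseteq> range (\<lambda>\<sigma> :: 'k \<Rightarrow> 'n. \<lambda>z. det (\<chi> i c. M z $ i $ \<sigma> c))"
    by (auto simp: max_minors_def)
  then show ?thesis by (rule finite_subset) simp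
qed

locale critical_deformation =
  fixes f0 :: "complex^'n \<Rightarrow> complex^'k"
    and e :: "'m::finite \<Rightarrow> complex^'n \<Rightarrow> complex^'k"
    and i1 :: 'k and l0 :: 'm
    and W :: "(complex^'n) set" and \<delta> :: real
    and \<phi> :: "'m \<Rightarrow> complex^'n \<Rightarrow> complex"
    and \<rho> :: "'m \<Rightarrow> 'm \<Rightarrow> complex^'m \<Rightarrow> complex"
    and w :: "'m \<Rightarrow> 'm \<Rightarrow> 'm \<Rightarrow> complex^'m \<Rightarrow> complex"
  assumes delta: "\<delta> > 0" and W: "open W" "cball 0 \<delta> \<subseteq> W"
    and f0_hol: "f0 \<in> holv W" and e_hol: "\<And>l. e l \<in> holv W"
    and e_l0: "\<And>x. x \<in> W \<Longrightarrow> e l0 x = - axis i1 1"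
    and crit_in_X: "\<forall>\<^sub>F s in nhds 0. \<forall>x\<in>W. critical_point i1 (deformation f0 e) s x \<longrightarrow> x \<in> cball 0 \<delta>"
    and phi_hol0: "\<And>l. \<phi> l \<in> hol (cball 0 \<delta>)"
    and basis: "free_basis_Phi_s (cball 0 \<delta>) i1 l0 (deformation f0 e) \<phi>"
    and rho_hol: "\<And>i l. \<rho> i l \<in> hol {0}"
    and rho_rel: "\<And>i. (\<lambda>z. deformation f0 e (xs_x z) (xs_s z) $ i1 * \<phi> i (xs_x z)
               - (\<Sum>l\<in>UNIV. \<rho> i l (xs_s z) * \<phi> l (xs_x z))) \<in> ideal_J (cball 0 \<delta>) i1 l0 (deformation f0 e)"
    and w_hol0: "\<And>i j l. w i j l \<in> hol {0}"
    and w_rel0: "\<And>i j. (\<lambda>z. \<phi> i (xs_x z) * \<phi> j (xs_x z)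
               - (\<Sum>l\<in>UNIV. w i j l (no_u l0 (xs_s z)) * \<phi> l (xs_x z))) \<in> ideal_J (cball 0 \<delta>) i1 l0 (deformation f0 e)"
begin

abbreviation "F \<equiv> deformation f0 e"
abbreviation "X \<equiv> cball (0 :: complex^'n) \<delta>"
abbreviation "KX \<equiv> slab X :: (complex^('n + 'm)) set"

definition F_comp :: "'k \<Rightarrow> complex^('n + 'm) \<Rightarrow> complex" where
  "F_comp i z = F (xs_x z) (xs_s z) $ i"

definition F0_comp :: "'k \<Rightarrow> complex^('n + 'm) \<Rightarrow> complex" where
  "F0_comp i z = F (xs_x z) (no_u l0 (xs_s z)) $ i"

definition jac :: "complex^('n + 'm) \<Rightarrow> complex^'n^'k" where
  "jac z = jacobi_matrix (\<lambda>x. F x (no_u l0 (xs_s z))) (xs_x z)"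

definition gens :: "(complex^('n + 'm) \<Rightarrow> complex) set" where
  "gens = {F_comp i | i. i \<noteq> i1} \<union> max_minors jac"

definition J :: "(complex^('n + 'm) \<Rightarrow> complex) set" where "J = ideal_near KX gens"

definition wN :: "'m \<Rightarrow> 'm \<Rightarrow> 'm \<Rightarrow> complex^'m \<Rightarrow> complex" where
  "wN i j l s = w i j l (no_u l0 s)"

lemma J_eq: "ideal_J X i1 l0 F = J"
  by (simp add: J_def ideal_J_def gens_def F_comp_def[abs_def] jac_def[abs_def])

lemma F_nth: "F x s $ i = f0 x $ i + (\<Sum>l\<in>UNIV. s $ l * e l x $ i)"
  by (simp add: deformation_def)

lemma f0_nth_hol: "(\<lambda>x. f0 x $ i) \<in> hol X" and e_nth_hol: "(\<lambda>x. e l x $ i) \<in> hol X"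
  using f0_hol e_hol W(2) by (auto simp: holv_simps intro: hol_mono)

lemma F_comp_hol: "F_comp i \<in> hol KX"
  unfolding F_comp_def[abs_def] F_nth
  by (intro hol_add hol_sum hol_mult hol_comp_x f0_nth_hol e_nth_hol)
     (auto intro!: hol_everywhere simp: xs_s_def complex_differentiable_coord)

lemma no_u_hol: "(\<lambda>z. no_u l0 (xs_s z) $ l) \<in> hol (K :: (complex^('n + 'm)) set)"
  by (cases "l = l0") (auto simp: no_u_def hol_const xs_s_def intro!: hol_everywhere complex_differentiable_coord)

lemma F0_comp_hol: "F0_comp i \<in> hol KX"
  unfolding F0_comp_def[abs_def] F_nth
  by (intro hol_add hol_sum hol_mult hol_comp_x f0_nth_hol e_nth_hol no_u_hol)

lemma jac_nth: "jac z $ i $ j = cpartial (Inl j) (F0_comp i) z"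
proof -
  have "F0_comp i (z + axis (Inl j) v) = F (xs_x z + axis j v) (no_u l0 (xs_s z)) $ i" for v
  proof -
    have "z + axis (Inl j) v = join (xs_x z + axis j v) (xs_s z)"
      by (metis join_axis join_simps(3))
    then show ?thesis by (simp add: F0_comp_def)
  qed
  then show ?thesis by (simp add: jac_def jacobi_matrix_def partial_def cpartial_def)
qed

lemma gens_hol: "g \<in> gens \<Longrightarrow> g \<in> hol KX"
  unfolding gens_def max_minors_def
  by (auto intro!: hol_det F_comp_hol simp: jac_nth hol_cpartial F0_comp_hol)

lemma gens_finite: "finite gens"
proof -
  have "{F_comp i | i. i \<noteq> i1} \<subseteq> range F_comp" by auto
  then have "finite {F_comp i | i. i \<noteq> i1}" by (rule finite_subset) simp
  then show ?thesis by (simp add: gens_def max_minors_finite)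
qed

lemma wN_hol: "wN i j l \<in> hol {0}"
proof -
  have c: "complex_differentiable_at (\<lambda>s :: complex^'m. no_u l0 s $ l) s" for l s
    by (cases "l = l0") (auto simp: no_u_def complex_differentiable_const complex_differentiable_coord)
  have "isCont (\<lambda>s :: complex^'m. no_u l0 s) 0"
  proof -
    have "continuous_on UNIV (\<lambda>s :: complex^'m. no_u l0 s)"
      by (rule continuous_on_vecI) (simp add: continuous_at_imp_continuous_on complex_differentiable_isCont[OF c])
    then show ?thesis by (simp add: continuous_on_eq_continuous_at)
  qed
  moreover have "no_u l0 (0 :: complex^'m) = 0" by (simp add: no_u_def vec_eq_iff)
  then have "\<forall>\<^sub>F t in nhds (no_u l0 (0 :: complex^'m)). complex_differentiable_at (w i j l) t"
    using w_hol0[of i j l] by (simp add: hol_def)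
  ultimately have "\<forall>\<^sub>F s in nhds 0. complex_differentiable_at (w i j l) (no_u l0 s)"
    by (rule eventually_nhds_compose)
  then have "\<forall>\<^sub>F s in nhds 0. complex_differentiable_at (wN i j l) s"
    unfolding wN_def[abs_def] by eventually_elim (rule complex_differentiable_compose[OF c])
  then show ?thesis by (simp add: hol_def)
qed

sublocale fam: free_family \<delta> X J \<phi> wN
proof
  show "(\<lambda>z. \<phi> i (xs_x z) * \<phi> j (xs_x z) - (\<Sum>l\<in>UNIV. wN i j l (xs_s z) * \<phi> l (xs_x z))) \<in> J" for i j
    using w_rel0 by (simp add: wN_def J_eq)
  show "\<exists>c\<in>holv {0}. (\<lambda>z. h z - (\<Sum>l\<in>UNIV. c (xs_s z) $ l * \<phi> l (xs_x z))) \<in> J" if "h \<in> hol KX" for h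
    using basis that by (auto simp: free_basis_Phi_s_def J_eq)
  show "eq_near {0} c (\<lambda>_. 0)" if "c \<in> holv {0}" "(\<lambda>z. \<Sum>l\<in>UNIV. c (xs_s z) $ l * \<phi> l (xs_x z)) \<in> J" for c
    using basis that by (auto simp: free_basis_Phi_s_def J_eq)
  show "h \<in> J" if "g \<in> J" "eq_near KX g h" for g h
    using that unfolding J_def by (rule ideal_near_eq_near)
  show "(\<lambda>z. g z + h z) \<in> J" if "g \<in> J" "h \<in> J" for g h
    using that unfolding J_def by (rule ideal_near_add)
  show "(\<lambda>z. a z * g z) \<in> J" if "a \<in> hol KX" "g \<in> J" for a g
    using that unfolding J_def by (rule ideal_near_mult)
  show "(\<lambda>_. 0) \<in> J" unfolding J_def by (rule ideal_near_zero)
  show "g \<in> hol KX" if "g \<in> J" for g using that by (simp add: J_def ideal_near_def)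
qed (use delta phi_hol0 wN_hol in auto)

abbreviation "crit s x \<equiv> critical_point i1 F s x"
abbreviation "Ch s \<equiv> fam.Ch s"

definition Phi :: "complex^'n \<Rightarrow> complex^'m" where "Phi x = (\<chi> l. \<phi> l x)"

text \<open>
Only \<open>F\<^sub>1\<close> involves \<open>u\<close>, through the summand \<open>- u\<close>; hence the critical points and the ideal depend on
\<open>t\<close> only.
\<close>

lemma F_shift: "F x s $ i = F x (no_u l0 s) $ i + s $ l0 * e l0 x $ i"
proof -
  have "(\<Sum>l\<in>UNIV. s $ l * e l x $ i) = s $ l0 * e l0 x $ i + (\<Sum>l\<in>UNIV - {l0}. s $ l * e l x $ i)"
    by (rule sum.remove) auto
  also have "(\<Sum>l\<in>UNIV - {l0}. s $ l * e l x $ i) = (\<Sum>l\<in>UNIV. no_u l0 s $ l * e l x $ i)"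
    by (rule sum.mono_neutral_cong_left) (auto simp: no_u_def)
  finally show ?thesis by (simp add: F_nth)
qed

lemma jacobi_no_u:
  assumes "x \<in> W" shows "jacobi_matrix (\<lambda>x. F x s) x = jac (join x s)"
proof -
  have entry: "jacobi_matrix (\<lambda>x. F x s) x $ i $ j = jac (join x s) $ i $ j" for i j
  proof -
    have "isCont (\<lambda>v. x + axis j v) 0"
    proof -
      have "continuous_on UNIV (\<lambda>v. x + axis j v)"
        by (intro continuous_on_add continuous_on_const continuous_on_axis continuous_on_id)
      then show ?thesis by (simp add: continuous_on_eq_continuous_at)
    qed
    then have "\<forall>\<^sub>F v in nhds 0. x + axis j v \<in> W"
      by (rule eventually_nhds_compose) (use W(1) assms in \<open>auto simp: axis_zero intro: eventually_nhds_in_open\<close>)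
    then have "\<forall>\<^sub>F v in nhds 0. F (x + axis j v) s $ i = F (x + axis j v) (no_u l0 s) $ i + s $ l0 * (- axis i1 1 :: complex^'k) $ i"
      by eventually_elim (metis F_shift e_l0)
    then have "deriv (\<lambda>v. F (x + axis j v) s $ i) 0 = deriv (\<lambda>v. F (x + axis j v) (no_u l0 s) $ i + s $ l0 * (- axis i1 1 :: complex^'k) $ i) 0"
      by (rule deriv_cong_ev) simp
    then have "deriv (\<lambda>v. F (x + axis j v) s $ i) 0 = deriv (\<lambda>v. F (x + axis j v) (no_u l0 s) $ i) 0"
      by (simp only: deriv_add_const)
    then show ?thesis unfolding jac_def jacobi_matrix_def partial_def vec_lambda_beta join_simps .
  qed
  show ?thesis by (simp only: vec_eq_iff entry simp_thms)
qed

lemma crit_iff_gens: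
  assumes "x \<in> W" shows "crit s x \<longleftrightarrow> (\<forall>h\<in>gens. h (join x s) = 0)"
proof -
  have "(\<forall>h\<in>max_minors jac. h (join x s) = 0) \<longleftrightarrow> rank (jac (join x s)) < CARD('k)"
  proof -
    have "max_minors jac = (\<lambda>\<sigma> z. det (\<chi> i c. jac z $ i $ \<sigma> c)) ` {\<sigma>. inj \<sigma>}"
      unfolding max_minors_def by (simp only: image_Collect)
    then show ?thesis
      by (simp only: rank_less_iff_minors_zero ball_simps mem_Collect_eq)
  qed
  moreover have "(\<forall>h\<in>{F_comp i |i. i \<noteq> i1}. h (join x s) = 0) \<longleftrightarrow> (\<forall>i. i \<noteq> i1 \<longrightarrow> F x s $ i = 0)"
    by (auto simp: F_comp_def)
  ultimately show ?thesis
    unfolding critical_point_def gens_def jacobi_no_u[OF assms] by blast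
qed

lemma J_vanish:
  assumes "g \<in> J" shows "\<forall>\<^sub>F s in nhds 0. \<forall>x\<in>X. crit s x \<longrightarrow> g (join x s) = 0"
proof -
  have "\<forall>\<^sub>F s in nhds 0. \<forall>x\<in>X. (\<forall>h\<in>gens. h (join x s) = 0) \<longrightarrow> g (join x s) = 0"
  proof (rule fam.eventually_at_points[where Q="\<lambda>z. (\<forall>h\<in>gens. h z = 0) \<longrightarrow> g z = 0"])
    fix p :: "complex^('n + 'm)" assume "p \<in> KX"
    with assms show "\<forall>\<^sub>F z in nhds p. (\<forall>h\<in>gens. h z = 0) \<longrightarrow> g z = 0"
      unfolding J_def by (rule ideal_near_vanish)
  qed
  then show ?thesis
  proof (rule eventually_mono)
    fix s assume v: "\<forall>x\<in>X. (\<forall>h\<in>gens. h (join x s) = 0) \<longrightarrow> g (join x s) = 0"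
    show "\<forall>x\<in>X. crit s x \<longrightarrow> g (join x s) = 0"
    proof (intro ballI impI)
      fix x assume x: "x \<in> X" "crit s x"
      then have "\<forall>h\<in>gens. h (join x s) = 0" using W(2) crit_iff_gens[of x s] by (metis subsetD)
      with v x(1) show "g (join x s) = 0" by (metis (no_types))
    qed
  qed
qed

lemma represents_vanish:
  assumes "fam.represents g c"
  shows "\<forall>\<^sub>F s in nhds 0. \<forall>x\<in>X. crit s x \<longrightarrow> g (join x s) = pairing (c s) (Phi x)"
proof -
  have "(\<lambda>z. g z - (\<Sum>l\<in>UNIV. c (xs_s z) $ l * \<phi> l (xs_x z))) \<in> J" using assms by (simp add: fam.represents_def)
  from J_vanish[OF this] show ?thesis
    by eventually_elim (simp add: pairing_def Phi_def)
qed

text \<open>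
Evaluation at a critical point is a character, and the point is recovered from its values because the
coordinate functions are combinations of the \<open>\<phi> l\<close>.
\<close>

lemma crit_char:
  "\<forall>\<^sub>F s in nhds 0. \<forall>x\<in>X. crit s x \<longrightarrow> Phi x \<in> Ch s \<and> fam.char_point s (Phi x) = x"
proof -
  have 1: "\<forall>\<^sub>F s in nhds 0. \<forall>x\<in>X. crit s x \<longrightarrow> 1 = pairing (fam.unit_coeffs s) (Phi x)"
    by (rule represents_vanish[OF fam.represents_un])
  have 2: "\<forall>\<^sub>F s in nhds 0. \<forall>i j. \<forall>x\<in>X. crit s x \<longrightarrow> \<phi> i x * \<phi> j x = pairing (\<chi> l. wN i j l s) (Phi x)"
    using represents_vanish[OF fam.represents_w] by (intro eventually_all_finite) simp
  have 3: "\<forall>\<^sub>F s in nhds 0. \<forall>j. \<forall>x\<in>X. crit s x \<longrightarrow> x $ j = pairing (fam.coeffs_of (\<lambda>z. xs_x z $ j) s) (Phi x)"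
    using represents_vanish[OF fam.represents_cf[OF xs_x_coord_hol]] by (intro eventually_all_finite) simp
  from 1 2 3 show ?thesis
  proof eventually_elim
    case (elim s)
    show ?case
    proof (intro ballI impI conjI)
      fix x assume x: "x \<in> X" "crit s x"
      have "Phi x \<noteq> 0" using elim(1) x by (auto simp: pairing_def)
      moreover have "Phi x $ i * Phi x $ j = (\<Sum>l\<in>UNIV. wN i j l s * Phi x $ l)" for i j
        using elim(2) x by (simp add: Phi_def pairing_def)
      ultimately show "Phi x \<in> Ch s" by (simp add: algebra_chars_def)
      show "fam.char_point s (Phi x) = x" using elim(3) x by (simp add: fam.char_point_def vec_eq_iff)
    qed
  qed
qed

lemma X_neighbourhood: obtains \<eta> where "\<eta> > 0" "\<forall>x :: complex^'n. norm x < \<delta> + \<eta> \<longrightarrow> x \<in> W"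
proof -
  have "\<forall>\<^sub>F z in nhds p. xs_x z \<in> W" if "p \<in> KX" for p :: "complex^('n + 'm)"
    by (rule eventually_nhds_compose[OF isCont_xs(1)])
       (use that W in \<open>auto simp: slab_def intro!: eventually_nhds_in_open\<close>)
  then obtain R r where R: "R > \<delta>" "r > 0" "\<forall>z\<in>polybox R r :: (complex^('n + 'm)) set. xs_x z \<in> W"
    using slab_ball_polybox[of \<delta> "\<lambda>z :: complex^('n + 'm). xs_x z \<in> W"] delta by blast
  show thesis
  proof (rule that; safe?)
    show "R - \<delta> > 0" using R by simp
    fix x :: "complex^'n" assume "norm x < \<delta> + (R - \<delta>)"
    then have "join x (0 :: complex^'m) \<in> polybox R r" using R by (simp add: polybox_def)
    then show "x \<in> W" using R(3) by (metis join_simps(1))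
  qed
qed

text \<open>
The point of a character lies on the common zero set of the generators and close to the ball. It is
thus a critical point in \<open>W\<close>, and those lie in \<open>X\<close> for \<open>s\<close> near \<open>0\<close>.
\<close>

lemma char_crit:
  "\<forall>\<^sub>F s in nhds 0. \<forall>y\<in>Ch s. fam.char_point s y \<in> X \<and> crit s (fam.char_point s y) \<and> Phi (fam.char_point s y) = y"
proof -
  obtain \<eta> where \<eta>: "\<eta> > 0" "\<forall>x :: complex^'n. norm x < \<delta> + \<eta> \<longrightarrow> x \<in> W" by (rule X_neighbourhood)
  have "\<forall>\<^sub>F s in nhds 0. \<forall>g\<in>gens. \<forall>y\<in>Ch s. g (join (fam.char_point s y) s) = 0"
    by (intro eventually_ball_finite gens_finite ballI fam.ideal_vanishes_at_char_points)
       (auto simp: J_def intro: ideal_near_generator gens_hol)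
  with fam.char_point_near_X[OF \<eta>(1)] fam.char_eq_phi_at_char_point crit_in_X show ?thesis
  proof eventually_elim
    case (elim s)
    show ?case
    proof
      fix y assume y: "y \<in> Ch s"
      have xW: "fam.char_point s y \<in> W" using elim(1) y \<eta>(2) by blast
      then have c: "crit s (fam.char_point s y)" using crit_iff_gens elim(4) y by blast
      moreover have "fam.char_point s y \<in> X" using elim(3) xW c by blast
      moreover have "Phi (fam.char_point s y) = y" using elim(2) y by (simp add: Phi_def vec_eq_iff)
      ultimately show "fam.char_point s y \<in> X \<and> crit s (fam.char_point s y) \<and> Phi (fam.char_point s y) = y" by blast
    qed
  qed
qed

lemma represents_rho: "fam.represents (\<lambda>z. F_comp i1 z * \<phi> i (xs_x z)) (\<lambda>s. \<chi> l. \<rho> i l s)"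
  using rho_rel[of i] unfolding J_eq
  by (simp add: fam.represents_def F_comp_def holv_simps rho_hol hol_mult F_comp_hol[unfolded F_comp_def[abs_def]] fam.phi_hol')

lemma P_eigen:
  "\<forall>\<^sub>F s in nhds 0. \<forall>x\<in>X. crit s x \<longrightarrow> mat_P \<rho> s *v Phi x = F x s $ i1 *s Phi x"
proof -
  have "\<forall>\<^sub>F s in nhds 0. \<forall>i. \<forall>x\<in>X. crit s x \<longrightarrow> F x s $ i1 * \<phi> i x = pairing (\<chi> l. \<rho> i l s) (Phi x)"
    using represents_vanish[OF represents_rho] by (intro eventually_all_finite) (simp add: F_comp_def)
  then show ?thesis
    by eventually_elim (simp add: vec_eq_iff mat_P_def matrix_vector_mult_def pairing_def Phi_def)
qed

text \<open>
Both sides contain the coefficients of the products of \<open>F\<^sub>1 - u\<close> with the basis.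
\<close>

lemma P_mulmat: "\<forall>\<^sub>F s in nhds 0. mat_P \<rho> s = mulmat (\<lambda>i j l. wN i j l s) (fam.coeffs_of (F_comp i1) s)"
proof -
  have "\<forall>\<^sub>F s in nhds 0. (\<chi> l. \<rho> i l s) = alg_mult (\<lambda>i j l. wN i j l s) (fam.coeffs_of (F_comp i1) s) (axis i 1)" for i
    by (rule fam.represents_unique[OF represents_rho fam.represents_mult[OF fam.represents_cf[OF F_comp_hol] fam.represents_phi]])
  then have "\<forall>\<^sub>F s in nhds 0. \<forall>i. (\<chi> l. \<rho> i l s) = alg_mult (\<lambda>i j l. wN i j l s) (fam.coeffs_of (F_comp i1) s) (axis i 1)"
    by (rule eventually_all_finite)
  then show ?thesis
  proof eventually_elim
    case (elim s)
    have "\<rho> i b s = (\<Sum>l\<in>UNIV. fam.coeffs_of (F_comp i1) s $ l * wN l i b s)" for i b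
    proof -
      have "(\<chi> l. \<rho> i l s) $ b = alg_mult (\<lambda>i j l. wN i j l s) (fam.coeffs_of (F_comp i1) s) (axis i 1) $ b"
        using elim by simp
      then show ?thesis by (simp add: alg_mult_axis)
    qed
    then show ?case by (simp add: vec_eq_iff mat_P_def mulmat_def)
  qed
qed

theorem discriminant_eq_det_zero: "\<forall>\<^sub>F s in nhds 0. s \<in> discriminant X F \<longleftrightarrow> det (mat_P \<rho> s) = 0"
  using crit_char char_crit P_eigen P_mulmat fam.eventually_structure
proof eventually_elim
  case (elim s)
  show ?case
  proof
    assume "s \<in> discriminant X F"
    then obtain x where x: "x \<in> X" "F x s = 0" "rank (jacobi_matrix (\<lambda>x. F x s) x) < CARD('k)"
      by (auto simp: discriminant_def Cr_def)
    then have c: "crit s x" by (simp add: critical_point_def)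
    have "mat_P \<rho> s *v Phi x = 0" using elim(3) x c by simp
    moreover have "Phi x \<noteq> 0" using elim(1) x c by (auto simp: algebra_chars_def)
    ultimately have "\<not> inj ((*v) (mat_P \<rho> s))" by (metis injD matrix_vector_mult_0_right)
    then show "det (mat_P \<rho> s) = 0"
      by (metis invertible_det_nz invertible_left_inverse matrix_left_invertible_injective)
  next
    assume "det (mat_P \<rho> s) = 0"
    then obtain y where y: "y \<in> Ch s" "pairing (fam.coeffs_of (F_comp i1) s) y = 0"
      using structure_constants.singular_mulmat_char[OF elim(5)] elim(4) by metis
    let ?x = "fam.char_point s y"
    have x: "?x \<in> X" "crit s ?x" "Phi ?x = y" using elim(2) y by auto
    have "F ?x s $ i1 *s y = mat_P \<rho> s *v y" using elim(3) x by metis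
    also have "\<dots> = 0" using elim(4) mulmat_char[OF y(1)] y(2) by simp
    finally have "F ?x s $ i1 = 0" using y(1) by (auto simp: algebra_chars_def vector_mul_eq_0)
    then have "F ?x s = 0" using x(2) by (metis critical_point_def vec_eq_iff zero_index)
    then show "s \<in> discriminant X F"
      using x by (force simp: discriminant_def Cr_def critical_point_def)
  qed
qed

text \<open>
The number \<open>zeta w c\<close> is the trace of multiplication by \<open>\<phi>\<^sub>c\<close>, so by the trace formula \<open>T\<close> is the sum
of the matrices \<open>m\<^sub>y y y\<^sup>T\<close>; and each \<open>y\<close> is an eigenvector of \<open>P\<close>.
\<close>

lemma PT_entries:
  "\<forall>\<^sub>F s in nhds 0. \<exists>m. (\<forall>y\<in>Ch s. m y > (0 :: nat)) \<and> (\<forall>i b. (mat_P \<rho> s ** mat_T w (no_u l0 s)) $ i $ b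
      = (\<Sum>y\<in>Ch s. of_nat (m y) * F (fam.char_point s y) s $ i1 * y $ i * y $ b))"
  using char_crit P_eigen fam.eventually_structure
proof eventually_elim
  case (elim s)
  obtain m where m: "\<forall>y\<in>Ch s. m y > (0 :: nat)"
    "\<forall>a. trace (mulmat (\<lambda>i j l. wN i j l s) a) = (\<Sum>y\<in>Ch s. of_nat (m y) * pairing a y)"
    by (rule structure_constants.trace_eq_sum_chars[OF elim(3)])
  have zeta: "zeta w c (no_u l0 s) = (\<Sum>y\<in>Ch s. of_nat (m y) * y $ c)" for c
  proof -
    have "zeta w c (no_u l0 s) = trace (mulmat (\<lambda>i j l. wN i j l s) (axis c 1))"
      by (simp add: zeta_def trace_def mulmat_def wN_def axis_def if_distrib[of "\<lambda>x. x * _"] cong: if_cong)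
    then show ?thesis using m(2) by (simp add: pairing_linear)
  qed
  have T: "mat_T w (no_u l0 s) $ l $ b = (\<Sum>y\<in>Ch s. of_nat (m y) * y $ l * y $ b)" for l b
  proof -
    have "mat_T w (no_u l0 s) $ l $ b = (\<Sum>c\<in>UNIV. (\<Sum>y\<in>Ch s. of_nat (m y) * y $ c) * wN l b c s)"
      by (simp add: mat_T_def map_matrix_def mat_W_def zeta wN_def)
    also have "\<dots> = (\<Sum>c\<in>UNIV. \<Sum>y\<in>Ch s. of_nat (m y) * (wN l b c s * y $ c))"
      by (simp add: sum_distrib_right sum_distrib_left mult_ac)
    also have "\<dots> = (\<Sum>y\<in>Ch s. \<Sum>c\<in>UNIV. of_nat (m y) * (wN l b c s * y $ c))" by (rule sum.swap)
    also have "\<dots> = (\<Sum>y\<in>Ch s. of_nat (m y) * y $ l * y $ b)"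
      by (rule sum.cong[OF refl]) (simp add: sum_distrib_left[symmetric] algebra_chars_def)
    finally show ?thesis .
  qed
  have "(mat_P \<rho> s ** mat_T w (no_u l0 s)) $ i $ b
      = (\<Sum>y\<in>Ch s. of_nat (m y) * F (fam.char_point s y) s $ i1 * y $ i * y $ b)" for i b
  proof -
    have "(mat_P \<rho> s ** mat_T w (no_u l0 s)) $ i $ b = (\<Sum>l\<in>UNIV. \<Sum>y\<in>Ch s. of_nat (m y) * y $ b * (mat_P \<rho> s $ i $ l * y $ l))"
      by (simp add: matrix_matrix_mult_def T sum_distrib_left mult_ac)
    also have "\<dots> = (\<Sum>y\<in>Ch s. \<Sum>l\<in>UNIV. of_nat (m y) * y $ b * (mat_P \<rho> s $ i $ l * y $ l))" by (rule sum.swap)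
    also have "\<dots> = (\<Sum>y\<in>Ch s. of_nat (m y) * y $ b * (mat_P \<rho> s *v y) $ i)"
      by (simp add: matrix_vector_mult_def sum_distrib_left)
    also have "\<dots> = (\<Sum>y\<in>Ch s. of_nat (m y) * F (fam.char_point s y) s $ i1 * y $ i * y $ b)"
    proof (rule sum.cong[OF refl])
      fix y assume "y \<in> Ch s"
      then have "mat_P \<rho> s *v y = F (fam.char_point s y) s $ i1 *s y" using elim(1,2) by metis
      then show "of_nat (m y) * y $ b * (mat_P \<rho> s *v y) $ i = of_nat (m y) * F (fam.char_point s y) s $ i1 * y $ i * y $ b"
        by simp
    qed
    finally show ?thesis .
  qed
  with m(1) show ?case by blast
qed

end

section \<open>Real data\<close>

text \<open>
Schwarz reflection; it preserves holomorphy.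
\<close>

definition conj_fun :: "(complex^'a \<Rightarrow> complex) \<Rightarrow> complex^'a \<Rightarrow> complex" where
  "conj_fun g z = cnj (g (conj_vec z))"

lemma complex_differentiable_conj_fun:
  assumes "complex_differentiable_at g (conj_vec z)" shows "complex_differentiable_at (conj_fun g) z"
proof -
  obtain D where D: "(g has_derivative D) (at (conj_vec z))" "\<forall>c v. D (c *s v) = c * D v"
    using assms by (rule complex_differentiableE)
  have "(conj_vec has_derivative (\<lambda>v. \<chi> i. cnj (v $ i))) (at z)"
  proof (rule has_derivative_vec_lambda)
    fix i
    have "bounded_linear (\<lambda>v :: complex^'a. cnj (v $ i))"
      by (rule bounded_linear_compose[OF bounded_linear_cnj bounded_linear_vec_nth])
    then have "((\<lambda>z :: complex^'a. cnj (z $ i)) has_derivative (\<lambda>v. cnj (v $ i))) (at z)"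
      by (rule bounded_linear_imp_has_derivative)
    then show "((\<lambda>z. conj_vec z $ i) has_derivative (\<lambda>v. cnj (v $ i))) (at z)" by (simp only: conj_vec_simps)
  qed
  then have "(conj_vec has_derivative conj_vec) (at z)" by (simp only: conj_vec_def[abs_def])
  from bounded_linear.has_derivative[OF bounded_linear_cnj has_derivative_compose[OF this D(1)]]
  have "(conj_fun g has_derivative (\<lambda>v. cnj (D (conj_vec v)))) (at z)" by (simp only: conj_fun_def[abs_def])
  moreover have "cnj (D (conj_vec (c *s v))) = c * cnj (D (conj_vec v))" for c v
  proof -
    have "conj_vec (c *s v) = cnj c *s conj_vec v" by (simp add: vec_eq_iff)
    then show ?thesis using D(2) by simp
  qed
  ultimately show ?thesis unfolding complex_differentiable_at_def by blast
qed

lemma isCont_conj_vec: "isCont conj_vec z"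
proof -
  have "continuous_on UNIV (conj_vec :: complex^'a \<Rightarrow> complex^'a)"
    by (rule continuous_on_vecI) (auto intro!: continuous_intros)
  then show ?thesis by (simp add: continuous_on_eq_continuous_at)
qed

lemma eventually_conj_vec:
  assumes "\<forall>\<^sub>F z in nhds (conj_vec p). P z" shows "\<forall>\<^sub>F z in nhds p. P (conj_vec z)"
  using isCont_conj_vec assms by (rule eventually_nhds_compose)

lemma hol_conj_fun:
  assumes "\<And>p. p \<in> K \<Longrightarrow> conj_vec p \<in> K" "g \<in> hol K" shows "conj_fun g \<in> hol K"
  unfolding hol_def
proof safe
  fix p assume "p \<in> K"
  then have "\<forall>\<^sub>F z in nhds (conj_vec p). complex_differentiable_at g z" using assms by (auto simp: hol_def)
  then have "\<forall>\<^sub>F z in nhds p. complex_differentiable_at g (conj_vec z)" by (rule eventually_conj_vec)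
  then show "\<forall>\<^sub>F z in nhds p. complex_differentiable_at (conj_fun g) z"
    by eventually_elim (rule complex_differentiable_conj_fun)
qed

lemma norm_conj_vec: "norm (conj_vec x) = norm x"
proof -
  have "(norm (conj_vec x))\<^sup>2 = (norm x)\<^sup>2" by (simp add: norm_vec_sq)
  then show ?thesis by (simp add: power2_eq_iff_nonneg)
qed

lemma conj_vec_join: "conj_vec (join x s) = join (conj_vec x) (conj_vec s)"
proof -
  have "conj_vec (join x s) $ q = join (conj_vec x) (conj_vec s) $ q" for q by (cases q) auto
  then show ?thesis by (simp add: vec_eq_iff)
qed

lemma xs_conj_vec: "xs_x (conj_vec z) = conj_vec (xs_x z)" "xs_s (conj_vec z) = conj_vec (xs_s z)"
  by (simp_all add: xs_x_def xs_s_def vec_eq_iff)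

text \<open>
The parameters \<open>l\<close> with \<open>a + l b\<close> in the ball form a convex open set, and a holomorphic function on it
that vanishes on a real interval around \<open>0\<close> is zero.
\<close>

lemma zero_on_line:
  fixes h :: "complex^'n \<Rightarrow> complex"
  assumes h: "\<And>x. norm x < R \<Longrightarrow> complex_differentiable_at h x"
    and a: "norm a < R" and \<epsilon>: "\<epsilon> > 0" "\<And>t. \<bar>t\<bar> < \<epsilon> \<Longrightarrow> h (a + of_real t *s b) = 0"
    and l: "norm (a + l *s b) < R"
  shows "h (a + l *s b) = 0"
proof -
  define S where "S = {l. norm (a + l *s b) < R}"
  have contl: "continuous_on UNIV (\<lambda>l. a + l *s b)"
    by (rule continuous_on_vecI) (auto intro!: continuous_intros)
  have "open S" unfolding S_def by (intro open_Collect_less continuous_on_norm contl continuous_on_const)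
  have "convex S"
  proof (rule convexI)
    fix x y :: complex and u v :: real assume xy: "x \<in> S" "y \<in> S" and uv: "0 \<le> u" "0 \<le> v" "u + v = 1"
    have "a + (u *\<^sub>R x + v *\<^sub>R y) *s b = u *\<^sub>R (a + x *s b) + v *\<^sub>R (a + y *s b)"
    proof -
      have "a $ i = of_real u * a $ i + of_real v * a $ i" for i
        using uv by (metis distrib_right mult_1 of_real_1 of_real_add)
      then show ?thesis
        by (simp add: vec_eq_iff scaleR_conv_of_real[where 'a=complex] algebra_simps)
    qed
    also have "\<dots> \<in> ball 0 R"
      by (rule convexD[OF convex_ball]) (use xy uv in \<open>auto simp: S_def\<close>)
    finally show "u *\<^sub>R x + v *\<^sub>R y \<in> S" by (simp add: S_def)
  qed
  have hol: "(\<lambda>l. h (a + l *s b)) holomorphic_on S"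
    unfolding holomorphic_on_def
  proof
    fix l assume "l \<in> S"
    have "(\<lambda>l. h (a + l *s b)) field_differentiable at l"
    proof (rule complex_differentiable_along_curve)
      show "(\<lambda>l. (a + l *s b) $ i) field_differentiable at l" for i
        by (auto intro!: field_differentiable_add field_differentiable_mult)
      show "complex_differentiable_at h (a + l *s b)" using h \<open>l \<in> S\<close> by (simp add: S_def)
    qed
    then show "(\<lambda>l. h (a + l *s b)) field_differentiable at l within S" by (rule field_differentiable_at_within)
  qed
  have S0: "0 \<in> S" using a by (simp add: S_def)
  obtain d where d: "d > 0" "ball 0 d \<subseteq> S" using \<open>open S\<close> S0 open_contains_ball by blast
  define T :: "complex set" where "T = of_real ` {t :: real. \<bar>t\<bar> < min d \<epsilon>}"
  show ?thesis
  proof (rule analytic_continuation[OF hol \<open>open S\<close> convex_connected[OF \<open>convex S\<close>] _ S0])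
    show "T \<subseteq> S" using d S0 by (auto simp: T_def)
    show "0 islimpt T"
      unfolding islimpt_approachable
    proof (intro allI impI)
      fix r :: real assume "r > 0"
      define t where "t = min r (min d \<epsilon>) / 2"
      have t: "0 < t" "t < r" "t < min d \<epsilon>" using \<open>r > 0\<close> d \<epsilon> by (auto simp: t_def)
      show "\<exists>x'\<in>T. x' \<noteq> 0 \<and> dist x' 0 < r"
        by (rule bexI[of _ "of_real t"]) (use t in \<open>auto simp: T_def\<close>)
    qed
    show "h (a + z *s b) = 0" if zT: "z \<in> T" for z
    proof -
      obtain t where "z = of_real t" "\<bar>t\<bar> < \<epsilon>" using zT by (auto simp: T_def)
      then show ?thesis using \<epsilon>(2) by simp
    qed
    show "l \<in> S" using l by (simp add: S_def)
  qed
qed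

lemma real_vec_affine: "real_vec x \<Longrightarrow> real_vec y \<Longrightarrow> real_vec (x + of_real t *s y)"
  by (simp add: real_vec_def)

text \<open>
Two applications of \<open>zero_on_line\<close>: along the complex line through \<open>0\<close> and a real point \<open>a\<close> the
function vanishes at the real points of the small ball, so it vanishes at all real points of the large
ball; and \<open>x = a + \<i> b\<close> lies on the line through \<open>a\<close> with the real direction \<open>b\<close>.
\<close>

theorem zero_on_real_points:
  fixes h :: "complex^'n \<Rightarrow> complex"
  assumes h: "\<And>x. norm x < R \<Longrightarrow> complex_differentiable_at h x"
    and "\<delta> > 0" and z: "\<And>x. norm x \<le> \<delta> \<Longrightarrow> real_vec x \<Longrightarrow> h x = 0"
    and x: "norm x < R"
  shows "h x = 0"
proof -
  have R: "0 < R" using x norm_ge_zero[of x] by linarith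
  have real: "h a = 0" if a: "real_vec a" "norm a < R" for a
  proof -
    have "h (0 + 1 *s a) = 0"
    proof (rule zero_on_line[OF h, where \<epsilon>="\<delta> / (norm a + 1)"])
      show "\<delta> / (norm a + 1) > 0" using \<open>\<delta> > 0\<close> by (simp add: add_nonneg_pos)
      fix t :: real assume t: "\<bar>t\<bar> < \<delta> / (norm a + 1)"
      show "h (0 + of_real t *s a) = 0"
      proof (rule z)
        have "\<bar>t\<bar> * norm a \<le> \<bar>t\<bar> * (norm a + 1)" by (intro mult_left_mono) auto
        also have "\<dots> \<le> \<delta>" using t by (simp add: pos_less_divide_eq add_nonneg_pos less_imp_le)
        finally show "norm (0 + of_real t *s a) \<le> \<delta>" by (simp add: norm_cscale)
        show "real_vec (0 + of_real t *s a)" using a by (simp add: real_vec_def)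
      qed
    qed (use R a in auto)
    then show ?thesis by simp
  qed
  define a :: "complex^'n" where "a = (\<chi> i. of_real (Re (x $ i)))"
  define b :: "complex^'n" where "b = (\<chi> i. of_real (Im (x $ i)))"
  have ab: "real_vec a" "real_vec b" by (auto simp: a_def b_def real_vec_def)
  have xab: "x = a + \<i> *s b" by (simp add: vec_eq_iff a_def b_def complex_eq)
  have "(norm a)\<^sup>2 \<le> (norm x)\<^sup>2"
    unfolding norm_vec_sq by (rule sum_mono) (simp add: a_def cmod_power2)
  then have na: "norm a < R" using x power2_le_imp_le[of "norm a" "norm x"] by simp
  have "h (a + \<i> *s b) = 0"
  proof (rule zero_on_line[OF h na, where \<epsilon>="(R - norm a) / (norm b + 1)"])
    show "(R - norm a) / (norm b + 1) > 0" using na by (simp add: add_nonneg_pos)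
    fix t :: real assume t: "\<bar>t\<bar> < (R - norm a) / (norm b + 1)"
    show "h (a + of_real t *s b) = 0"
    proof (rule real)
      have "\<bar>t\<bar> * norm b \<le> \<bar>t\<bar> * (norm b + 1)" by (intro mult_left_mono) auto
      also have "\<dots> < R - norm a" using t by (simp add: pos_less_divide_eq add_nonneg_pos)
      finally have "norm (of_real t *s b) < R - norm a" by (simp add: norm_cscale)
      then show "norm (a + of_real t *s b) < R" using norm_triangle_ineq[of a "of_real t *s b"] by linarith
    qed (rule real_vec_affine[OF ab])
  qed (use x xab in auto)
  then show ?thesis using xab by simp
qed

text \<open>
A function that is real at real points agrees with its reflection there, hence on the whole ball.
\<close>

lemma self_conjugate_on_ball:
  fixes f :: "complex^'n \<Rightarrow> complex"
  assumes f: "f \<in> hol (cball 0 \<delta>)" and "\<delta> > 0" and real: "\<And>x. norm x \<le> \<delta> \<Longrightarrow> real_vec x \<Longrightarrow> f x \<in> \<real>"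
  obtains R where "R > \<delta>" "\<forall>x. norm x < R \<longrightarrow> cnj (f (conj_vec x)) = f x"
proof -
  have "\<forall>\<^sub>F z in nhds p. complex_differentiable_at f (xs_x z)" if "p \<in> slab (cball 0 \<delta>)" for p :: "complex^('n + unit)"
    by (rule eventually_nhds_compose[OF isCont_xs(1)]) (use that f in \<open>auto simp: slab_def hol_def\<close>)
  then obtain R r where R: "R > \<delta>" "r > 0" "\<forall>z\<in>polybox R r :: (complex^('n + unit)) set. complex_differentiable_at f (xs_x z)"
    using slab_ball_polybox[of \<delta> "\<lambda>z :: complex^('n + unit). complex_differentiable_at f (xs_x z)"] \<open>\<delta> > 0\<close> by blast
  have cd: "complex_differentiable_at f x" if "norm x < R" for x
  proof -
    have "join x (0 :: complex^unit) \<in> polybox R r" using R that by (simp add: polybox_def)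
    then show ?thesis using R(3) by (metis join_simps(1))
  qed
  have "f x - conj_fun f x = 0" if "norm x < R" for x
  proof (rule zero_on_real_points[where R=R and \<delta>=\<delta>])
    show "complex_differentiable_at (\<lambda>x. f x - conj_fun f x) x" if "norm x < R" for x
      using that by (intro complex_differentiable_diff complex_differentiable_conj_fun cd) (simp_all add: norm_conj_vec)
    show "f x - conj_fun f x = 0" if "norm x \<le> \<delta>" "real_vec x" for x
      using real[OF that] that(2) conj_vec_fixed[of x] by (simp add: conj_fun_def Reals_cnj_iff)
  qed (use \<open>\<delta> > 0\<close> that in auto)
  then show thesis using R(1) by (intro that[of R]) (auto simp: conj_fun_def)
qed

lemma cpartial_conj_fun:
  assumes "complex_differentiable_at g (conj_vec z)"
  shows "cpartial j (conj_fun g) z = cnj (cpartial j g (conj_vec z))"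
proof -
  have "(\<lambda>v. g (conj_vec z + axis j v)) field_differentiable at (cnj 0)"
  proof (rule complex_differentiable_along_curve)
    show "(\<lambda>v. (conj_vec z + axis j v) $ i) field_differentiable at (cnj 0)" for i by (rule axis_field_differentiable)
    show "complex_differentiable_at g (conj_vec z + axis j (cnj 0))" using assms by (simp add: axis_zero)
  qed
  then have "((\<lambda>v. g (conj_vec z + axis j v)) has_field_derivative deriv (\<lambda>v. g (conj_vec z + axis j v)) 0) (at (cnj 0))"
    by (simp add: field_differentiable_derivI)
  from has_field_derivative_cnj_cnj[OF this]
  have "deriv (cnj \<circ> (\<lambda>v. g (conj_vec z + axis j v)) \<circ> cnj) 0 = cnj (deriv (\<lambda>v. g (conj_vec z + axis j v)) 0)"
    by (simp add: DERIV_imp_deriv)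
  moreover have "conj_vec (z + axis j v) = conj_vec z + axis j (cnj v)" for v
    by (simp add: vec_eq_iff axis_def)
  ultimately show ?thesis by (simp add: cpartial_def conj_fun_def o_def)
qed

lemma cpartial_cong_near: "\<forall>\<^sub>F z in nhds p. f z = g z \<Longrightarrow> cpartial j f p = cpartial j g p"
proof -
  assume a: "\<forall>\<^sub>F z in nhds p. f z = g z"
  have "isCont (\<lambda>v. p + axis j v) 0"
  proof -
    have "continuous_on UNIV (\<lambda>v. p + axis j v)"
      by (intro continuous_on_add continuous_on_const continuous_on_axis continuous_on_id)
    then show ?thesis by (simp add: continuous_on_eq_continuous_at)
  qed
  moreover have "\<forall>\<^sub>F z in nhds (p + axis j 0). f z = g z" using a by (simp add: axis_zero)
  ultimately have "\<forall>\<^sub>F v in nhds 0. f (p + axis j v) = g (p + axis j v)" by (rule eventually_nhds_compose)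
  then show ?thesis unfolding cpartial_def by (rule deriv_cong_ev) simp
qed

locale real_critical_deformation = critical_deformation f0 e i1 l0 W \<delta> \<phi> \<rho> w
  for f0 :: "complex^'n \<Rightarrow> complex^'k"
    and e :: "'m::finite \<Rightarrow> complex^'n \<Rightarrow> complex^'k"
    and i1 :: 'k and l0 :: 'm
    and W :: "(complex^'n) set" and \<delta> :: real
    and \<phi> :: "'m \<Rightarrow> complex^'n \<Rightarrow> complex"
    and \<rho> :: "'m \<Rightarrow> 'm \<Rightarrow> complex^'m \<Rightarrow> complex"
    and w :: "'m \<Rightarrow> 'm \<Rightarrow> 'm \<Rightarrow> complex^'m \<Rightarrow> complex" +
  assumes real_data: "\<And>x. x \<in> X \<Longrightarrow> real_vec x \<Longrightarrow> real_vec (f0 x) \<and> (\<forall>l. real_vec (e l x)) \<and> (\<forall>l. \<phi> l x \<in> \<real>)"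
begin

abbreviation "self_conj g \<equiv> eq_near KX (conj_fun g) g"

lemma slab_conj_vec: "p \<in> KX \<Longrightarrow> conj_vec p \<in> KX"
  by (auto simp: slab_def xs_conj_vec norm_conj_vec) (simp add: conj_vec_def vec_eq_iff)

lemma scI: "(\<And>p. p \<in> KX \<Longrightarrow> \<forall>\<^sub>F z in nhds p. conj_fun g z = g z) \<Longrightarrow> self_conj g"
  by (auto simp: eq_near_def)

lemma scD: "self_conj g \<Longrightarrow> p \<in> KX \<Longrightarrow> \<forall>\<^sub>F z in nhds p. conj_fun g z = g z"
  by (auto simp: eq_near_def)

lemma self_conj_everywhere: "(\<And>z. conj_fun g z = g z) \<Longrightarrow> self_conj g"
  by (rule scI) simp

lemma self_conj_add: "self_conj f \<Longrightarrow> self_conj g \<Longrightarrow> self_conj (\<lambda>z. f z + g z)"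
  unfolding eq_near_def by (auto elim!: eventually_elim2 simp: conj_fun_def)

lemma self_conj_mult: "self_conj f \<Longrightarrow> self_conj g \<Longrightarrow> self_conj (\<lambda>z. f z * g z)"
  unfolding eq_near_def by (auto elim!: eventually_elim2 simp: conj_fun_def)

lemma self_conj_sum: "(\<And>i. i \<in> A \<Longrightarrow> self_conj (f i)) \<Longrightarrow> self_conj (\<lambda>z. \<Sum>i\<in>A. f i z)"
  by (induction A rule: infinite_finite_induct) (auto intro: self_conj_add self_conj_everywhere simp: conj_fun_def)

lemma self_conj_prod: "(\<And>i. i \<in> A \<Longrightarrow> self_conj (f i)) \<Longrightarrow> self_conj (\<lambda>z. \<Prod>i\<in>A. f i z)"
  by (induction A rule: infinite_finite_induct) (auto intro: self_conj_mult self_conj_everywhere simp: conj_fun_def)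

lemma self_conj_comp_x:
  assumes "f \<in> hol X" "\<And>x. x \<in> X \<Longrightarrow> real_vec x \<Longrightarrow> f x \<in> \<real>"
  shows "self_conj (\<lambda>z. f (xs_x z))"
proof -
  obtain R where R: "R > \<delta>" "\<forall>x. norm x < R \<longrightarrow> cnj (f (conj_vec x)) = f x"
    by (rule self_conjugate_on_ball[OF assms(1) delta]) (use assms(2) in auto)
  show ?thesis
  proof (rule scI)
    fix p :: "complex^('n + 'm)" assume p: "p \<in> KX"
    have "p \<in> polybox R 1" using p R by (auto simp: slab_def polybox_def)
    then have "\<forall>\<^sub>F z in nhds p. z \<in> polybox R 1" by (rule eventually_nhds_in_open[OF open_polybox])
    then show "\<forall>\<^sub>F z in nhds p. conj_fun (\<lambda>z. f (xs_x z)) z = f (xs_x z)"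
      by eventually_elim (use R(2) in \<open>simp add: conj_fun_def xs_conj_vec polybox_def\<close>)
  qed
qed

lemma self_conj_phi: "self_conj (\<lambda>z. \<phi> l (xs_x z))"
  by (rule self_conj_comp_x[OF phi_hol0]) (use real_data in auto)

lemma self_conj_f0: "self_conj (\<lambda>z. f0 (xs_x z) $ i)" and self_conj_e: "self_conj (\<lambda>z. e l (xs_x z) $ i)"
  using self_conj_comp_x[OF f0_nth_hol] self_conj_comp_x[OF e_nth_hol] real_data by (auto simp: real_vec_def)

lemma self_conj_comp: "self_conj (F_comp i)" and self_conj_comp0: "self_conj (F0_comp i)"
proof -
  have "self_conj (\<lambda>z. xs_s z $ l)" for l by (rule self_conj_everywhere) (simp add: conj_fun_def xs_conj_vec)
  then show "self_conj (F_comp i)"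
    unfolding F_comp_def[abs_def] F_nth by (intro self_conj_add self_conj_f0 self_conj_sum self_conj_mult self_conj_e)
  have "self_conj (\<lambda>z. no_u l0 (xs_s z) $ l)" for l
    by (rule self_conj_everywhere) (simp add: conj_fun_def xs_conj_vec no_u_def)
  then show "self_conj (F0_comp i)"
    unfolding F0_comp_def[abs_def] F_nth by (intro self_conj_add self_conj_f0 self_conj_sum self_conj_mult self_conj_e)
qed

lemma self_conj_pd:
  assumes g: "g \<in> hol KX" and s: "self_conj g" shows "self_conj (cpartial j g)"
proof (rule scI)
  fix p assume p: "p \<in> KX"
  have "\<forall>\<^sub>F z in nhds (conj_vec p). complex_differentiable_at g z" using g slab_conj_vec[OF p] by (auto simp: hol_def)
  then have 1: "\<forall>\<^sub>F z in nhds p. complex_differentiable_at g (conj_vec z)" by (rule eventually_conj_vec)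
  have 2: "\<forall>\<^sub>F z in nhds p. \<forall>\<^sub>F z in nhds z. conj_fun g z = g z"
    using scD[OF s p] by (simp only: eventually_eventually)
  from 1 2 show "\<forall>\<^sub>F z in nhds p. conj_fun (cpartial j g) z = cpartial j g z"
  proof eventually_elim
    case (elim z)
    have "cpartial j (conj_fun g) z = cpartial j g z" using elim(2) by (rule cpartial_cong_near)
    moreover have "cpartial j (conj_fun g) z = cnj (cpartial j g (conj_vec z))" using elim(1) by (rule cpartial_conj_fun)
    ultimately show ?case by (simp add: conj_fun_def)
  qed
qed

lemma self_conj_det:
  fixes M :: "complex^('n + 'm) \<Rightarrow> complex^'k^'k"
  assumes "\<And>i j. self_conj (\<lambda>z. M z $ i $ j)" shows "self_conj (\<lambda>z. det (M z))"
  unfolding det_def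
  by (intro self_conj_sum self_conj_mult self_conj_prod assms) (rule self_conj_everywhere, simp add: conj_fun_def)

lemma self_conj_gens:
  assumes "g \<in> gens" shows "self_conj g"
proof -
  have j: "self_conj (\<lambda>z. jac z $ i $ j)" for i j
    unfolding jac_nth by (rule self_conj_pd[OF F0_comp_hol self_conj_comp0])
  have "self_conj g" if mm: "g \<in> max_minors jac"
  proof -
    obtain \<sigma> :: "'k \<Rightarrow> 'n" where \<sigma>: "g = (\<lambda>z. det (\<chi> i c. jac z $ i $ \<sigma> c))"
      using mm unfolding max_minors_def by blast
    show ?thesis unfolding \<sigma> by (rule self_conj_det) (simp only: vec_lambda_beta j)
  qed
  then show ?thesis using assms self_conj_comp unfolding gens_def by auto
qed

text \<open>
The generators of \<open>J\<close> are self-conjugate.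
\<close>

lemma J_conj_fun:
  assumes "g \<in> J" shows "conj_fun g \<in> J"
proof -
  obtain A a where A: "finite A" "A \<subseteq> gens" "\<forall>h\<in>A. a h \<in> hol KX" "eq_near KX g (\<lambda>z. \<Sum>h\<in>A. a h z * h z)"
    and g: "g \<in> hol KX" using assms by (auto simp: J_def ideal_near_def)
  have "eq_near KX (conj_fun g) (\<lambda>z. \<Sum>h\<in>A. conj_fun (a h) z * h z)"
    unfolding eq_near_def
  proof
    fix p assume p: "p \<in> KX"
    have "\<forall>\<^sub>F z in nhds (conj_vec p). g z = (\<Sum>h\<in>A. a h z * h z)" using A(4) slab_conj_vec[OF p] by (auto simp: eq_near_def)
    then have 1: "\<forall>\<^sub>F z in nhds p. g (conj_vec z) = (\<Sum>h\<in>A. a h (conj_vec z) * h (conj_vec z))" by (rule eventually_conj_vec)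
    have 2: "\<forall>\<^sub>F z in nhds p. \<forall>h\<in>A. conj_fun h z = h z"
      using A(1,2) self_conj_gens scD[OF _ p] by (intro eventually_ball_finite) auto
    from 1 2 show "\<forall>\<^sub>F z in nhds p. conj_fun g z = (\<Sum>h\<in>A. conj_fun (a h) z * h z)"
    proof eventually_elim
      case (elim z)
      have "conj_fun g z = (\<Sum>h\<in>A. conj_fun (a h) z * conj_fun h z)" using elim(1) by (simp add: conj_fun_def)
      also have "\<dots> = (\<Sum>h\<in>A. conj_fun (a h) z * h z)" using elim(2) by simp
      finally show ?case .
    qed
  qed
  moreover have "conj_fun g \<in> hol KX" "\<forall>h\<in>A. conj_fun (a h) \<in> hol KX" using A(3) g by (auto intro!: hol_conj_fun slab_conj_vec)
  ultimately show ?thesis using A(1,2) unfolding J_def ideal_near_def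
    by (auto intro!: exI[of _ A] exI[of _ "\<lambda>h. conj_fun (a h)"])
qed

text \<open>
Reflection turns the coefficients \<open>c(s)\<close> of a self-conjugate function into coefficients
\<open>cnj (c (cnj s))\<close> of the same function, and coefficients are unique.
\<close>

lemma represents_real:
  assumes r: "fam.represents g c" and s: "self_conj g"
  shows "\<forall>\<^sub>F s in nhds 0. real_vec s \<longrightarrow> real_vec (c s)"
proof -
  define c' where "c' s = conj_vec (c (conj_vec s))" for s
  have c'h: "c' \<in> holv {0}"
  proof -
    have "conj_fun (\<lambda>s. c s $ l) \<in> hol {0}" for l
      using r by (intro hol_conj_fun) (auto simp: fam.represents_def holv_simps, simp add: conj_vec_def vec_eq_iff)
    then show ?thesis by (simp add: holv_simps c'_def conj_fun_def[abs_def])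
  qed
  have "conj_fun (\<lambda>z. g z - (\<Sum>l\<in>UNIV. c (xs_s z) $ l * \<phi> l (xs_x z))) \<in> J"
    using r by (intro J_conj_fun) (simp add: fam.represents_def)
  moreover have "eq_near KX (conj_fun (\<lambda>z. g z - (\<Sum>l\<in>UNIV. c (xs_s z) $ l * \<phi> l (xs_x z))))
      (\<lambda>z. g z - (\<Sum>l\<in>UNIV. c' (xs_s z) $ l * \<phi> l (xs_x z)))"
    unfolding eq_near_def
  proof
    fix p assume p: "p \<in> KX"
    have "\<forall>\<^sub>F z in nhds p. \<forall>l. conj_fun (\<lambda>z. \<phi> l (xs_x z)) z = \<phi> l (xs_x z)"
      using scD[OF self_conj_phi p] by (intro eventually_all_finite)
    with scD[OF s p] show "\<forall>\<^sub>F z in nhds p. conj_fun (\<lambda>z. g z - (\<Sum>l\<in>UNIV. c (xs_s z) $ l * \<phi> l (xs_x z))) z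
       = g z - (\<Sum>l\<in>UNIV. c' (xs_s z) $ l * \<phi> l (xs_x z))"
      by eventually_elim (simp add: conj_fun_def c'_def xs_conj_vec)
  qed
  ultimately have "(\<lambda>z. g z - (\<Sum>l\<in>UNIV. c' (xs_s z) $ l * \<phi> l (xs_x z))) \<in> J" by (rule fam.J_near)
  then have "fam.represents g c'" using r c'h by (simp add: fam.represents_def)
  from fam.represents_unique[OF r this] show ?thesis
  proof eventually_elim
    case (elim s)
    show ?case
    proof
      assume "real_vec s"
      then have "conj_vec s = s" by (simp add: conj_vec_fixed)
      then have "conj_vec (c s) = c s" using elim by (simp add: c'_def)
      then show "real_vec (c s)" by (simp add: conj_vec_fixed)
    qed
  qed
qed

lemma PT_real:
  "\<forall>\<^sub>F s in nhds 0. real_vec s \<longrightarrow> (\<forall>i b. (mat_P \<rho> s ** mat_T w (no_u l0 s)) $ i $ b \<in> \<real>)"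
proof -
  have "\<forall>\<^sub>F s in nhds 0. \<forall>i. real_vec s \<longrightarrow> real_vec (\<chi> l. \<rho> i l s)"
    using represents_real[OF represents_rho self_conj_mult[OF self_conj_comp self_conj_phi]] by (rule eventually_all_finite)
  moreover have "\<forall>\<^sub>F s in nhds 0. \<forall>i j. real_vec s \<longrightarrow> real_vec (\<chi> l. wN i j l s)"
    using represents_real[OF fam.represents_w self_conj_mult[OF self_conj_phi self_conj_phi]] by (intro eventually_all_finite)
  ultimately show ?thesis
  proof eventually_elim
    case (elim s)
    show ?case
    proof (intro impI allI)
      fix i b assume s: "real_vec s"
      have r: "\<rho> i l s \<in> \<real>" "w i j l (no_u l0 s) \<in> \<real>" for i j l
        using elim s by (auto simp: real_vec_def wN_def)
      show "(mat_P \<rho> s ** mat_T w (no_u l0 s)) $ i $ b \<in> \<real>"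
        by (simp add: matrix_matrix_mult_def mat_P_def mat_T_def mat_W_def map_matrix_def zeta_def)
           (intro sum_in_Reals Reals_mult r)
    qed
  qed
qed

text \<open>
The generators, the functions \<open>\<phi> l\<close> and \<open>F\<^sub>1\<close> are self-conjugate near the slab.
\<close>

lemma crit_conj:
  "\<forall>\<^sub>F s in nhds 0. real_vec s \<longrightarrow> (\<forall>x\<in>X. crit s x \<longrightarrow>
     conj_vec x \<in> X \<and> crit s (conj_vec x) \<and> Phi (conj_vec x) = conj_vec (Phi x) \<and> F (conj_vec x) s $ i1 = cnj (F x s $ i1))"
proof -
  have 1: "\<forall>\<^sub>F s in nhds 0. \<forall>x\<in>X. \<forall>h\<in>gens. conj_fun h (join x s) = h (join x s)"
    by (rule fam.eventually_at_points[where Q="\<lambda>z. \<forall>h\<in>gens. conj_fun h z = h z"])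
       (intro eventually_ball_finite gens_finite ballI scD self_conj_gens)
  have 2: "\<forall>\<^sub>F s in nhds (0 :: complex^'m). \<forall>x\<in>X. \<forall>l. conj_fun (\<lambda>z. \<phi> l (xs_x z)) (join x s) = \<phi> l (xs_x (join x s))"
    by (rule fam.eventually_at_points[where Q="\<lambda>z. \<forall>l. conj_fun (\<lambda>z. \<phi> l (xs_x z)) z = \<phi> l (xs_x z)"])
       (intro eventually_all_finite scD[OF self_conj_phi])
  have 3: "\<forall>\<^sub>F s in nhds 0. \<forall>x\<in>X. conj_fun (F_comp i1) (join x s) = F_comp i1 (join x s)"
    by (rule fam.eventually_at_points[where Q="\<lambda>z. conj_fun (F_comp i1) z = F_comp i1 z"]) (rule scD[OF self_conj_comp])
  from 1 2 3 show ?thesis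
  proof eventually_elim
    case (elim s)
    show ?case
    proof (intro impI ballI)
      fix x assume s: "real_vec s" and x: "x \<in> X" "crit s x"
      have cvs: "conj_vec (join x s) = join (conj_vec x) s" using s by (simp add: conj_vec_join conj_vec_fixed[symmetric])
      have xW: "x \<in> W" "conj_vec x \<in> X" "conj_vec x \<in> W" using x W(2) by (auto simp: norm_conj_vec subset_eq)
      have "h (join (conj_vec x) s) = 0" if "h \<in> gens" for h
      proof -
        have "cnj (h (join (conj_vec x) s)) = h (join x s)" using elim(1) x(1) that cvs by (metis conj_fun_def)
        also have "\<dots> = 0" using crit_iff_gens[OF xW(1)] x(2) that by blast
        finally show ?thesis by simp
      qed
      then have "crit s (conj_vec x)" using crit_iff_gens[OF xW(3)] by blast
      moreover have "cnj (\<phi> l (conj_vec x)) = \<phi> l x" for l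
        using elim(2) x(1) by (simp add: conj_fun_def xs_conj_vec)
      then have "\<phi> l (conj_vec x) = cnj (\<phi> l x)" for l by (metis complex_cnj_cnj)
      then have "Phi (conj_vec x) = conj_vec (Phi x)" by (simp add: Phi_def vec_eq_iff)
      moreover have "conj_fun (F_comp i1) (join x s) = F_comp i1 (join x s)" using elim(3) x(1) by blast
      then have "cnj (F (conj_vec x) s $ i1) = F x s $ i1" by (simp add: conj_fun_def F_comp_def cvs)
      then have "F (conj_vec x) s $ i1 = cnj (F x s $ i1)" by (metis complex_cnj_cnj)
      ultimately show "conj_vec x \<in> X \<and> crit s (conj_vec x) \<and> Phi (conj_vec x) = conj_vec (Phi x) \<and> F (conj_vec x) s $ i1 = cnj (F x s $ i1)"
        using xW by blast
    qed
  qed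
qed

text \<open>
The map \<open>Phi\<close> is a bijection from the critical points onto the characters that commutes with complex
conjugation, so real points correspond to real characters.
\<close>

theorem real_critical_points_signature:
  "\<forall>\<^sub>F s in nhds 0. real_vec s \<longrightarrow> finite {x \<in> X. real_vec x \<and> crit s x} \<and>
     (\<exists>A :: real^'m^'m. transpose A = A \<and>
        mat_P \<rho> s ** mat_T w (no_u l0 s) = map_matrix complex_of_real A \<and>
        int (card {x \<in> X. real_vec x \<and> crit s x \<and> Re (F x s $ i1) > 0})
        - int (card {x \<in> X. real_vec x \<and> crit s x \<and> Re (F x s $ i1) < 0}) = signature A)"
  using crit_char char_crit PT_entries PT_real crit_conj fam.eventually_structure
proof eventually_elim
  case (elim s)
  show ?case
  proof
    assume s: "real_vec s"
    have fin: "finite (Ch s)" by (rule structure_constants.finite_chars[OF elim(6)])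
    have pt: "fam.char_point s y \<in> X" "crit s (fam.char_point s y)" "Phi (fam.char_point s y) = y" if "y \<in> Ch s" for y
      using elim(2) that by auto
    have ch: "Phi x \<in> Ch s" "fam.char_point s (Phi x) = x" if "x \<in> X" "crit s x" for x
      using elim(1) that by auto
    have cj: "conj_vec x \<in> X" "crit s (conj_vec x)" "Phi (conj_vec x) = conj_vec (Phi x)" "F (conj_vec x) s $ i1 = cnj (F x s $ i1)"
      if "x \<in> X" "crit s x" for x using elim(5) s that by auto
    obtain m where m: "\<forall>y\<in>Ch s. m y > (0 :: nat)" "\<forall>i b. (mat_P \<rho> s ** mat_T w (no_u l0 s)) $ i $ b
      = (\<Sum>y\<in>Ch s. of_nat (m y) * F (fam.char_point s y) s $ i1 * y $ i * y $ b)" using elim(3) by blast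
    define g where "g y = F (fam.char_point s y) s $ i1" for y
    have cvCh: "conj_vec y \<in> Ch s" "fam.char_point s (conj_vec y) = conj_vec (fam.char_point s y)" if "y \<in> Ch s" for y
      using pt[OF that] cj[of "fam.char_point s y"] ch[of "conj_vec (fam.char_point s y)"] by auto
    define A :: "real^'m^'m" where "A = (\<chi> i b. Re ((mat_P \<rho> s ** mat_T w (no_u l0 s)) $ i $ b))"
    have Ac: "complex_of_real (A $ i $ b) = (mat_P \<rho> s ** mat_T w (no_u l0 s)) $ i $ b" for i b
      using elim(4) s by (simp add: A_def of_real_Re)
    have dual: "\<exists>z. pairing z y = 1 \<and> (\<forall>y'\<in>Ch s - {y}. pairing z y' = 0)" if "y \<in> Ch s" for y
      using structure_constants.dual_char[OF elim(6) that] by metis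
    have gcv: "g (conj_vec y) = cnj (g y)" if "y \<in> Ch s" for y
      using cvCh[OF that] cj(4)[of "fam.char_point s y"] pt[OF that] by (simp add: g_def)
    have Ag: "complex_of_real (A $ i $ b) = (\<Sum>y\<in>Ch s. of_nat (m y) * g y * y $ i * y $ b)" for i b
      using m(2) by (simp add: Ac g_def)
    have sig: "transpose A = A"
      "signature A = int (card {y \<in> Ch s. real_vec y \<and> Re (g y) > 0}) - int (card {y \<in> Ch s. real_vec y \<and> Re (g y) < 0})"
      using trace_form_signature[where Y="Ch s" and A=A and m=m and g=g, OF fin cvCh(1) dual _ gcv Ag] m(1) by auto
    have real: "real_vec (Phi x) \<longleftrightarrow> real_vec x" if x: "x \<in> X" "crit s x" for x
      unfolding conj_vec_fixed[symmetric] using cj[OF x] ch[OF x] ch[of "conj_vec x"] by metis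
    have count: "card {x \<in> X. real_vec x \<and> crit s x \<and> Q (F x s $ i1)} = card {y \<in> Ch s. real_vec y \<and> Q (g y)}" for Q
    proof (rule bij_betw_same_card)
      show "bij_betw Phi {x \<in> X. real_vec x \<and> crit s x \<and> Q (F x s $ i1)} {y \<in> Ch s. real_vec y \<and> Q (g y)}"
      proof (rule bij_betwI[where g="fam.char_point s"])
        show "Phi \<in> {x \<in> X. real_vec x \<and> crit s x \<and> Q (F x s $ i1)} \<rightarrow> {y \<in> Ch s. real_vec y \<and> Q (g y)}"
          using ch real by (auto simp: g_def)
        show "fam.char_point s \<in> {y \<in> Ch s. real_vec y \<and> Q (g y)} \<rightarrow> {x \<in> X. real_vec x \<and> crit s x \<and> Q (F x s $ i1)}"
        proof
          fix y assume y: "y \<in> {y \<in> Ch s. real_vec y \<and> Q (g y)}"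
          then have "real_vec (fam.char_point s y)" using real[OF pt(1,2)] pt(3) by auto
          then show "fam.char_point s y \<in> {x \<in> X. real_vec x \<and> crit s x \<and> Q (F x s $ i1)}"
            using y pt by (auto simp: g_def)
        qed
      qed (use ch pt in auto)
    qed
    have "{x \<in> X. real_vec x \<and> crit s x} \<subseteq> fam.char_point s ` Ch s" using ch by (metis (mono_tags, lifting) image_eqI mem_Collect_eq subsetI)
    then have "finite {x \<in> X. real_vec x \<and> crit s x}" using fin by (meson finite_imageI finite_subset)
    moreover have "mat_P \<rho> s ** mat_T w (no_u l0 s) = map_matrix complex_of_real A"
      by (simp add: vec_eq_iff map_matrix_def Ac)
    ultimately show "finite {x \<in> X. real_vec x \<and> crit s x} \<and>
     (\<exists>A :: real^'m^'m. transpose A = A \<and>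
        mat_P \<rho> s ** mat_T w (no_u l0 s) = map_matrix complex_of_real A \<and>
        int (card {x \<in> X. real_vec x \<and> crit s x \<and> Re (F x s $ i1) > 0})
        - int (card {x \<in> X. real_vec x \<and> crit s x \<and> Re (F x s $ i1) < 0}) = signature A)"
      using sig count[of "\<lambda>c. Re c > 0"] count[of "\<lambda>c. Re c < 0"] by (intro conjI exI[of _ A]) auto
  qed
qed

end

section \<open>Discriminant and signature\<close>

theorem theorem5p2:
  fixes f0 :: "complex^'n \<Rightarrow> complex^'k"
    and e :: "'m::finite \<Rightarrow> complex^'n \<Rightarrow> complex^'k"
    and i1 :: 'k and l0 :: 'm
    and W :: "(complex^'n) set" and \<delta> :: real
    and \<phi> :: "'m \<Rightarrow> complex^'n \<Rightarrow> complex"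
    and \<rho> :: "'m \<Rightarrow> 'm \<Rightarrow> complex^'m \<Rightarrow> complex"
    and w :: "'m \<Rightarrow> 'm \<Rightarrow> 'm \<Rightarrow> complex^'m \<Rightarrow> complex"
  defines "F \<equiv> deformation f0 e"
    and "X \<equiv> cball (0 :: complex^'n) \<delta>"
  assumes "\<delta> > 0" and "open W" and "X \<subseteq> W"
    and "f0 \<in> holv W" and "\<And>l. e l \<in> holv W"
    and "f0 0 = 0"
    and "\<And>x. x \<in> W \<Longrightarrow> e l0 x = - axis i1 1"
    and "represents_basis_Q (undeformed l0 F) (\<lambda>l z. e l (xu_x z))"
    and "\<forall>\<^sub>F s in nhds 0. \<forall>x\<in>W. critical_point i1 F s x \<longrightarrow> x \<in> X"
    and "basis_Phi X i1 f0 \<phi>"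
    and "free_basis_Phi_s X i1 l0 F \<phi>"
    and "\<And>i l. \<rho> i l \<in> hol {0}"
    and "\<And>i. (\<lambda>z. F (xs_x z) (xs_s z) $ i1 * \<phi> i (xs_x z)
               - (\<Sum>l\<in>UNIV. \<rho> i l (xs_s z) * \<phi> l (xs_x z))) \<in> ideal_J X i1 l0 F"
    and "\<And>i j l. w i j l \<in> hol {0}"
    and "\<And>i j. (\<lambda>z. \<phi> i (xs_x z) * \<phi> j (xs_x z)
               - (\<Sum>l\<in>UNIV. w i j l (no_u l0 (xs_s z)) * \<phi> l (xs_x z))) \<in> ideal_J X i1 l0 F"
  shows "(\<forall>\<^sub>F s in nhds 0. s \<in> discriminant X F \<longleftrightarrow> det (mat_P \<rho> s) = 0) \<and>
    ((\<forall>x\<in>X. real_vec x \<longrightarrow>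
        real_vec (f0 x) \<and> (\<forall>l. real_vec (e l x)) \<and> (\<forall>l. \<phi> l x \<in> \<real>)) \<longrightarrow>
     (\<forall>\<^sub>F s in nhds 0. real_vec s \<longrightarrow>
        finite {x \<in> X. real_vec x \<and> critical_point i1 F s x} \<and>
        (\<exists>A :: real^'m^'m. transpose A = A \<and>
           mat_P \<rho> s ** mat_T w (no_u l0 s) = map_matrix complex_of_real A \<and>
           int (card {x \<in> X. real_vec x \<and> critical_point i1 F s x \<and> Re (F x s $ i1) > 0})
           - int (card {x \<in> X. real_vec x \<and> critical_point i1 F s x \<and> Re (F x s $ i1) < 0})
           = signature A)))"
proof -
  interpret cd: critical_deformation f0 e i1 l0 W \<delta> \<phi> \<rho> w
    using assms(3-) unfolding F_def X_def by unfold_locales (auto simp: basis_Phi_def)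
  have "\<forall>\<^sub>F s in nhds 0. real_vec s \<longrightarrow>
        finite {x \<in> X. real_vec x \<and> critical_point i1 F s x} \<and>
        (\<exists>A :: real^'m^'m. transpose A = A \<and>
           mat_P \<rho> s ** mat_T w (no_u l0 s) = map_matrix complex_of_real A \<and>
           int (card {x \<in> X. real_vec x \<and> critical_point i1 F s x \<and> Re (F x s $ i1) > 0})
           - int (card {x \<in> X. real_vec x \<and> critical_point i1 F s x \<and> Re (F x s $ i1) < 0})
           = signature A)"
    if real: "\<forall>x\<in>X. real_vec x \<longrightarrow>
        real_vec (f0 x) \<and> (\<forall>l. real_vec (e l x)) \<and> (\<forall>l. \<phi> l x \<in> \<real>)"
  proof -
    interpret rcd: real_critical_deformation f0 e i1 l0 W \<delta> \<phi> \<rho> w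
      using real unfolding X_def by unfold_locales auto
    show ?thesis unfolding F_def X_def by (rule rcd.real_critical_points_signature)
  qed
  then show ?thesis
    using cd.discriminant_eq_det_zero unfolding F_def X_def by blast
qed

end
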